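(* Let $E$ be a graph satisfying Condition (K) and let $K$ be a field. Then the set of prime ideals of $L_K(E)$ is $$\left\{I(\Omega(M),B_{\Omega(M)}),\ I(\Omega(v),B_{\Omega(v)}\setminus\{v\}) : M\in M(E),\ v\in BV(E)\right\}.$$ In particular, if $E$ has no proper maximal tails (i.e. no maximal tail $M\subsetneq E^0$) and no breaking vertices, then $L_K(E)$ is simple.
   Context: A graph $E=(E^0,E^1,r,s)$ consists of countable sets $E^0$ (vertices, here nonempty) and $E^1$ (edges) and range and source maps $r,s:E^1\to E^0$. A path of length $n\ge 1$ is $\alpha=e_1\cdots e_n$ with $r(e_i)=s(e_{i+1})$; $s(\alpha)=s(e_1)$, $r(\alpha)=r(e_n)$; vertices are paths of length $0$. Write $v\ge w$ if there is a path from $v$ to $w$. A closed path based at $v$ is a path $\alpha=e_1\cdots e_n$, $n\geq 1$, with $s(\alpha)=r(\alpha)=v$; it is a closed simple path if moreover $s(e_i)\ne s(e_1)$ for all $i>1$. $E$ satisfies Condition (K) if every vertex is either the base of no closed path or the base of at least two distinct closed simple paths. For a field $K$, $L_K(E)$ is the universal $K$-algebra generated by pairwise orthogonal idempotents $\{v:v\in E^0\}$ and elements $\{e,e^*:e\in E^1\}$ subject to: $s(e)e=er(e)=e$; $r(e)e^*=e^*s(e)=e^*$; $e^*f=\delta_{e,f}r(e)$; and $v=\sum_{s(e)=v}ee^*$ whenever $0<|s^{-1}(v)|<\infty$. $X\subseteq E^0$ is hereditary if $s(e)\in X$ implies $r(e)\in X$, and saturated if every $v$ with $0<|s^{-1}(v)|<\infty$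 and $r(s^{-1}(v))\subseteq X$ lies in $X$. For $H$ saturated hereditary, $B_H:=\{v\in E^0\setminus H: |s^{-1}(v)|=\infty,\ 0<|s^{-1}(v)\cap r^{-1}(E^0\setminus H)|<\infty\}$ and, for $v\in B_H$, $v^H:=v-\sum_{s(e)=v,\,r(e)\notin H}ee^*$. For $S\subseteq B_H$, $I(H,S)$ is the (two-sided) ideal generated by $\{v:v\in H\}\cup\{v^H:v\in S\}$. A proper ideal $I$ of a ring $A$ is prime if $J_1J_2\subseteq I$ for ideals $J_1,J_2$ of $A$ implies $J_1\subseteq I$ or $J_2\subseteq I$. $M(E)$ is the set of maximal tails: nonempty $M\subseteq E^0$ such that (MT1) if $v\in E^0$, $w\in M$, $v\ge w$, then $v\in M$; (MT2) if $v\in M$ with $0<|s^{-1}(v)|<\infty$, there is $e\in E^1$ with $s(e)=v$ and $r(e)\in M$; (MT3) for all $v,w\in M$ there is $y\in M$ with $v\ge y$ and $w\ge y$. For nonempty $X\subseteq E^0$, $\Omega(X):=\{w\in E^0\setminus X: w\not\ge v \text{ for every } v\in X\}$, and $\Omega(v):=\Omega(\{v\})$. If $M$ is a maximal tail, or if $v$ is an infinite emitter, then $\Omega(M)$, respectively $\Omega(v)$, is hereditary and saturated. The set of breaking vertices is $BV(E):=\{v\in E^0:|s^{-1}(v)|=\infty,\ 0<|s^{-1}(v)\setminus r^{-1}(\Omega(v))|<\infty\}$. *)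

theory Defs
  imports
    "Graph_Theory.Graph_Theory"
    "HOL-Library.Countable_Set"
    "HOL-Library.Poly_Mapping"
    "HOL-Algebra.QuotRing"
    "HOL-Algebra.Ideal_Product"
begin

section \<open>Graphs\<close>

text \<open>
  A graph is a \<^locale>\<open>wf_digraph\<close>, where \<^const>\<open>tail\<close> is the source map \<open>s\<close> and
  \<^const>\<open>head\<close> is the range map \<open>r\<close>, so that \<^term>\<open>out_arcs G v\<close> is the set of edges
  emitted by \<open>v\<close>.  Loops, parallel edges and infinitely many vertices or edges are allowed.
  A path is a \<^const>\<open>pre_digraph.awalk\<close>, i.e. its list of edges together with its two end
  points; the empty list stands for a path of length 0.
\<close>

definition path_ge :: "('v, 'e) pre_digraph \<Rightarrow> 'v \<Rightarrow> 'v \<Rightarrow> bool" where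
  "path_ge G v w \<longleftrightarrow> (\<exists>p. pre_digraph.awalk G v p w)"

definition closed_path :: "('v, 'e) pre_digraph \<Rightarrow> 'v \<Rightarrow> 'e list \<Rightarrow> bool" where
  "closed_path G v p \<longleftrightarrow> p \<noteq> [] \<and> pre_digraph.awalk G v p v"

definition closed_simple_path :: "('v, 'e) pre_digraph \<Rightarrow> 'v \<Rightarrow> 'e list \<Rightarrow> bool" where
  "closed_simple_path G v p \<longleftrightarrow>
     closed_path G v p \<and> (\<forall>e\<in>set (tl p). tail G e \<noteq> tail G (hd p))"

definition condition_K :: "('v, 'e) pre_digraph \<Rightarrow> bool" where
  "condition_K G \<longleftrightarrow>
     (\<forall>v\<in>verts G. (\<nexists>p. closed_path G v p) \<or>
        (\<exists>p q. p \<noteq> q \<and> closed_simple_path G v p \<and> closed_simple_path G v q))"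

text \<open>The regular vertices are those with \<open>0 < |s\<^sup>-\<^sup>1(v)| < \<infinity>\<close>.\<close>

definition regular_vertex :: "('v, 'e) pre_digraph \<Rightarrow> 'v \<Rightarrow> bool" where
  "regular_vertex G v \<longleftrightarrow> v \<in> verts G \<and> finite (out_arcs G v) \<and> out_arcs G v \<noteq> {}"

definition maximal_tail :: "('v, 'e) pre_digraph \<Rightarrow> 'v set \<Rightarrow> bool" where
  "maximal_tail G M \<longleftrightarrow>
     M \<noteq> {} \<and> M \<subseteq> verts G \<and>
     (\<forall>v\<in>verts G. \<forall>w\<in>M. path_ge G v w \<longrightarrow> v \<in> M) \<and>
     (\<forall>v\<in>M. regular_vertex G v \<longrightarrow> (\<exists>e\<in>out_arcs G v. head G e \<in> M)) \<and>
     (\<forall>v\<in>M. \<forall>w\<in>M. \<exists>y\<in>M. path_ge G v y \<and> path_ge G w y)"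

definition Omega :: "('v, 'e) pre_digraph \<Rightarrow> 'v set \<Rightarrow> 'v set" where
  "Omega G X = {w \<in> verts G - X. \<forall>v\<in>X. \<not> path_ge G w v}"

definition breaking_vertices_of :: "('v, 'e) pre_digraph \<Rightarrow> 'v set \<Rightarrow> 'v set" where
  "breaking_vertices_of G H =
     {v \<in> verts G - H. infinite (out_arcs G v) \<and>
        finite {e \<in> out_arcs G v. head G e \<in> verts G - H} \<and>
        {e \<in> out_arcs G v. head G e \<in> verts G - H} \<noteq> {}}"

definition breaking_vertices :: "('v, 'e) pre_digraph \<Rightarrow> 'v set" where
  "breaking_vertices G =
     {v \<in> verts G. infinite (out_arcs G v) \<and>
        finite {e \<in> out_arcs G v. head G e \<notin> Omega G {v}} \<and>
        {e \<in> out_arcs G v. head G e \<notin> Omega G {v}} \<noteq> {}}"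

section \<open>Ideals of rings without unit\<close>

text \<open>
  A Leavitt path algebra has a unit only if the graph has finitely many vertices, whereas the
  locales \<^locale>\<open>ring\<close> and \<^locale>\<open>ideal\<close> require one.  The definitions of this section never
  refer to the field \<^const>\<open>one\<close> of the record.
\<close>

definition two_sided_ideal :: "('a, 'b) ring_scheme \<Rightarrow> 'a set \<Rightarrow> bool" where
  "two_sided_ideal A I \<longleftrightarrow>
     additive_subgroup I A \<and>
     (\<forall>x\<in>I. \<forall>a\<in>carrier A. a \<otimes>\<^bsub>A\<^esub> x \<in> I \<and> x \<otimes>\<^bsub>A\<^esub> a \<in> I)"

lemma two_sided_ideal_iff_ideal: "ring A \<Longrightarrow> two_sided_ideal A I \<longleftrightarrow> ideal I A"
  by (auto simp: two_sided_ideal_def ideal_def ideal_axioms_def abelian_subgroup_def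
      additive_subgroup_def intro: ring.is_abelian_group)

definition ideal_generated_by :: "('a, 'b) ring_scheme \<Rightarrow> 'a set \<Rightarrow> 'a set" where
  "ideal_generated_by A S = \<Inter>{I. two_sided_ideal A I \<and> S \<subseteq> I}"

definition prime_ideal :: "('a, 'b) ring_scheme \<Rightarrow> 'a set \<Rightarrow> bool" where
  "prime_ideal A I \<longleftrightarrow>
     two_sided_ideal A I \<and> I \<noteq> carrier A \<and>
     (\<forall>J\<^sub>1 J\<^sub>2. two_sided_ideal A J\<^sub>1 \<and> two_sided_ideal A J\<^sub>2 \<and> ideal_prod A J\<^sub>1 J\<^sub>2 \<subseteq> I \<longrightarrow>
        J\<^sub>1 \<subseteq> I \<or> J\<^sub>2 \<subseteq> I)"

definition simple_ring :: "('a, 'b) ring_scheme \<Rightarrow> bool" where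
  "simple_ring A \<longleftrightarrow>
     (\<exists>x\<in>carrier A. \<exists>y\<in>carrier A. x \<otimes>\<^bsub>A\<^esub> y \<noteq> \<zero>\<^bsub>A\<^esub>) \<and>
     (\<forall>I. two_sided_ideal A I \<longrightarrow> I = {\<zero>\<^bsub>A\<^esub>} \<or> I = carrier A)"

section \<open>Free algebras\<close>

datatype 'x free_monoid = Word (letters: "'x list")

instantiation free_monoid :: (type) monoid_add
begin

definition zero_free_monoid :: "'a free_monoid" where
  "0 = Word []"

definition plus_free_monoid :: "'a free_monoid \<Rightarrow> 'a free_monoid \<Rightarrow> 'a free_monoid" where
  "u + v = Word (letters u @ letters v)"

instance
  by standard (simp_all add: zero_free_monoid_def plus_free_monoid_def)

end

text \<open>
  The multiplication of \<^typ>\<open>'x free_monoid \<Rightarrow>\<^sub>0 'k\<close> is the convolution product, so this type is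
  the unital associative algebra of noncommutative polynomials over \<open>'k\<close>.
\<close>

type_synonym ('x, 'k) nc_poly = "'x free_monoid \<Rightarrow>\<^sub>0 'k"

definition gen :: "'x \<Rightarrow> ('x, 'k::field) nc_poly" where
  "gen x = Poly_Mapping.single (Word [x]) 1"

definition free_algebra :: "'x set \<Rightarrow> ('x, 'k::field) nc_poly ring" where
  "free_algebra X =
     \<lparr>carrier = {f. \<forall>w\<in>Poly_Mapping.keys f. set (letters w) \<subseteq> X},
      mult = (*), one = 1, zero = 0, add = (+)\<rparr>"

text \<open>The free algebra without unit: the polynomials with constant coefficient 0.\<close>

definition free_algebra_nonunital :: "'x set \<Rightarrow> ('x, 'k::field) nc_poly ring" where
  "free_algebra_nonunital X =
     (free_algebra X)\<lparr>carrier := {f \<in> carrier (free_algebra X). Poly_Mapping.lookup f 0 = 0}\<rparr>"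

lemma ring_free_algebra: "ring (free_algebra X :: ('x, 'k::field) nc_poly ring)"
proof -
  let ?F = "free_algebra X :: ('x, 'k) nc_poly ring"
  have sel: "mult ?F = (*)" "monoid.one ?F = 1" "ring.zero ?F = 0" "add ?F = (+)"
    by (simp_all add: free_algebra_def)
  have add: "f + g \<in> carrier ?F" if "f \<in> carrier ?F" "g \<in> carrier ?F" for f g
    using that Poly_Mapping.keys_add[of f g] unfolding free_algebra_def by fastforce
  have zero: "0 \<in> carrier ?F" and one: "1 \<in> carrier ?F"
    by (simp_all add: free_algebra_def zero_free_monoid_def)
  have neg: "- f \<in> carrier ?F" if "f \<in> carrier ?F" for f
    using that by (simp add: free_algebra_def keys.rep_eq)
  have mult: "f * g \<in> carrier ?F" if "f \<in> carrier ?F" "g \<in> carrier ?F" for f g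
    using that Poly_Mapping.keys_mult[of f g] unfolding free_algebra_def
    by (fastforce simp: plus_free_monoid_def)
  have "abelian_group ?F"
  proof (rule abelian_groupI)
    show "\<exists>g\<in>carrier ?F. g \<oplus>\<^bsub>?F\<^esub> f = \<zero>\<^bsub>?F\<^esub>" if "f \<in> carrier ?F" for f
      using neg[OF that] by (intro bexI[of _ "- f"]) (simp_all add: sel)
  qed (simp_all add: sel add zero ac_simps)
  moreover have "monoid ?F"
    by (rule monoidI) (simp_all add: sel mult one mult.assoc)
  ultimately show ?thesis
    by (rule ringI) (simp_all add: sel distrib_left distrib_right)
qed

section \<open>Leavitt path algebras\<close>

datatype ('v, 'e) lpa_gen = Vertex 'v | Edge 'e | Ghost 'e

definition lpa_gens :: "('v, 'e) pre_digraph \<Rightarrow> ('v, 'e) lpa_gen set" where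
  "lpa_gens G = Vertex ` verts G \<union> Edge ` arcs G \<union> Ghost ` arcs G"

abbreviation vx :: "'v \<Rightarrow> (('v, 'e) lpa_gen, 'k::field) nc_poly" where
  "vx v \<equiv> gen (Vertex v)"

abbreviation ed :: "'e \<Rightarrow> (('v, 'e) lpa_gen, 'k::field) nc_poly" where
  "ed e \<equiv> gen (Edge e)"

abbreviation gh :: "'e \<Rightarrow> (('v, 'e) lpa_gen, 'k::field) nc_poly" where
  "gh e \<equiv> gen (Ghost e)"

text \<open>Each defining relation \<open>a = b\<close> is recorded as the element \<open>a - b\<close>.\<close>

definition lpa_relations :: "('v, 'e) pre_digraph \<Rightarrow> (('v, 'e) lpa_gen, 'k::field) nc_poly set" where
  "lpa_relations G =
     {vx v * vx w - (if v = w then vx v else 0) | v w. v \<in> verts G \<and> w \<in> verts G} \<union>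
     {vx (tail G e) * ed e - ed e | e. e \<in> arcs G} \<union>
     {ed e * vx (head G e) - ed e | e. e \<in> arcs G} \<union>
     {vx (head G e) * gh e - gh e | e. e \<in> arcs G} \<union>
     {gh e * vx (tail G e) - gh e | e. e \<in> arcs G} \<union>
     {gh e * ed f - (if e = f then vx (head G e) else 0) | e f. e \<in> arcs G \<and> f \<in> arcs G} \<union>
     {vx v - (\<Sum>e\<in>out_arcs G v. ed e * gh e) | v. regular_vertex G v}"

text \<open>
  The ideal of relations is generated inside the unital free algebra, which contains the scalars;
  it is therefore a \<open>'k\<close>-subspace.  It consists of polynomials with constant coefficient 0, and
  it is the smallest algebra ideal of the nonunital free algebra that contains the relations.
\<close>

definition lpa_relation_ideal ::
    "('v, 'e) pre_digraph \<Rightarrow> (('v, 'e) lpa_gen, 'k::field) nc_poly set" where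
  "lpa_relation_ideal G = Idl\<^bsub>free_algebra (lpa_gens G)\<^esub> (lpa_relations G)"

text \<open>
  The field \<^const>\<open>one\<close> of the following record is a junk value outside the carrier.
\<close>

definition lpa ::
    "'k::field itself \<Rightarrow> ('v, 'e) pre_digraph \<Rightarrow> (('v, 'e) lpa_gen, 'k) nc_poly set ring" where
  "lpa _ G = free_algebra_nonunital (lpa_gens G) Quot lpa_relation_ideal G"

definition lpa_class ::
    "('v, 'e) pre_digraph \<Rightarrow> (('v, 'e) lpa_gen, 'k::field) nc_poly \<Rightarrow>
     (('v, 'e) lpa_gen, 'k) nc_poly set" where
  "lpa_class G f = lpa_relation_ideal G +>\<^bsub>free_algebra_nonunital (lpa_gens G)\<^esub> f"

text \<open>A representative of \<open>v\<^sup>H\<close>; the sum is finite for \<^term>\<open>v \<in> breaking_vertices_of G H\<close>.\<close>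

definition breaking_elem ::
    "('v, 'e) pre_digraph \<Rightarrow> 'v set \<Rightarrow> 'v \<Rightarrow> (('v, 'e) lpa_gen, 'k::field) nc_poly" where
  "breaking_elem G H v = vx v - (\<Sum>e\<in>{e \<in> out_arcs G v. head G e \<notin> H}. ed e * gh e)"

definition lpa_ideal ::
    "'k::field itself \<Rightarrow> ('v, 'e) pre_digraph \<Rightarrow> 'v set \<Rightarrow> 'v set \<Rightarrow>
     (('v, 'e) lpa_gen, 'k) nc_poly set set" where
  "lpa_ideal k G H S =
     ideal_generated_by (lpa k G)
       ((\<lambda>v. lpa_class G (vx v)) ` H \<union> (\<lambda>v. lpa_class G (breaking_elem G H v)) ` S)"

end

theory Submission
  imports Defs
begin

text \<open>
  An ideal of \<open>L\<^sub>K(E)\<close> shows two kinds of elements on the surface: the vertices that it contains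
  and, if \<open>H\<close> is the set of these vertices, the elements \<open>v\<^sup>H\<close> that it contains.  Under
  Condition (K) they determine the ideal.  The reason is the reduction theorem (lemma
  \<open>reduction\<close>): an ideal that is strictly larger than the ideal generated by \<open>H\<close> and
  \<open>{v\<^sup>H : v \<in> S}\<close> contains a further vertex or a further \<open>v\<^sup>H\<close>.  To find one, write an element
  of the larger ideal as a linear combination of products \<open>\<alpha>\<beta>\<^sup>*\<close> and shrink it by multiplications.
  Multiplying by edges from the right removes the ghost paths \<open>\<beta>\<^sup>*\<close>, unless the element is of the
  form \<open>p (v - \<Sum> e e\<^sup>*)\<close>, and then a gap \<open>v - \<Sum> e e\<^sup>*\<close> can be split off.  Multiplying by the ghost of
  a shortest path from the left leaves a multiple of a vertex plus closed paths at it.  If there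
  are closed paths, Condition (K) provides two closed simple paths \<open>\<gamma>\<close>; no closed path starts with
  both, so conjugation by one of them, \<open>x \<mapsto> \<gamma>\<^sup>* x \<gamma>\<close>, kills one of the terms and keeps the vertex.

  Hence every ideal is some \<open>I(H, S)\<close> (lemma \<open>ideal_is_generated\<close>), and primeness becomes a
  statement about the graph.  Let \<open>P = I(H, S)\<close> be prime.  For vertices \<open>v, w \<notin> H\<close> some product
  \<open>v \<alpha>\<beta>\<^sup>* w\<close> is not in \<open>P\<close>, and the common end of \<open>\<alpha>\<close> and \<open>\<beta>\<close> is the vertex that (MT3) asks for; so
  the complement of \<open>H\<close> is a maximal tail.  The same argument with \<open>v\<^sup>H\<close> in place of \<open>v\<close> forces
  \<open>\<alpha>\<close> to be trivial, because \<open>v\<^sup>H e\<close> is in \<open>P\<close> for every edge \<open>e\<close>.  So if \<open>v\<^sup>H \<notin> P\<close>, then every vertex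
  outside \<open>H\<close> reaches \<open>v\<close>, and \<open>v\<close> is the only vertex of this kind
  (lemma \<open>prime_is_generated\<close>).

  Conversely, let two ideals contain \<open>P\<close> properly, where \<open>P\<close> is one of the listed ideals.  By the
  reduction theorem each of them contains a vertex outside \<open>H\<close> or the exceptional \<open>v\<^sup>H\<close>, and by
  (MT3), or because all vertices outside \<open>H\<close> reach \<open>v\<close>, they contain a common idempotent
  outside \<open>P\<close>.  That this idempotent is not in \<open>P\<close> is shown by a representation in which \<open>P\<close> acts as
  zero: \<open>L\<^sub>K(E)\<close> acts on functions on \<open>E\<^sup>0 \<times> \<nat>\<close> by a branching system (lemmas \<open>vx_not_generated\<close>
  and \<open>breaking_elem_not_generated\<close>).

  For simplicity, an ideal that contains some but not all vertices leaves room for a maximal tail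
  outside \<open>H\<close>, built by walking along edges outside \<open>H\<close> for ever (lemma \<open>exists_maximal_tail\<close>).

  All computations take place in the ring of noncommutative polynomials, as congruences modulo an
  ideal; the ideals of the Leavitt path algebra are translated to ideals of that ring.
\<close>

section \<open>Ideals as sets of ring elements\<close>

locale type_ideal =
  fixes J :: "'a::ring_1 set"
  assumes zero_mem: "0 \<in> J"
    and add_mem: "\<lbrakk>x \<in> J; y \<in> J\<rbrakk> \<Longrightarrow> x + y \<in> J"
    and mult_left_mem: "x \<in> J \<Longrightarrow> a * x \<in> J"
    and mult_right_mem: "x \<in> J \<Longrightarrow> x * a \<in> J"
begin

lemma minus_mem: "x \<in> J \<Longrightarrow> - x \<in> J"
  using mult_left_mem[of x "-1"] by simp

lemma diff_mem: "\<lbrakk>x \<in> J; y \<in> J\<rbrakk> \<Longrightarrow> x - y \<in> J"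
  using add_mem[of x "- y"] minus_mem by simp

lemma sum_mem: "(\<And>i. i \<in> A \<Longrightarrow> f i \<in> J) \<Longrightarrow> sum f A \<in> J"
  by (induction A rule: infinite_finite_induct) (auto intro: zero_mem add_mem)

definition eqv :: "'a \<Rightarrow> 'a \<Rightarrow> bool" (infix "\<approx>" 50)
  where "f \<approx> g \<longleftrightarrow> f - g \<in> J"

lemma eqv_refl [simp, intro]: "f \<approx> f"
  by (simp add: eqv_def zero_mem)

lemma eqv_sym: "f \<approx> g \<Longrightarrow> g \<approx> f"
  unfolding eqv_def using minus_mem[of "f - g"] by simp

lemma eqv_trans [trans]: "\<lbrakk>f \<approx> g; g \<approx> h\<rbrakk> \<Longrightarrow> f \<approx> h"
  unfolding eqv_def using add_mem[of "f - g" "g - h"] by simp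

lemma eqv_add: "\<lbrakk>f \<approx> f'; g \<approx> g'\<rbrakk> \<Longrightarrow> f + g \<approx> f' + g'"
  unfolding eqv_def using add_mem[of "f - f'" "g - g'"] by (simp add: algebra_simps)

lemma eqv_diff: "\<lbrakk>f \<approx> f'; g \<approx> g'\<rbrakk> \<Longrightarrow> f - g \<approx> f' - g'"
  unfolding eqv_def using diff_mem[of "f - f'" "g - g'"] by (simp add: algebra_simps)

lemma eqv_mult: "\<lbrakk>f \<approx> f'; g \<approx> g'\<rbrakk> \<Longrightarrow> f * g \<approx> f' * g'"
  unfolding eqv_def
  using add_mem[OF mult_right_mem[of "f - f'" g] mult_left_mem[of "g - g'" f']]
  by (simp add: algebra_simps)

lemma eqv_mult_left: "g \<approx> g' \<Longrightarrow> f * g \<approx> f * g'"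
  by (rule eqv_mult) auto

lemma eqv_mult_right: "f \<approx> f' \<Longrightarrow> f * g \<approx> f' * g"
  by (rule eqv_mult) auto

lemma eqv_sum: "(\<And>i. i \<in> A \<Longrightarrow> f i \<approx> g i) \<Longrightarrow> sum f A \<approx> sum g A"
  by (induction A rule: infinite_finite_induct) (auto intro: eqv_add)

lemma eqv_zero_iff: "f \<approx> 0 \<longleftrightarrow> f \<in> J"
  by (simp add: eqv_def)

lemma eqv_mem_iff: "f \<approx> g \<Longrightarrow> f \<in> J \<longleftrightarrow> g \<in> J"
  using eqv_sym eqv_trans eqv_zero_iff by blast

lemma eqv_mem_super:
  assumes "f \<approx> g" "type_ideal L" "J \<subseteq> L"
  shows "f \<in> L \<longleftrightarrow> g \<in> L"
proof -
  interpret L: type_ideal L by fact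
  have "f - g \<in> L" using assms unfolding eqv_def by auto
  then show ?thesis
    using L.add_mem[of "f - g" g] L.diff_mem[of f "f - g"] by auto
qed

end

lemma type_ideal_Int: "type_ideal I \<Longrightarrow> type_ideal J \<Longrightarrow> type_ideal (I \<inter> J)"
  by (simp add: type_ideal_def)

abbreviation ideal_plus :: "'a::plus set \<Rightarrow> 'a set \<Rightarrow> 'a set" where
  "ideal_plus I J \<equiv> {x + y | x y. x \<in> I \<and> y \<in> J}"

lemma type_ideal_sum:
  assumes "type_ideal I" "type_ideal J"
  shows "type_ideal (ideal_plus I J)"
proof -
  interpret I: type_ideal I by fact
  interpret J: type_ideal J by fact
  show ?thesis
  proof
    show "0 \<in> ideal_plus I J"
      using I.zero_mem J.zero_mem by force
    show "a + b \<in> ideal_plus I J"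
      if a: "a \<in> ideal_plus I J" and b: "b \<in> ideal_plus I J" for a b
    proof -
      obtain x y where xy: "a = x + y" "x \<in> I" "y \<in> J"
        using a by blast
      obtain x' y' where xy': "b = x' + y'" "x' \<in> I" "y' \<in> J"
        using b by blast
      from xy xy' show ?thesis
        using I.add_mem J.add_mem
        by (intro CollectI exI[of _ "x + x'"] exI[of _ "y + y'"]) (auto simp: algebra_simps)
    qed
    show "c * a \<in> ideal_plus I J" "a * c \<in> ideal_plus I J"
      if "a \<in> ideal_plus I J" for a c
      using that I.mult_left_mem J.mult_left_mem I.mult_right_mem J.mult_right_mem
      by (auto simp: distrib_left distrib_right) blast+
  qed
qed

section \<open>Noncommutative polynomials\<close>

lemma poly_mapping_eq_sum_single:
  "f = (\<Sum>w\<in>Poly_Mapping.keys f. Poly_Mapping.single w (Poly_Mapping.lookup f w))"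
  by (rule poly_mapping_eqI)
     (auto simp: lookup_sum lookup_single when_def sum.delta in_keys_iff)

definition scal :: "'k \<Rightarrow> ('x, 'k::field) nc_poly \<Rightarrow> ('x, 'k) nc_poly"
  where "scal c f = Poly_Mapping.single 0 c * f"

definition word :: "'x list \<Rightarrow> ('x, 'k::field) nc_poly"
  where "word w = Poly_Mapping.single (Word w) 1"

lemma word_Nil: "word [] = 1"
  by (simp add: word_def flip: zero_free_monoid_def)

lemma word_Cons: "word (x # w) = gen x * word w"
  by (simp add: word_def gen_def mult_single plus_free_monoid_def)

lemma scal_word: "scal c (word w) = Poly_Mapping.single (Word w) c"
  by (simp add: word_def scal_def mult_single)

lemma scal_add: "scal c (f + g) = scal c f + scal c g"
  by (simp add: scal_def distrib_left)

lemma scal_0 [simp]: "scal 0 f = 0"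
  by (simp add: scal_def)

lemma scal_1 [simp]: "scal 1 f = f"
  by (simp add: scal_def)

lemma scal_scal: "scal c (scal d f) = scal (c * d) f"
  by (simp add: scal_def mult_single flip: mult.assoc)

lemma scal_add_left: "scal (c + d) f = scal c f + scal d f"
  by (simp add: scal_def single_add distrib_right)

lemma scal_mult_left: "scal c f * g = scal c (f * g)"
  by (simp add: scal_def mult.assoc)

lemma nc_poly_expand:
  "f = (\<Sum>w\<in>Poly_Mapping.keys f. scal (Poly_Mapping.lookup f w) (word (letters w)))"
  by (subst poly_mapping_eq_sum_single) (simp add: scal_word)

lemma scal_mult_right: "f * scal c g = scal c (f * g)"
proof -
  have "f * Poly_Mapping.single 0 c = Poly_Mapping.single 0 c * f"
    by (subst (1 2) poly_mapping_eq_sum_single)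
       (simp add: sum_distrib_left sum_distrib_right mult_single mult.commute)
  then show ?thesis
    by (simp add: scal_def flip: mult.assoc)
qed

lemma keys_gen [simp]: "Poly_Mapping.keys (gen x) = {Word [x]}"
  by (simp add: gen_def)

lemma plus_free_monoid_eq_0_iff: "u + v = (0::'x free_monoid) \<longleftrightarrow> u = 0 \<and> v = 0"
  by (cases u; cases v) (auto simp: plus_free_monoid_def zero_free_monoid_def)

text \<open>
  The Leavitt path algebra is a quotient of the algebra without unit.  Ideals of the full polynomial
  ring that come from it consist of polynomials without constant term.
\<close>

definition const_free :: "('x, 'k::field) nc_poly set"
  where "const_free = {f. Poly_Mapping.lookup f 0 = 0}"

lemma type_ideal_const_free: "type_ideal const_free"
proof
  have "0 \<in> Poly_Mapping.keys f \<and> 0 \<in> Poly_Mapping.keys g" if 0: "0 \<in> Poly_Mapping.keys (f * g)"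
    for f g :: "('x, 'k::field) nc_poly"
  proof -
    obtain u v where "0 = u + v" "u \<in> Poly_Mapping.keys f" "v \<in> Poly_Mapping.keys g"
      using 0 Poly_Mapping.keys_mult[of f g] by blast
    then show ?thesis by (metis plus_free_monoid_eq_0_iff)
  qed
  then show "a * x \<in> const_free" "x * a \<in> const_free"
    if "x \<in> const_free" for x a :: "('x, 'k::field) nc_poly"
    using that by (auto simp: const_free_def in_keys_iff)
qed (auto simp: const_free_def lookup_add)

lemma gen_const_free [simp]: "gen x \<in> const_free"
  by (simp add: const_free_def gen_def lookup_single when_def zero_free_monoid_def)

section \<open>Linear spans modulo an ideal\<close>

text \<open>
  The sum of \<open>I\<close> and the linear span of \<open>B\<close>, built up one term at a time so that an induction can
  treat the terms of a linear combination one by one.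
\<close>

inductive_set span_mod :: "('x, 'k::field) nc_poly set \<Rightarrow> ('x, 'k) nc_poly set \<Rightarrow> ('x, 'k) nc_poly set"
  for I :: "('x, 'k::field) nc_poly set" and B where
  base: "f \<in> I \<Longrightarrow> f \<in> span_mod I B"
| step: "\<lbrakk>f \<in> span_mod I B; b \<in> B\<rbrakk> \<Longrightarrow> f + scal c b \<in> span_mod I B"

lemma span_mod_mono: "f \<in> span_mod J B \<Longrightarrow> B \<subseteq> B' \<Longrightarrow> f \<in> span_mod J B'"
  by (induction rule: span_mod.induct) (auto intro: span_mod.intros)

locale poly_ideal = type_ideal J for J :: "('x, 'k::field) nc_poly set"
begin

lemma scal_mem: "f \<in> J \<Longrightarrow> scal c f \<in> J"
  by (simp add: scal_def mult_left_mem)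

lemma scal_mem_iff: "c \<noteq> 0 \<Longrightarrow> scal c f \<in> J \<longleftrightarrow> f \<in> J"
  using scal_mem[of f c] scal_mem[of "scal c f" "inverse c"] by (auto simp: scal_scal)

lemma span_mod_add:
  assumes "f \<in> span_mod J B" "g \<in> span_mod J B"
  shows "f + g \<in> span_mod J B"
  using assms(2)
proof (induction rule: span_mod.induct)
  case (base g)
  with assms(1) show ?case
  proof (induction rule: span_mod.induct)
    case (base f)
    then show ?case by (auto intro: span_mod.base add_mem)
  next
    case (step f b c)
    then have "f + g + scal c b \<in> span_mod J B" by (auto intro: span_mod.step)
    then show ?case by (simp add: algebra_simps)
  qed
next
  case (step g b c)
  then have "f + g + scal c b \<in> span_mod J B" by (auto intro: span_mod.step)
  then show ?case by (simp add: algebra_simps)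
qed

lemma span_mod_basis: "b \<in> B \<Longrightarrow> b \<in> span_mod J B"
  using span_mod.step[OF span_mod.base[OF zero_mem], of b B 1] by simp

lemma span_mod_scal: "f \<in> span_mod J B \<Longrightarrow> scal c f \<in> span_mod J B"
proof (induction rule: span_mod.induct)
  case (base f)
  then show ?case by (auto intro: span_mod.base scal_mem)
next
  case (step f b d)
  then show ?case by (auto intro: span_mod.step simp: scal_add scal_scal)
qed

lemma span_mod_eqv: "g \<in> span_mod J B \<Longrightarrow> f \<approx> g \<Longrightarrow> f \<in> span_mod J B"
  using span_mod_add[of "f - g" B g] span_mod.base[of "f - g" J B] by (simp add: eqv_def)

lemma span_mod_zero: "0 \<in> span_mod J B"
  by (intro span_mod.base zero_mem)

lemma span_mod_sum: "(\<And>i. i \<in> A \<Longrightarrow> f i \<in> span_mod J B) \<Longrightarrow> sum f A \<in> span_mod J B"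
  by (induction A rule: infinite_finite_induct) (auto intro: span_mod_zero span_mod_add)

lemma span_mod_mult_left:
  assumes "f \<in> span_mod J B" "\<And>b. b \<in> B \<Longrightarrow> a * b \<in> span_mod J B'"
  shows "a * f \<in> span_mod J B'"
  using assms(1)
proof (induction rule: span_mod.induct)
  case (base f)
  then show ?case by (auto intro: span_mod.base mult_left_mem)
next
  case (step f b c)
  then show ?case
    using assms(2) by (simp add: distrib_left scal_mult_right span_mod_add span_mod_scal)
qed

lemma span_mod_mult_right:
  assumes "f \<in> span_mod J B" "\<And>b. b \<in> B \<Longrightarrow> b * a \<in> span_mod J B'"
  shows "f * a \<in> span_mod J B'"
  using assms(1)
proof (induction rule: span_mod.induct)
  case (base f)
  then show ?case by (auto intro: span_mod.base mult_right_mem)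
next
  case (step f b c)
  then show ?case
    using assms(2) by (simp add: distrib_right scal_mult_left span_mod_add span_mod_scal)
qed

text \<open>
  Multiplication by \<open>a\<close> and \<open>b\<close> is linear and preserves the ideal, so it cannot send every basis
  element into the ideal if it does not send \<open>f\<close> there.
\<close>

lemma span_mod_sandwich:
  assumes "f \<in> span_mod J B" "a * f * b \<notin> J"
  obtains m where "m \<in> B" "a * m * b \<notin> J"
proof -
  have "a * f * b \<in> J" if "\<forall>m\<in>B. a * m * b \<in> J"
    using assms(1)
  proof (induction rule: span_mod.induct)
    case (base f)
    then show ?case by (auto intro: mult_right_mem mult_left_mem)
  next
    case (step f m c)
    then show ?case
      using that by (simp add: distrib_left distrib_right scal_mult_right scal_mult_left add_mem scal_mem)
  qed
  then show ?thesis using assms(2) that by blast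
qed

end

section \<open>Paths and ghost paths\<close>

type_synonym ('v, 'e, 'k) lpa_poly = "(('v, 'e) lpa_gen, 'k) nc_poly"

text \<open>
  The ideals of the Leavitt path algebra are represented by their preimages in the ring of all
  polynomials.  The letters of the type that are not generators of the graph belong to every such
  ideal.  This makes it an ideal of the whole ring, so that congruences may be multiplied by arbitrary
  polynomials and the identities below hold for all vertices and edges of the type.
\<close>

locale leavitt_ideal = wf_digraph G + poly_ideal J
  for G :: "('v, 'e) pre_digraph" and J :: "('v, 'e, 'k::field) lpa_poly set" +
  assumes relations: "lpa_relations G \<subseteq> J"
    and outside: "x \<notin> lpa_gens G \<Longrightarrow> gen x \<in> J"
    and const_free: "J \<subseteq> const_free"

lemma leavitt_ideal_type_ideal: "leavitt_ideal G J \<Longrightarrow> type_ideal J"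
  by (simp add: leavitt_ideal_def poly_ideal_def)

fun left_vertex :: "('v, 'e) pre_digraph \<Rightarrow> ('v, 'e) lpa_gen \<Rightarrow> 'v" where
  "left_vertex G (Vertex v) = v"
| "left_vertex G (Edge e) = tail G e"
| "left_vertex G (Ghost e) = head G e"

fun right_vertex :: "('v, 'e) pre_digraph \<Rightarrow> ('v, 'e) lpa_gen \<Rightarrow> 'v" where
  "right_vertex G (Vertex v) = v"
| "right_vertex G (Edge e) = head G e"
| "right_vertex G (Ghost e) = tail G e"

text \<open>
  A walk \<open>e\<^sub>1 \<dots> e\<^sub>n\<close> ending in \<open>v\<close> is turned into \<open>e\<^sub>1 \<dots> e\<^sub>n v\<close>, and by the next function into
  \<open>v e\<^sub>n\<^sup>* \<dots> e\<^sub>1\<^sup>*\<close>.  The final vertex lets the empty walk stand for \<open>v\<close>.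
\<close>

fun path :: "'e list \<Rightarrow> 'v \<Rightarrow> ('v, 'e, 'k::field) lpa_poly" where
  "path [] v = vx v"
| "path (e # p) v = ed e * path p v"

fun ghost :: "'e list \<Rightarrow> 'v \<Rightarrow> ('v, 'e, 'k::field) lpa_poly" where
  "ghost [] v = vx v"
| "ghost (e # p) v = ghost p v * gh e"

context leavitt_ideal
begin

lemma gen_in_gens_iff:
  "Vertex v \<in> lpa_gens G \<longleftrightarrow> v \<in> verts G"
  "Edge e \<in> lpa_gens G \<longleftrightarrow> e \<in> arcs G"
  "Ghost e \<in> lpa_gens G \<longleftrightarrow> e \<in> arcs G"
  by (auto simp: lpa_gens_def)

lemma vx_mult_vx: "vx v * vx w \<approx> (if v = w then vx v else 0)"
proof (cases "v \<in> verts G \<and> w \<in> verts G")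
  case True
  then have "vx v * vx w - (if v = w then vx v else 0) \<in> lpa_relations G"
    unfolding lpa_relations_def by blast
  then show ?thesis
    using relations unfolding eqv_def by blast
next
  case False
  then have "gen (Vertex v) \<in> J \<or> gen (Vertex w) \<in> J"
    using outside gen_in_gens_iff(1) by blast
  then have "vx v * vx w \<in> J" "v = w \<Longrightarrow> vx v \<in> J"
    using mult_left_mem mult_right_mem by blast+
  then show ?thesis
    by (cases "v = w") (simp_all add: eqv_def diff_mem)
qed

lemma left_vertex_mult: "vx (left_vertex G x) * gen x \<approx> gen x"
proof (cases "x \<in> lpa_gens G")
  case True
  show ?thesis
  proof (cases x)
    case (Vertex v)
    then show ?thesis using vx_mult_vx[of v v] by simp
  next
    case (Edge e)
    with True have "e \<in> arcs G" by (simp add: gen_in_gens_iff)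
    then have "vx (tail G e) * ed e - ed e \<in> J"
      by (intro subsetD[OF relations]) (unfold lpa_relations_def, blast)
    then show ?thesis by (simp add: Edge eqv_def)
  next
    case (Ghost e)
    with True have "e \<in> arcs G" by (simp add: gen_in_gens_iff)
    then have "vx (head G e) * gh e - gh e \<in> J"
      by (intro subsetD[OF relations]) (unfold lpa_relations_def, blast)
    then show ?thesis by (simp add: Ghost eqv_def)
  qed
next
  case False
  then show ?thesis
    unfolding eqv_def by (intro diff_mem mult_left_mem outside)
qed

lemma right_vertex_mult: "gen x * vx (right_vertex G x) \<approx> gen x"
proof (cases "x \<in> lpa_gens G")
  case True
  show ?thesis
  proof (cases x)
    case (Vertex v)
    then show ?thesis using vx_mult_vx[of v v] by simp
  next
    case (Edge e)
    with True have "e \<in> arcs G" by (simp add: gen_in_gens_iff)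
    then have "ed e * vx (head G e) - ed e \<in> J"
      by (intro subsetD[OF relations]) (unfold lpa_relations_def, blast)
    then show ?thesis by (simp add: Edge eqv_def)
  next
    case (Ghost e)
    with True have "e \<in> arcs G" by (simp add: gen_in_gens_iff)
    then have "gh e * vx (tail G e) - gh e \<in> J"
      by (intro subsetD[OF relations]) (unfold lpa_relations_def, blast)
    then show ?thesis by (simp add: Ghost eqv_def)
  qed
next
  case False
  then show ?thesis
    unfolding eqv_def by (intro diff_mem mult_right_mem outside)
qed

lemma vx_mult_gen: "vx v * gen x \<approx> (if v = left_vertex G x then gen x else 0)"
proof -
  have "vx v * gen x \<approx> vx v * (vx (left_vertex G x) * gen x)"
    by (intro eqv_mult_left eqv_sym[OF left_vertex_mult])
  also have "\<dots> = vx v * vx (left_vertex G x) * gen x"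
    by (simp add: mult.assoc)
  also have "\<dots> \<approx> (if v = left_vertex G x then vx v else 0) * gen x"
    by (intro eqv_mult_right vx_mult_vx)
  also have "\<dots> \<approx> (if v = left_vertex G x then gen x else 0)"
    using left_vertex_mult by auto
  finally show ?thesis .
qed

lemma gen_mult_vx: "gen x * vx v \<approx> (if v = right_vertex G x then gen x else 0)"
proof -
  have "gen x * vx v \<approx> (gen x * vx (right_vertex G x)) * vx v"
    by (intro eqv_mult_right eqv_sym[OF right_vertex_mult])
  also have "\<dots> = gen x * (vx (right_vertex G x) * vx v)"
    by (simp add: mult.assoc)
  also have "\<dots> \<approx> gen x * (if right_vertex G x = v then vx (right_vertex G x) else 0)"
    by (intro eqv_mult_left vx_mult_vx)
  also have "\<dots> \<approx> (if v = right_vertex G x then gen x else 0)"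
    using right_vertex_mult by auto
  finally show ?thesis .
qed

lemma gh_mult_ed_same:
  assumes "e \<in> arcs G"
  shows "gh e * ed e \<approx> vx (head G e)"
proof -
  have "gh e * ed e - (if e = e then vx (head G e) else 0) \<in> J"
    using assms by (intro subsetD[OF relations]) (unfold lpa_relations_def, blast)
  then show ?thesis by (simp add: eqv_def)
qed

lemma gh_mult_ed_diff:
  assumes "e \<noteq> f"
  shows "gh e * ed f \<in> J"
proof (cases "e \<in> arcs G \<and> f \<in> arcs G")
  case True
  then have "gh e * ed f - (if e = f then vx (head G e) else 0) \<in> J"
    by (intro subsetD[OF relations]) (unfold lpa_relations_def, blast)
  with assms show ?thesis by simp
next
  case False
  then have "gen (Ghost e) \<in> J \<or> gen (Edge f) \<in> J"
    using outside gen_in_gens_iff by blast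
  then show ?thesis
    using mult_left_mem mult_right_mem by blast
qed

lemma regular_sum:
  assumes "regular_vertex G v"
  shows "vx v \<approx> (\<Sum>e\<in>out_arcs G v. ed e * gh e)"
proof -
  have "vx v - (\<Sum>e\<in>out_arcs G v. ed e * gh e) \<in> lpa_relations G"
    using assms unfolding lpa_relations_def by blast
  then show ?thesis
    using relations unfolding eqv_def by blast
qed

lemma vx_mult_path:
  assumes "awalk u p v"
  shows "vx w * path p v \<approx> (if w = u then path p v else 0)"
proof (cases p)
  case Nil
  then show ?thesis
    using assms vx_mult_vx[of w v] by (auto simp: awalk_Nil_iff)
next
  case (Cons e q)
  have "vx w * path p v = vx w * ed e * path q v"
    by (simp add: Cons mult.assoc)
  also have "\<dots> \<approx> (if w = tail G e then ed e else 0) * path q v"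
    using vx_mult_gen[of w "Edge e"] by (intro eqv_mult_right) simp
  also have "\<dots> = (if w = u then path p v else 0)"
    using assms by (simp add: Cons awalk_Cons_iff)
  finally show ?thesis .
qed

lemma ghost_mult_vx:
  assumes "awalk u p v"
  shows "ghost p v * vx w \<approx> (if w = u then ghost p v else 0)"
proof (cases p)
  case Nil
  then show ?thesis
    using assms vx_mult_vx[of v w] by (auto simp: awalk_Nil_iff)
next
  case (Cons e q)
  have "ghost p v * vx w = ghost q v * (gh e * vx w)"
    by (simp add: Cons mult.assoc)
  also have "\<dots> \<approx> ghost q v * (if w = tail G e then gh e else 0)"
    using gen_mult_vx[of "Ghost e" w] by (intro eqv_mult_left) simp
  also have "\<dots> = (if w = u then ghost p v else 0)"
    using assms by (simp add: Cons awalk_Cons_iff)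
  finally show ?thesis .
qed

lemma path_mult_vx: "path p v * vx w \<approx> (if v = w then path p v else 0)"
proof (induction p)
  case Nil
  show ?case using vx_mult_vx[of v w] by auto
next
  case (Cons e p)
  then show ?case
    using eqv_mult_left[OF Cons, of "ed e"] by (auto simp: mult.assoc split: if_splits)
qed

lemma vx_mult_ghost: "vx w * ghost p v \<approx> (if v = w then ghost p v else 0)"
proof (induction p)
  case Nil
  show ?case using vx_mult_vx[of w v] by auto
next
  case (Cons e p)
  then show ?case
    using eqv_mult_right[OF Cons, of "gh e"] by (auto simp: mult.assoc split: if_splits)
qed

lemma path_append:
  assumes "awalk s p u" "awalk u q v"
  shows "path (p @ q) v \<approx> path p u * path q v"
  using assms(1)
proof (induction p arbitrary: s)
  case Nil
  then show ?case
    using assms(2) eqv_sym[OF vx_mult_path[OF assms(2), of u]] by (simp add: awalk_Nil_iff)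
next
  case (Cons e p)
  then have "path (p @ q) v \<approx> path p u * path q v"
    by (auto simp: awalk_Cons_iff)
  then show ?case
    using eqv_mult_left[of _ _ "ed e"] by (simp add: mult.assoc)
qed

text \<open>
  The recursion for ghost paths adds edges on the right.  On the left a ghost edge can be added
  because it extends the walk at its end.
\<close>

lemma ghost_snoc:
  assumes "awalk s q u" "u = tail G e" "e \<in> arcs G"
  shows "ghost (q @ [e]) (head G e) \<approx> gh e * ghost q u"
  using assms(1)
proof (induction q arbitrary: s)
  case Nil
  have "ghost [e] (head G e) = vx (head G e) * gh e" by simp
  also have "\<dots> \<approx> gh e" using vx_mult_gen[of "head G e" "Ghost e"] by simp
  also have "\<dots> \<approx> gh e * vx u"
    using gen_mult_vx[of "Ghost e" u] assms(2) eqv_sym by simp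
  finally show ?case by simp
next
  case (Cons f q)
  then have "ghost (q @ [e]) (head G e) \<approx> gh e * ghost q u"
    by (auto simp: awalk_Cons_iff)
  from eqv_mult_right[OF this, of "gh f"] show ?case
    by (simp add: mult.assoc)
qed

lemma ghost_mult_path_append:
  assumes "awalk s p u" "awalk u q v"
  shows "ghost p u * path (p @ q) v \<approx> path q v"
  using assms(1)
proof (induction p arbitrary: s)
  case Nil
  then show ?case
    using vx_mult_path[OF assms(2), of u] by (simp add: awalk_Nil_iff)
next
  case (Cons e p)
  then have w: "awalk (head G e) p u" and e: "e \<in> arcs G"
    by (auto simp: awalk_Cons_iff)
  have "ghost (e # p) u * path ((e # p) @ q) v = ghost p u * (gh e * ed e) * path (p @ q) v"
    by (simp add: mult.assoc)
  also have "\<dots> \<approx> ghost p u * vx (head G e) * path (p @ q) v"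
    by (intro eqv_mult_right eqv_mult_left gh_mult_ed_same e)
  also have "\<dots> \<approx> ghost p u * path (p @ q) v"
    using ghost_mult_vx[OF w, of "head G e"] by (intro eqv_mult_right) simp
  also have "\<dots> \<approx> path q v"
    by (rule Cons.IH[OF w])
  finally show ?case .
qed

lemma ghost_mult_path_self: "awalk s p u \<Longrightarrow> ghost p u * path p u \<approx> vx u"
  using ghost_mult_path_append[of s p u "[]" u] by (simp add: awalk_Nil_iff awalk_last_in_verts)

text \<open>
  The relation \<open>e\<^sup>* f = \<delta>\<^sub>e\<^sub>f r(e)\<close> cancels common first edges one after the other, until one walk is
  used up or two different edges meet and the product vanishes.
\<close>

lemma ghost_mult_path_cases:
  assumes "awalk s p u" "awalk s q v"
  shows "(\<exists>r. q = p @ r \<and> awalk u r v) \<or> (\<exists>r. p = q @ r \<and> r \<noteq> [] \<and> awalk v r u) \<or>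
         ghost p u * path q v \<in> J"
  using assms
proof (induction p arbitrary: s q)
  case Nil
  then show ?case by (auto simp: awalk_Nil_iff)
next
  case (Cons e p)
  show ?case
  proof (cases q)
    case Nil
    then show ?thesis
      using Cons.prems by (auto simp: awalk_Nil_iff)
  next
    case q: (Cons f q')
    have w: "awalk (head G e) p u" "e \<in> arcs G" "awalk (head G f) q' v"
      using Cons.prems q by (auto simp: awalk_Cons_iff)
    show ?thesis
    proof (cases "e = f")
      case True
      have "ghost (e # p) u * path q v = ghost p u * (gh e * ed e) * path q' v"
        by (simp add: mult.assoc q True)
      also have "\<dots> \<approx> ghost p u * vx (head G e) * path q' v"
        by (intro eqv_mult_right eqv_mult_left gh_mult_ed_same w)
      also have "\<dots> \<approx> ghost p u * path q' v"
        using ghost_mult_vx[OF w(1), of "head G e"] by (intro eqv_mult_right) simp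
      finally have "ghost (e # p) u * path q v \<in> J \<longleftrightarrow> ghost p u * path q' v \<in> J"
        by (rule eqv_mem_iff)
      then show ?thesis
        using Cons.IH[OF w(1), of q'] w(3) True by (auto simp: q)
    next
      case False
      have "ghost p u * (gh e * ed f) * path q' v \<in> J"
        by (intro mult_right_mem mult_left_mem gh_mult_ed_diff False)
      then have "ghost (e # p) u * path q v \<in> J"
        by (simp add: mult.assoc q)
      then show ?thesis by blast
    qed
  qed
qed

definition monomials :: "('v, 'e, 'k) lpa_poly set" where
  "monomials = {path p w * ghost q w | u p w u' q. awalk u p w \<and> awalk u' q w}"

lemma monomialsI: "\<lbrakk>awalk u p w; awalk u' q w\<rbrakk> \<Longrightarrow> path p w * ghost q w \<in> monomials"
  unfolding monomials_def by blast

lemma vx_in_span: "vx v \<in> span_mod J monomials"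
proof (cases "v \<in> verts G")
  case True
  then have "vx v * vx v \<in> monomials"
    using monomialsI[of v "[]" v v "[]"] by (simp add: awalk_Nil_iff)
  moreover have "vx v \<approx> vx v * vx v"
    using eqv_sym[OF vx_mult_vx[of v v]] by simp
  ultimately show ?thesis
    by (intro span_mod_eqv[OF span_mod_basis])
next
  case False
  then show ?thesis by (intro span_mod.base outside) (simp add: gen_in_gens_iff)
qed

text \<open>
  This is why the products \<open>\<alpha>\<beta>\<^sup>*\<close> span the algebra: every word arises from its last letter by left
  multiplications with generators.  The only product that is not immediately such a product again is
  that of a ghost edge with a ghost path, where the edge is moved to the end of the walk.
\<close>

lemma gen_mult_monomial:
  assumes "m \<in> monomials"
  shows "gen x * m \<in> span_mod J monomials"
proof -
  obtain u p w u' q where m: "m = path p w * ghost q w" "awalk u p w" "awalk u' q w"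
    using assms unfolding monomials_def by blast
  note eqvI = span_mod_eqv[OF span_mod_basis]
  show ?thesis
  proof (cases "x \<in> lpa_gens G")
    case False
    then show ?thesis
      using outside by (intro span_mod.base mult_right_mem) auto
  next
    case True
    show ?thesis
    proof (cases x)
      case (Vertex v)
      have "gen x * m \<approx> (if v = u then path p w else 0) * ghost q w"
        unfolding m(1) Vertex mult.assoc[symmetric] by (intro eqv_mult_right vx_mult_path m(2))
      then show ?thesis
        using eqvI[OF assms] m(1) span_mod.base by (cases "v = u") (auto simp: eqv_zero_iff)
    next
      case (Edge e)
      then have e: "e \<in> arcs G" using True gen_in_gens_iff by simp
      show ?thesis
      proof (cases "head G e = u")
        case True
        then have "awalk (tail G e) (e # p) w"
          using m(2) e by (simp add: awalk_Cons_iff)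
        then have "path (e # p) w * ghost q w \<in> monomials"
          unfolding monomials_def using m(3) by blast
        then show ?thesis
          unfolding m(1) Edge by (simp add: mult.assoc span_mod_basis)
      next
        case False
        have "gen x * m \<approx> ed e * vx (head G e) * path p w * ghost q w"
          unfolding m(1) Edge mult.assoc[symmetric]
          using gen_mult_vx[of "Edge e" "head G e"]
          by (intro eqv_mult_right eqv_sym[of "_ * _" "ed e"]) simp
        also have "\<dots> = ed e * (vx (head G e) * path p w) * ghost q w"
          by (simp add: mult.assoc)
        also have "\<dots> \<approx> ed e * 0 * ghost q w"
          using vx_mult_path[OF m(2), of "head G e"] False
          by (intro eqv_mult_right eqv_mult_left) simp
        finally show ?thesis
          by (auto intro: span_mod.base simp: eqv_zero_iff)
      qed
    next
      case (Ghost e)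
      then have e: "e \<in> arcs G" using True gen_in_gens_iff by simp
      show ?thesis
      proof (cases p)
        case Nil
        then have u: "u = w" "w \<in> verts G" using m(2) by (auto simp: awalk_Nil_iff)
        have "gen x * m = gh e * vx w * ghost q w"
          by (simp add: m(1) Ghost Nil mult.assoc)
        also have "\<dots> \<approx> (if w = tail G e then gh e else 0) * ghost q w"
          using gen_mult_vx[of "Ghost e" w] by (intro eqv_mult_right) simp
        finally have eq: "gen x * m \<approx> (if w = tail G e then gh e else 0) * ghost q w" .
        show ?thesis
        proof (cases "w = tail G e")
          case True
          have aw: "awalk u' (q @ [e]) (head G e)"
            using m(3) e True by (intro awalk_appendI) (auto intro: arc_implies_awalk)
          then have "path [] (head G e) * ghost (q @ [e]) (head G e) \<in> monomials"
            using monomialsI[of "head G e" "[]"] e by (simp add: awalk_Nil_iff)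
          moreover have "gen x * m \<approx> path [] (head G e) * ghost (q @ [e]) (head G e)"
          proof -
            have "gen x * m \<approx> gh e * ghost q w" using eq True by simp
            also have "\<dots> \<approx> ghost (q @ [e]) (head G e)"
              using ghost_snoc[OF m(3) True e] eqv_sym by blast
            also have "\<dots> \<approx> path [] (head G e) * ghost (q @ [e]) (head G e)"
              using vx_mult_ghost[of "head G e" "q @ [e]" "head G e"] eqv_sym by simp
            finally show ?thesis .
          qed
          ultimately show ?thesis by (rule eqvI)
        next
          case False
          then show ?thesis
            using eq by (auto intro: span_mod.base simp: eqv_zero_iff)
        qed
      next
        case (Cons f p')
        then have w: "awalk (head G f) p' w" using m(2) by (simp add: awalk_Cons_iff)
        have eq: "gen x * m = gh e * ed f * path p' w * ghost q w"
          by (simp add: m(1) Ghost Cons mult.assoc)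
        show ?thesis
        proof (cases "e = f")
          case True
          have "gen x * m \<approx> vx (head G f) * path p' w * ghost q w"
            unfolding eq using gh_mult_ed_same[OF e] True by (intro eqv_mult_right) simp
          also have "\<dots> \<approx> path p' w * ghost q w"
            using vx_mult_path[OF w, of "head G f"] by (intro eqv_mult_right) simp
          finally have "gen x * m \<approx> path p' w * ghost q w" .
          moreover have "path p' w * ghost q w \<in> monomials"
            using w m(3) unfolding monomials_def by blast
          ultimately show ?thesis using eqvI by blast
        next
          case False
          then show ?thesis
            unfolding eq by (intro span_mod.base mult_right_mem gh_mult_ed_diff)
        qed
      qed
    qed
  qed
qed

lemma gen_in_span: "gen x \<in> span_mod J monomials"
proof -
  have "gen x * vx (right_vertex G x) \<in> span_mod J monomials"
    by (intro span_mod_mult_left[OF vx_in_span] gen_mult_monomial)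
  then show ?thesis
    using span_mod_eqv eqv_sym[OF right_vertex_mult[of x]] by blast
qed

lemma word_in_span: "w \<noteq> [] \<Longrightarrow> word w \<in> span_mod J monomials"
proof (induction w)
  case (Cons x w)
  show ?case
  proof (cases "w = []")
    case True
    then show ?thesis by (simp add: word_Nil word_Cons gen_in_span)
  next
    case False
    then show ?thesis
      unfolding word_Cons
      by (intro span_mod_mult_left[OF Cons.IH] gen_mult_monomial)
  qed
qed simp

lemma const_free_in_span:
  assumes "f \<in> const_free"
  shows "f \<in> span_mod J monomials"
proof -
  have "letters w \<noteq> []" if "w \<in> Poly_Mapping.keys f" for w
    using that assms by (cases w) (auto simp: const_free_def in_keys_iff zero_free_monoid_def)
  then show ?thesis
    by (subst nc_poly_expand)
       (intro span_mod_sum span_mod_scal word_in_span)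
qed

text \<open>
  A product \<open>\<alpha>\<beta>\<^sup>*\<close> is fixed by the source of \<open>\<beta>\<close> on its right and killed by all other vertices.  So the
  sum over all sources of ghost parts that occur is a right unit.
\<close>

lemma local_unit:
  assumes "f \<in> const_free"
  obtains V where "finite V" "V \<subseteq> verts G" "f * (\<Sum>v\<in>V. vx v) \<approx> f"
proof -
  have "\<exists>V. finite V \<and> V \<subseteq> verts G \<and> (\<forall>U. finite U \<and> V \<subseteq> U \<longrightarrow> g * (\<Sum>v\<in>U. vx v) \<approx> g)"
    if "g \<in> span_mod J monomials" for g
    using that
  proof (induction rule: span_mod.induct)
    case (base f)
    then have "f * a \<approx> f" for a
      unfolding eqv_def by (intro diff_mem mult_right_mem)
    then show ?case by auto
  next
    case (step f m c)
    obtain V where V: "finite V" "V \<subseteq> verts G" 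
        "\<forall>U. finite U \<and> V \<subseteq> U \<longrightarrow> f * (\<Sum>v\<in>U. vx v) \<approx> f"
      using step.IH by blast
    obtain u p w u' q where m: "m = path p w * ghost q w" "awalk u p w" "awalk u' q w"
      using step.hyps unfolding monomials_def by blast
    have "m * (\<Sum>v\<in>U. vx v) \<approx> m" if U: "finite U" "u' \<in> U" for U
    proof -
      have "m * (\<Sum>v\<in>U. vx v) = path p w * (\<Sum>v\<in>U. ghost q w * vx v)"
        by (simp add: m(1) mult.assoc sum_distrib_left)
      also have "\<dots> \<approx> path p w * (\<Sum>v\<in>U. if v = u' then ghost q w else 0)"
        by (intro eqv_mult_left eqv_sum ghost_mult_vx[OF m(3)])
      also have "\<dots> = m"
        using U by (simp add: m(1))
      finally show ?thesis .
    qed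
    then have "scal c (m * (\<Sum>v\<in>U. vx v)) \<approx> scal c m" if "finite U" "insert u' V \<subseteq> U" for U
      using that unfolding scal_def by (intro eqv_mult_left) auto
    then have "(f + scal c m) * (\<Sum>v\<in>U. vx v) \<approx> f + scal c m"
      if "finite U" "insert u' V \<subseteq> U" for U
      unfolding distrib_right scal_mult_left using that V(3) by (intro eqv_add) auto
    moreover have "u' \<in> verts G" using m(3) by (rule awalk_hd_in_verts)
    ultimately show ?case
      using V(1,2) by (intro exI[of _ "insert u' V"]) simp
  qed
  from this[OF const_free_in_span[OF assms]]
  show ?thesis using that by blast
qed

lemma const_free_mult_vx:
  assumes "f \<in> const_free" "f \<notin> J"
  obtains v where "v \<in> verts G" "f * vx v \<notin> J"
proof -
  obtain V where "finite V" and V: "V \<subseteq> verts G" "f * (\<Sum>v\<in>V. vx v) \<approx> f"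
    by (rule local_unit[OF assms(1)])
  have "\<exists>v\<in>V. f * vx v \<notin> J"
  proof (rule ccontr)
    assume "\<not> (\<exists>v\<in>V. f * vx v \<notin> J)"
    then have "(\<Sum>v\<in>V. f * vx v) \<in> J" by (intro sum_mem) auto
    then show False using eqv_mem_iff[OF V(2)] assms(2) by (simp add: sum_distrib_left)
  qed
  then obtain v where v: "v \<in> V" "f * vx v \<notin> J" by blast
  with V(1) show ?thesis using that by blast
qed

end

section \<open>The reduction theorem\<close>

lemma span_mod_mono_ideal: "f \<in> span_mod I B \<Longrightarrow> I \<subseteq> J \<Longrightarrow> f \<in> span_mod J B"
  by (induction rule: span_mod.induct) (auto intro: span_mod.intros)

text \<open>
  For a finite set \<open>F\<close> of edges that start in \<open>v\<close> this is, modulo the relations, an idempotent that is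
  orthogonal to the edges in \<open>F\<close>.  If \<open>F\<close> consists of all edges from \<open>v\<close> to the complement of \<open>H\<close>, it is \<open>v\<^sup>H\<close>.
\<close>

definition gap :: "'e set \<Rightarrow> 'v \<Rightarrow> ('v, 'e, 'k::field) lpa_poly" where
  "gap F v = vx v - (\<Sum>e\<in>F. ed e * gh e)"

context leavitt_ideal
begin

abbreviation path_span :: "'v \<Rightarrow> ('v, 'e, 'k) lpa_poly set" where
  "path_span v \<equiv> span_mod J {path q v | u q. awalk u q v}"

abbreviation closed_span :: "'v \<Rightarrow> ('v, 'e, 'k) lpa_poly set" where
  "closed_span v \<equiv> span_mod J {path \<beta> v | \<beta>. closed_path G v \<beta>}"

abbreviation path_sum :: "'v \<Rightarrow> ('k \<times> 'e list) list \<Rightarrow> ('v, 'e, 'k) lpa_poly" where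
  "path_sum v ts \<equiv> (\<Sum>(d, \<beta>)\<leftarrow>ts. scal d (path \<beta> v))"

lemma ghost_mult_path_cases':
  assumes "awalk s p u" "awalk s' q v"
  shows "(\<exists>r. q = p @ r \<and> awalk u r v) \<or> (\<exists>r. p = q @ r \<and> r \<noteq> [] \<and> awalk v r u) \<or>
         ghost p u * path q v \<in> J"
proof (cases "s = s'")
  case True
  then show ?thesis using ghost_mult_path_cases assms by blast
next
  case False
  have "ghost p u * path q v \<approx> ghost p u * vx s * path q v"
    using ghost_mult_vx[OF assms(1), of s] by (intro eqv_mult_right eqv_sym[of "_ * _"]) simp
  also have "\<dots> = ghost p u * (vx s * path q v)"
    by (simp add: mult.assoc)
  also have "\<dots> \<approx> ghost p u * 0"
    using vx_mult_path[OF assms(2), of s] False by (intro eqv_mult_left) simp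
  finally show ?thesis
    by (simp add: eqv_zero_iff)
qed

subsection \<open>Leading terms\<close>

text \<open>
  Collecting terms with the same path gives pairwise distinct paths and nonzero coefficients.
\<close>

lemma path_span_expand:
  assumes "p \<in> path_span v"
  obtains A c where "finite A" "p \<approx> (\<Sum>q\<in>A. scal (c q) (path q v))"
    "\<And>q. q \<in> A \<Longrightarrow> c q \<noteq> 0" "\<And>q. q \<in> A \<Longrightarrow> \<exists>u. awalk u q v"
proof -
  have "\<exists>A c. finite A \<and> p \<approx> (\<Sum>q\<in>A. scal (c q) (path q v)) \<and>
          (\<forall>q. q \<notin> A \<longrightarrow> c q = 0) \<and> (\<forall>q\<in>A. \<exists>u. awalk u q v)"
    using assms
  proof (induction rule: span_mod.induct)
    case (base f)
    then show ?case
      by (intro exI[of _ "{}"] exI[of _ "\<lambda>_. 0"]) (simp add: eqv_zero_iff)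
  next
    case (step f b d)
    obtain A c where A: "finite A" "f \<approx> (\<Sum>q\<in>A. scal (c q) (path q v))"
      "\<forall>q. q \<notin> A \<longrightarrow> c q = 0" "\<forall>q\<in>A. \<exists>u. awalk u q v"
      using step.IH by blast
    obtain u q where q: "b = path q v" "awalk u q v"
      using step.hyps by blast
    let ?c = "c(q := c q + d)"
    have "(\<Sum>x\<in>insert q A. scal (?c x) (path x v)) =
          (\<Sum>x\<in>insert q A. scal (c x) (path x v) + (if x = q then scal d (path q v) else 0))"
      by (intro sum.cong) (auto simp: scal_add_left)
    also have "\<dots> = (\<Sum>x\<in>insert q A. scal (c x) (path x v)) + scal d b"
      using A(1) by (simp add: sum.distrib q(1))
    also have "(\<Sum>x\<in>insert q A. scal (c x) (path x v)) = (\<Sum>x\<in>A. scal (c x) (path x v))"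
      using A(1,3) by (cases "q \<in> A") (auto simp: insert_absorb)
    finally have "f + scal d b \<approx> (\<Sum>x\<in>insert q A. scal (?c x) (path x v))"
      using A(2) by (simp add: eqv_add)
    then show ?case
      using A q(2) by (intro exI[of _ "insert q A"] exI[of _ ?c]) auto
  qed
  then obtain A c where A: "finite A" "p \<approx> (\<Sum>q\<in>A. scal (c q) (path q v))"
      "\<forall>q\<in>A. \<exists>u. awalk u q v"
    by blast
  have "(\<Sum>q\<in>A. scal (c q) (path q v)) = (\<Sum>q\<in>{q \<in> A. c q \<noteq> 0}. scal (c q) (path q v))"
    using A(1) by (intro sum.mono_neutral_right) auto
  then show ?thesis
    using A by (intro that[of "{q \<in> A. c q \<noteq> 0}" c]) auto
qed

text \<open>
  The ghost of a shortest path \<open>\<alpha>\<close> that occurs turns \<open>\<alpha>\<close> into its end vertex.  No other path that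
  occurs is a proper initial segment of \<open>\<alpha>\<close>, so its product with the ghost of \<open>\<alpha>\<close> vanishes or is a
  path from \<open>v\<close> to \<open>v\<close>.
\<close>

lemma leading_term:
  assumes "p \<in> path_span v" "p \<notin> J"
  obtains s \<alpha> c r where "awalk s \<alpha> v" "c \<noteq> 0" "ghost \<alpha> v * p \<approx> scal c (vx v) + r"
    "r \<in> closed_span v"
proof -
  obtain A c where A: "finite A" "p \<approx> (\<Sum>q\<in>A. scal (c q) (path q v))"
    "\<And>q. q \<in> A \<Longrightarrow> c q \<noteq> 0" "\<And>q. q \<in> A \<Longrightarrow> \<exists>u. awalk u q v"
    using path_span_expand[OF assms(1)] by blast
  have "A \<noteq> {}"
    using A(2) assms(2) by (auto simp: eqv_zero_iff)
  then obtain \<alpha> where \<alpha>: "\<alpha> \<in> A" "\<And>q. q \<in> A \<Longrightarrow> length \<alpha> \<le> length q"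
    using ex_has_least_nat[of "\<lambda>q. q \<in> A" _ length] by blast
  obtain s where s: "awalk s \<alpha> v" using A(4) \<alpha>(1) by blast
  define r where "r = (\<Sum>q\<in>A - {\<alpha>}. scal (c q) (ghost \<alpha> v * path q v))"
  have "ghost \<alpha> v * p \<approx> ghost \<alpha> v * (\<Sum>q\<in>A. scal (c q) (path q v))"
    by (intro eqv_mult_left A(2))
  also have "\<dots> = scal (c \<alpha>) (ghost \<alpha> v * path \<alpha> v) + r"
    unfolding r_def using A(1) \<alpha>(1)
    by (simp add: sum.remove distrib_left sum_distrib_left scal_mult_right)
  also have "\<dots> \<approx> scal (c \<alpha>) (vx v) + r"
    unfolding scal_def using s by (intro eqv_add eqv_refl eqv_mult_left ghost_mult_path_self)
  finally have eq: "ghost \<alpha> v * p \<approx> scal (c \<alpha>) (vx v) + r" .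
  have "r \<in> closed_span v"
    unfolding r_def
  proof (intro span_mod_sum span_mod_scal)
    fix q assume q: "q \<in> A - {\<alpha>}"
    then obtain s' where s': "awalk s' q v" using A(4) by blast
    consider (a) x where "q = \<alpha> @ x" "awalk v x v" | (b) x where "\<alpha> = q @ x" "x \<noteq> []"
      | (c) "ghost \<alpha> v * path q v \<in> J"
      using ghost_mult_path_cases'[OF s s'] by blast
    then show "ghost \<alpha> v * path q v \<in> closed_span v"
    proof cases
      case a
      then have "closed_path G v x"
        using q unfolding closed_path_def by auto
      then have "path x v \<in> closed_span v"
        by (intro span_mod_basis) blast
      then show ?thesis
        using span_mod_eqv ghost_mult_path_append[OF s a(2)] a(1) by blast
    next
      case b
      then show ?thesis using \<alpha>(2)[of q] q by simp
    next
      case c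
      then show ?thesis by (rule span_mod.base)
    qed
  qed
  with that[OF s A(3)[OF \<alpha>(1)] eq] show ?thesis .
qed

subsection \<open>Removing closed paths\<close>

text \<open>
  A closed simple path does not return to its base before its end.
\<close>

lemma closed_simple_no_proper_prefix:
  assumes "closed_simple_path G v \<gamma>" "\<gamma> = \<beta> @ r" "\<beta> \<noteq> []" "awalk v \<beta> v"
  shows "r = []"
proof (rule ccontr)
  assume r: "r \<noteq> []"
  have "awalk v \<gamma> v" "\<gamma> \<noteq> []"
    using assms(1) by (auto simp: closed_simple_path_def closed_path_def)
  then have "awalk v (\<beta> @ r) v" using assms(2) by simp
  then have "awalk v r v"
    using assms(4) by simp
  then have 1: "tail G (hd r) = v" using r by (cases r) (auto simp: awalk_Cons_iff)
  have 2: "tail G (hd \<gamma>) = v"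
    using \<open>awalk v \<gamma> v\<close> \<open>\<gamma> \<noteq> []\<close> by (cases \<gamma>) (auto simp: awalk_Cons_iff)
  have "hd r \<in> set (tl \<gamma>)"
    using assms(2,3) r by simp
  with assms(1) 1 2 show False by (auto simp: closed_simple_path_def)
qed

text \<open>
  If \<open>\<beta>\<close> does not start with \<open>\<gamma>\<close>, it is not a proper initial segment of \<open>\<gamma>\<close> either, since it
  returns to the base of \<open>\<gamma>\<close>; so the two walks separate at different edges.
\<close>

lemma conjugate_closed_path:
  assumes "closed_simple_path G v \<gamma>" "closed_path G v \<beta>" "\<nexists>r. \<beta> = \<gamma> @ r"
  shows "ghost \<gamma> v * path \<beta> v \<in> J"
proof -
  have "awalk v \<gamma> v" "awalk v \<beta> v" "\<beta> \<noteq> []"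
    using assms by (auto simp: closed_simple_path_def closed_path_def)
  then show ?thesis
    using ghost_mult_path_cases[of v \<gamma> v \<beta> v] assms(3)
      closed_simple_no_proper_prefix[OF assms(1), of \<beta>] by blast
qed

text \<open>
  Conjugation by \<open>\<gamma>\<close> rotates the closed paths \<open>\<gamma> r\<close> to \<open>r \<gamma>\<close> and kills all others.
\<close>

lemma conjugate_sum:
  assumes "closed_simple_path G v \<gamma>" "\<forall>(d, \<beta>)\<in>set ts. closed_path G v \<beta>"
  shows "\<exists>ts'. length ts' = length (filter (\<lambda>(d, \<beta>). \<exists>r. \<beta> = \<gamma> @ r) ts) \<and>
     (\<forall>(d, \<beta>)\<in>set ts'. closed_path G v \<beta>) \<and>
     ghost \<gamma> v * path_sum v ts * path \<gamma> v \<approx> path_sum v ts'"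
  using assms(2)
proof (induction ts)
  case Nil
  show ?case by simp
next
  case (Cons t ts)
  obtain d \<beta> where t: "t = (d, \<beta>)" by (cases t)
  have \<gamma>: "awalk v \<gamma> v" "\<gamma> \<noteq> []"
    using assms(1) by (auto simp: closed_simple_path_def closed_path_def)
  have \<beta>: "closed_path G v \<beta>" "awalk v \<beta> v" using Cons.prems t by (auto simp: closed_path_def)
  obtain ts' where ts': "length ts' = length (filter (\<lambda>(d, \<beta>). \<exists>r. \<beta> = \<gamma> @ r) ts)"
     "\<forall>(d, \<beta>)\<in>set ts'. closed_path G v \<beta>"
     "ghost \<gamma> v * path_sum v ts * path \<gamma> v \<approx> path_sum v ts'"
    using Cons by auto
  have sum: "ghost \<gamma> v * path_sum v (t # ts) * path \<gamma> v =
     scal d (ghost \<gamma> v * path \<beta> v * path \<gamma> v) +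
     ghost \<gamma> v * path_sum v ts * path \<gamma> v"
    by (simp add: t distrib_left distrib_right scal_mult_left scal_mult_right)
  show ?case
  proof (cases "\<exists>r. \<beta> = \<gamma> @ r")
    case True
    then obtain r where r: "\<beta> = \<gamma> @ r" by blast
    have w: "awalk v r v" using \<beta>(2) \<gamma> r by simp
    have "ghost \<gamma> v * path \<beta> v * path \<gamma> v \<approx> path r v * path \<gamma> v"
      unfolding r by (intro eqv_mult_right ghost_mult_path_append[OF \<gamma>(1) w])
    also have "\<dots> \<approx> path (r @ \<gamma>) v"
      by (intro eqv_sym[OF path_append[OF w \<gamma>(1)]])
    finally have "scal d (ghost \<gamma> v * path \<beta> v * path \<gamma> v) \<approx> scal d (path (r @ \<gamma>) v)"
      unfolding scal_def by (rule eqv_mult_left)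
    then have "ghost \<gamma> v * path_sum v (t # ts) * path \<gamma> v \<approx>
        path_sum v ((d, r @ \<gamma>) # ts')"
      unfolding sum using ts'(3) by (simp add: eqv_add)
    moreover have "closed_path G v (r @ \<gamma>)"
      using w \<gamma> by (auto simp: closed_path_def)
    ultimately show ?thesis
      using ts'(1,2) True t by (intro exI[of _ "(d, r @ \<gamma>) # ts'"]) auto
  next
    case False
    then have "ghost \<gamma> v * path \<beta> v * path \<gamma> v \<in> J"
      by (intro mult_right_mem conjugate_closed_path[OF assms(1) \<beta>(1)])
    then have "scal d (ghost \<gamma> v * path \<beta> v * path \<gamma> v) \<approx> 0"
      by (simp add: eqv_zero_iff scal_mem)
    from eqv_add[OF this ts'(3)] show ?thesis
      unfolding sum using ts'(1,2) False t by (intro exI[of _ ts']) auto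
  qed
qed

lemma closed_path_span_expand:
  assumes "r \<in> closed_span v"
  obtains ts where "\<forall>(d, \<beta>)\<in>set ts. closed_path G v \<beta>" "r \<approx> path_sum v ts"
proof -
  have "\<exists>ts. (\<forall>(d, \<beta>)\<in>set ts. closed_path G v \<beta>) \<and> r \<approx> path_sum v ts"
    using assms
  proof (induction rule: span_mod.induct)
    case (base f)
    then show ?case by (intro exI[of _ "[]"]) (simp add: eqv_zero_iff)
  next
    case (step f b c)
    obtain ts where ts: "\<forall>(d, \<beta>)\<in>set ts. closed_path G v \<beta>" "f \<approx> path_sum v ts"
      using step.IH by blast
    obtain \<beta> where \<beta>: "b = path \<beta> v" "closed_path G v \<beta>" using step.hyps by blast
    have "f + scal c b \<approx> path_sum v ((c, \<beta>) # ts)"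
      using eqv_add[OF eqv_refl ts(2), of "scal c b"] by (simp add: \<beta>(1) add.commute)
    then show ?case
      using ts(1) \<beta>(2) by (intro exI[of _ "(c, \<beta>) # ts"]) auto
  qed
  then show ?thesis using that by blast
qed

text \<open>
  Here Condition (K) enters.  Of two different closed simple paths at \<open>v\<close> neither is an initial segment
  of the other, so no closed path starts with both.  Conjugation by a suitable one of them keeps the
  multiple of the vertex and kills at least one closed path, and the number of terms decreases.
\<close>

lemma vertex_from_closed_paths:
  assumes K: "condition_K G" and v: "v \<in> verts G" and c: "c \<noteq> 0"
    and r: "r \<in> closed_span v"
    and mem: "scal c (vx v) + r \<in> J"
  shows "vx v \<in> J"
proof -
  have "vx v \<in> J"
    if "\<forall>(d, \<beta>)\<in>set ts. closed_path G v \<beta>" "scal c (vx v) + path_sum v ts \<in> J"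
    for ts
    using that
  proof (induction ts rule: length_induct)
    case (1 ts)
    show ?case
    proof (cases "ts = []")
      case True
      then show ?thesis
        using 1 c scal_mem_iff by simp
    next
      case False
      then obtain d0 \<beta>0 where 0: "(d0, \<beta>0) \<in> set ts" "closed_path G v \<beta>0"
        using 1(2) by (metis case_prodD list.set_sel(1) surj_pair)
      then obtain \<gamma> \<delta> where two: "\<gamma> \<noteq> \<delta>" "closed_simple_path G v \<gamma>" "closed_simple_path G v \<delta>"
        using K v unfolding condition_K_def by blast
      have "\<not> ((\<exists>r. \<beta>0 = \<gamma> @ r) \<and> (\<exists>r. \<beta>0 = \<delta> @ r))"
      proof
        assume "(\<exists>r. \<beta>0 = \<gamma> @ r) \<and> (\<exists>r. \<beta>0 = \<delta> @ r)"
        then obtain us where us: "\<gamma> = \<delta> @ us \<or> \<delta> = \<gamma> @ us"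
          by (metis append_eq_append_conv2)
        have "us = []"
          using us closed_simple_no_proper_prefix[OF two(2), of \<delta> us]
            closed_simple_no_proper_prefix[OF two(3), of \<gamma> us] two(2,3)
          unfolding closed_simple_path_def closed_path_def by blast
        with us two(1) show False by simp
      qed
      then obtain \<epsilon> where \<epsilon>: "closed_simple_path G v \<epsilon>" "\<nexists>r. \<beta>0 = \<epsilon> @ r"
        using two(2,3) by blast
      obtain ts' where ts': "length ts' = length (filter (\<lambda>(d, \<beta>). \<exists>r. \<beta> = \<epsilon> @ r) ts)"
        "\<forall>(d, \<beta>)\<in>set ts'. closed_path G v \<beta>"
        "ghost \<epsilon> v * path_sum v ts * path \<epsilon> v \<approx> path_sum v ts'"
        using conjugate_sum[OF \<epsilon>(1) 1(2)] by blast
      have "length ts' < length ts"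
        unfolding ts'(1) using 0(1) \<epsilon>(2) by (intro length_filter_less[of "(d0, \<beta>0)"]) auto
      have w: "awalk v \<epsilon> v" using \<epsilon>(1) by (simp add: closed_simple_path_def closed_path_def)
      have "ghost \<epsilon> v * (scal c (vx v) + path_sum v ts) * path \<epsilon> v \<in> J"
        by (intro mult_left_mem mult_right_mem 1(3))
      moreover have "ghost \<epsilon> v * (scal c (vx v) + path_sum v ts) * path \<epsilon> v \<approx>
          scal c (vx v) + path_sum v ts'"
      proof -
        have "ghost \<epsilon> v * vx v * path \<epsilon> v \<approx> ghost \<epsilon> v * path \<epsilon> v"
          using ghost_mult_vx[OF w, of v] by (intro eqv_mult_right) simp
        also have "\<dots> \<approx> vx v" by (rule ghost_mult_path_self[OF w])
        finally have "scal c (ghost \<epsilon> v * vx v * path \<epsilon> v) \<approx> scal c (vx v)"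
          unfolding scal_def by (rule eqv_mult_left)
        from eqv_add[OF this ts'(3)] show ?thesis
          by (simp add: distrib_left distrib_right scal_mult_left scal_mult_right)
      qed
      ultimately have "scal c (vx v) + path_sum v ts' \<in> J"
        using eqv_mem_iff by blast
      then show ?thesis
        using 1(1) \<open>length ts' < length ts\<close> ts'(2) by blast
    qed
  qed
  moreover obtain ts where ts: "\<forall>(d, \<beta>)\<in>set ts. closed_path G v \<beta>" "r \<approx> path_sum v ts"
    using closed_path_span_expand[OF r] by blast
  moreover have "scal c (vx v) + path_sum v ts \<in> J"
    using eqv_mem_iff[OF eqv_add[OF eqv_refl ts(2)]] mem by blast
  ultimately show ?thesis by blast
qed

subsection \<open>Gap idempotents\<close>

lemma gh_mult_gap:
  assumes "finite F" "F \<subseteq> out_arcs G v" "e \<in> out_arcs G v"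
  shows "gh e * gap F v \<approx> (if e \<in> F then 0 else gh e)"
proof -
  have e: "e \<in> arcs G" "tail G e = v" using assms(3) by auto
  have "gh e * gap F v = gh e * vx v - (\<Sum>f\<in>F. gh e * ed f * gh f)"
    by (simp add: gap_def right_diff_distrib sum_distrib_left mult.assoc)
  also have "\<dots> \<approx> gh e - (\<Sum>f\<in>F. if f = e then gh e else 0)"
  proof (intro eqv_diff eqv_sum)
    show "gh e * vx v \<approx> gh e" using gen_mult_vx[of "Ghost e" v] e by simp
    fix f assume "f \<in> F"
    show "gh e * ed f * gh f \<approx> (if f = e then gh e else 0)"
    proof (cases "f = e")
      case True
      have "gh e * ed e * gh e \<approx> vx (head G e) * gh e"
        by (intro eqv_mult_right gh_mult_ed_same e)
      also have "\<dots> \<approx> gh e" using vx_mult_gen[of "head G e" "Ghost e"] by simp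
      finally show ?thesis using True by simp
    next
      case False
      then show ?thesis
        using mult_right_mem[OF gh_mult_ed_diff[of e f]] by (simp add: eqv_zero_iff)
    qed
  qed
  also have "\<dots> = (if e \<in> F then 0 else gh e)"
    using assms(1) by simp
  finally show ?thesis .
qed

lemma gap_mult_ed:
  assumes "finite F" "F \<subseteq> out_arcs G v" "e \<in> out_arcs G v"
  shows "gap F v * ed e \<approx> (if e \<in> F then 0 else ed e)"
proof -
  have e: "e \<in> arcs G" "tail G e = v" using assms(3) by auto
  have "gap F v * ed e = vx v * ed e - (\<Sum>f\<in>F. ed f * (gh f * ed e))"
    by (simp add: gap_def left_diff_distrib sum_distrib_right mult.assoc)
  also have "\<dots> \<approx> ed e - (\<Sum>f\<in>F. if f = e then ed e else 0)"
  proof (intro eqv_diff eqv_sum)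
    show "vx v * ed e \<approx> ed e" using vx_mult_gen[of v "Edge e"] e by simp
    fix f assume "f \<in> F"
    show "ed f * (gh f * ed e) \<approx> (if f = e then ed e else 0)"
    proof (cases "f = e")
      case True
      have "ed e * (gh e * ed e) \<approx> ed e * vx (head G e)"
        by (intro eqv_mult_left gh_mult_ed_same e)
      also have "\<dots> \<approx> ed e" using gen_mult_vx[of "Edge e" "head G e"] by simp
      finally show ?thesis using True by simp
    next
      case False
      then show ?thesis
        using mult_left_mem[OF gh_mult_ed_diff[of f e]] by (simp add: eqv_zero_iff)
    qed
  qed
  also have "\<dots> = (if e \<in> F then 0 else ed e)"
    using assms(1) by simp
  finally show ?thesis .
qed

lemma vx_mult_gap:
  assumes "F \<subseteq> out_arcs G v"
  shows "vx v * gap F v \<approx> gap F v"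
proof -
  have "vx v * gap F v = vx v * vx v - (\<Sum>f\<in>F. vx v * ed f * gh f)"
    by (simp add: gap_def right_diff_distrib sum_distrib_left mult.assoc)
  also have "\<dots> \<approx> vx v - (\<Sum>f\<in>F. ed f * gh f)"
  proof (intro eqv_diff eqv_sum eqv_mult_right)
    show "vx v * vx v \<approx> vx v" using vx_mult_vx[of v v] by simp
    show "vx v * ed f \<approx> ed f" if "f \<in> F" for f
      using vx_mult_gen[of v "Edge f"] assms that by auto
  qed
  finally show ?thesis by (simp add: gap_def)
qed

lemma gap_mult_vx:
  assumes "F \<subseteq> out_arcs G v"
  shows "gap F v * vx v \<approx> gap F v"
proof -
  have "gap F v * vx v = vx v * vx v - (\<Sum>f\<in>F. ed f * (gh f * vx v))"
    by (simp add: gap_def left_diff_distrib sum_distrib_right mult.assoc)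
  also have "\<dots> \<approx> vx v - (\<Sum>f\<in>F. ed f * gh f)"
  proof (intro eqv_diff eqv_sum eqv_mult_left)
    show "vx v * vx v \<approx> vx v" using vx_mult_vx[of v v] by simp
    show "gh f * vx v \<approx> gh f" if "f \<in> F" for f
      using gen_mult_vx[of "Ghost f" v] assms that by auto
  qed
  finally show ?thesis by (simp add: gap_def)
qed

lemma gap_idem:
  assumes "finite F" "F \<subseteq> out_arcs G v"
  shows "gap F v * gap F v \<approx> gap F v"
proof -
  have "gap F v * gap F v = gap F v * vx v - (\<Sum>f\<in>F. gap F v * ed f * gh f)"
    by (subst (2) gap_def) (simp add: right_diff_distrib sum_distrib_left mult.assoc)
  also have "\<dots> \<approx> gap F v - (\<Sum>f\<in>F. 0 * gh f)"
    using gap_mult_ed[OF assms, of f for f] assms(2)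
    by (intro eqv_diff eqv_sum eqv_mult_right gap_mult_vx[OF assms(2)]) force
  finally show ?thesis by simp
qed

text \<open>
  A gap kills the paths whose first edge belongs to its edge set, so it is enough to take the first
  edges of all closed paths that occur.
\<close>

lemma gap_mult_closed_paths:
  assumes "r \<in> closed_span v"
  shows "\<exists>F. finite F \<and> F \<subseteq> out_arcs G v \<and>
    (\<forall>F'. finite F' \<longrightarrow> F \<subseteq> F' \<longrightarrow> F' \<subseteq> out_arcs G v \<longrightarrow> gap F' v * r \<in> J)"
  using assms
proof (induction rule: span_mod.induct)
  case (base f)
  then show ?case by (intro exI[of _ "{}"]) (auto intro: mult_left_mem)
next
  case (step f b c)
  obtain F where F: "finite F" "F \<subseteq> out_arcs G v"
    "\<And>F'. finite F' \<Longrightarrow> F \<subseteq> F' \<Longrightarrow> F' \<subseteq> out_arcs G v \<Longrightarrow> gap F' v * f \<in> J"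
    using step.IH by blast
  obtain \<beta> where \<beta>: "b = path \<beta> v" "closed_path G v \<beta>" using step.hyps by blast
  then obtain e \<beta>' where e: "\<beta> = e # \<beta>'" "e \<in> out_arcs G v"
    by (cases \<beta>) (auto simp: closed_path_def awalk_Cons_iff)
  have "gap F' v * (f + scal c b) \<in> J"
    if F': "finite F'" "insert e F \<subseteq> F'" "F' \<subseteq> out_arcs G v" for F'
  proof -
    have "gap F' v * ed e \<in> J"
      using gap_mult_ed[OF F'(1,3) e(2)] F'(2) by (simp add: eqv_zero_iff)
    then have "scal c (gap F' v * ed e * path \<beta>' v) \<in> J"
      by (rule scal_mem[OF mult_right_mem])
    moreover have "gap F' v * f \<in> J" using F F' by auto
    ultimately show ?thesis
      by (simp add: distrib_left scal_mult_right \<beta>(1) e(1) add_mem mult.assoc)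
  qed
  then show ?case
    using F(1,2) e(2) by (intro exI[of _ "insert e F"]) auto
qed

end

context leavitt_ideal
begin

subsection \<open>Removing ghost paths\<close>

definition monomials_from :: "nat \<Rightarrow> 'v \<Rightarrow> ('v, 'e, 'k) lpa_poly set" where
  "monomials_from n v =
     {path p w * ghost q w | u p w q. awalk u p w \<and> awalk v q w \<and> length q \<le> n}"

lemma monomials_from_mono: "n \<le> m \<Longrightarrow> monomials_from n v \<subseteq> monomials_from m v"
  unfolding monomials_from_def by (blast intro: order_trans)

lemma monomials_fromI:
  "\<lbrakk>awalk u p w; awalk v q w; length q \<le> n\<rbrakk> \<Longrightarrow> path p w * ghost q w \<in> monomials_from n v"
  unfolding monomials_from_def by blast

lemma path_mult_vx_self: "path p v * vx v \<approx> path p v"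
  using path_mult_vx[of p v v] by simp

lemma monomials_from_0:
  assumes "f \<in> span_mod J (monomials_from 0 v)"
  shows "f \<in> path_span v"
  using assms
proof (induction rule: span_mod.induct)
  case (base f)
  then show ?case by (rule span_mod.base)
next
  case (step f b c)
  obtain u p where p: "b = path p v * vx v" "awalk u p v"
    using step.hyps unfolding monomials_from_def by (auto simp: awalk_Nil_iff)
  have "path p v \<in> path_span v"
    by (rule span_mod_basis) (use p(2) in blast)
  then have "b \<in> path_span v"
    unfolding p(1) by (rule span_mod_eqv[OF _ path_mult_vx_self])
  then show ?case
    by (intro span_mod_add span_mod_scal step.IH)
qed

text \<open>
  A nontrivial ghost path is written as a shorter one times the ghost of its first edge.
\<close>

lemma ghost_decomposition:
  assumes "a \<in> span_mod J (monomials_from (Suc n) v)"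
  obtains F p b where "finite F" "F \<subseteq> out_arcs G v"
    "p \<in> path_span v"
    "\<forall>e. b e \<in> span_mod J (monomials_from n (head G e))"
    "a \<approx> p + (\<Sum>e\<in>F. b e * gh e)"
proof -
  have "\<exists>F p b. finite F \<and> F \<subseteq> out_arcs G v \<and>
      p \<in> path_span v \<and>
      (\<forall>e. b e \<in> span_mod J (monomials_from n (head G e))) \<and> (\<forall>e. e \<notin> F \<longrightarrow> b e = 0) \<and>
      a \<approx> p + (\<Sum>e\<in>F. b e * gh e)"
    using assms
  proof (induction rule: span_mod.induct)
    case (base f)
    then show ?case
      by (intro exI[of _ "{}"] exI[of _ 0] exI[of _ "\<lambda>_. 0"])
         (simp add: eqv_zero_iff span_mod_zero)
  next
    case (step f m c)
    obtain F p b where F: "finite F" "F \<subseteq> out_arcs G v"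
      "p \<in> path_span v"
      "\<forall>e. b e \<in> span_mod J (monomials_from n (head G e))" "\<forall>e. e \<notin> F \<longrightarrow> b e = 0"
      "f \<approx> p + (\<Sum>e\<in>F. b e * gh e)"
      using step.IH by blast
    obtain u \<alpha> w q where m: "m = path \<alpha> w * ghost q w" "awalk u \<alpha> w" "awalk v q w" "length q \<le> Suc n"
      using step.hyps unfolding monomials_from_def by blast
    show ?case
    proof (cases q)
      case Nil
      then have w: "w = v" using m(3) by (simp add: awalk_Nil_iff)
      have m_eq: "m \<approx> path \<alpha> v"
        using path_mult_vx_self[of \<alpha> v] by (simp add: m(1) Nil w)
      have "scal c m \<approx> scal c (path \<alpha> v)"
        unfolding scal_def by (rule eqv_mult_left[OF m_eq])
      from eqv_add[OF F(6) this]
      have "f + scal c m \<approx> (p + scal c (path \<alpha> v)) + (\<Sum>e\<in>F. b e * gh e)"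
        by (simp add: algebra_simps)
      moreover have "p + scal c (path \<alpha> v) \<in> path_span v"
        using F(3) m(2) w by (intro span_mod.step) auto
      ultimately show ?thesis
        using F by (intro exI[of _ F] exI[of _ "p + scal c (path \<alpha> v)"] exI[of _ b]) simp
    next
      case (Cons e q')
      have e: "e \<in> out_arcs G v" "awalk (head G e) q' w"
        using m(3) Cons by (auto simp: awalk_Cons_iff)
      let ?b = "b(e := b e + scal c (path \<alpha> w * ghost q' w))"
      have "(\<Sum>x\<in>insert e F. ?b x * gh x) =
            (\<Sum>x\<in>insert e F. b x * gh x + (if x = e then scal c m else 0))"
        by (intro sum.cong) (auto simp: distrib_right scal_mult_left m(1) Cons mult.assoc)
      also have "\<dots> = (\<Sum>x\<in>insert e F. b x * gh x) + scal c m"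
        using F(1) by (simp add: sum.distrib)
      also have "(\<Sum>x\<in>insert e F. b x * gh x) = (\<Sum>x\<in>F. b x * gh x)"
        using F(1,5) by (cases "e \<in> F") (auto simp: insert_absorb)
      finally have "f + scal c m \<approx> p + (\<Sum>x\<in>insert e F. ?b x * gh x)"
        using eqv_add[OF F(6) eqv_refl, of "scal c m"] by (simp add: algebra_simps)
      moreover have "?b x \<in> span_mod J (monomials_from n (head G x))" for x
      proof (cases "x = e")
        case True
        have "b e + scal c (path \<alpha> w * ghost q' w) \<in> span_mod J (monomials_from n (head G e))"
          using F(4) m(4) Cons by (intro span_mod.step monomials_fromI[OF m(2) e(2)]) auto
        then show ?thesis using True by simp
      next
        case False
        then show ?thesis using F(4) by simp
      qed
      ultimately show ?thesis
        using F(1,2,3,5) e(1)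
        by (intro exI[of _ "insert e F"] exI[of _ p] exI[of _ ?b]) auto
    qed
  qed
  then show ?thesis
    by (elim exE conjE) (rule that)
qed

text \<open>
  Multiplication by an edge on the right shortens every nontrivial ghost path, as it cancels the
  ghost of the first edge or kills the product, and it prolongs the paths.
\<close>

lemma mult_ed_span:
  assumes "finite F" "F \<subseteq> out_arcs G v" "e \<in> out_arcs G v"
    and p: "p \<in> path_span v"
    and b: "\<And>e. b e \<in> span_mod J (monomials_from n (head G e))"
    and a: "a \<approx> p + (\<Sum>e\<in>F. b e * gh e)"
  shows "a * ed e \<in> span_mod J (monomials_from n (head G e))"
proof -
  have e: "e \<in> arcs G" "tail G e = v" using assms(3) by auto
  have "a * ed e \<approx> (p + (\<Sum>f\<in>F. b f * gh f)) * ed e"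
    by (intro eqv_mult_right a)
  also have "\<dots> = p * ed e + (\<Sum>f\<in>F. b f * (gh f * ed e))"
    by (simp add: distrib_right sum_distrib_right mult.assoc)
  finally have eq: "a * ed e \<approx> p * ed e + (\<Sum>f\<in>F. b f * (gh f * ed e))" .
  have "p * ed e \<in> span_mod J (monomials_from n (head G e))"
  proof (rule span_mod_mult_right[OF p])
    fix m :: "('v, 'e, 'k) lpa_poly"
    assume "m \<in> {path q v | u q. awalk u q v}"
    then obtain u q where q: "m = path q v" "awalk u q v" by blast
    have w: "awalk v [e] (head G e)" using e arc_implies_awalk by auto
    have w': "awalk u (q @ [e]) (head G e)" using q(2) w by (rule awalk_appendI)
    have ed: "path [e] (head G e) \<approx> ed e"
      using gen_mult_vx[of "Edge e" "head G e"] by simp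
    have "m * ed e \<approx> path q v * path [e] (head G e)"
      unfolding q(1) by (intro eqv_mult_left eqv_sym[OF ed])
    also have "\<dots> \<approx> path (q @ [e]) (head G e)"
      by (rule eqv_sym[OF path_append[OF q(2) w]])
    also have "\<dots> \<approx> path (q @ [e]) (head G e) * ghost [] (head G e)"
      using eqv_sym[OF path_mult_vx_self] by simp
    finally have eq: "m * ed e \<approx> path (q @ [e]) (head G e) * ghost [] (head G e)" .
    have "path (q @ [e]) (head G e) * ghost [] (head G e) \<in> monomials_from n (head G e)"
      using e by (intro monomials_fromI[OF w']) (auto simp: awalk_Nil_iff)
    from span_mod_eqv[OF span_mod_basis[OF this] eq]
    show "m * ed e \<in> span_mod J (monomials_from n (head G e))" .
  qed
  moreover have "b f * (gh f * ed e) \<in> span_mod J (monomials_from n (head G e))" for f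
  proof (cases "f = e")
    case True
    have eq: "b e * (gh e * ed e) \<approx> b e * vx (head G e)"
      by (intro eqv_mult_left gh_mult_ed_same e)
    have "b e * vx (head G e) \<in> span_mod J (monomials_from n (head G e))"
    proof (rule span_mod_mult_right[OF b])
      fix m assume m: "m \<in> monomials_from n (head G e)"
      then obtain u p w q where w: "m = path p w * ghost q w" "awalk (head G e) q w"
        unfolding monomials_from_def by blast
      have "m * vx (head G e) = path p w * (ghost q w * vx (head G e))"
        by (simp add: w(1) mult.assoc)
      also have "\<dots> \<approx> m"
        unfolding w(1) using ghost_mult_vx[OF w(2), of "head G e"] by (intro eqv_mult_left) simp
      finally show "m * vx (head G e) \<in> span_mod J (monomials_from n (head G e))"
        by (rule span_mod_eqv[OF span_mod_basis[OF m]])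
    qed
    then show ?thesis
      using span_mod_eqv[OF _ eq] True by simp
  next
    case False
    then show ?thesis by (intro span_mod.base mult_left_mem gh_mult_ed_diff)
  qed
  ultimately have "p * ed e + (\<Sum>f\<in>F. b f * (gh f * ed e)) \<in> span_mod J (monomials_from n (head G e))"
    by (intro span_mod_add span_mod_sum)
  then show ?thesis
    by (rule span_mod_eqv[OF _ eq])
qed

lemma gap_eqv_subset:
  assumes "finite F" "A \<subseteq> F" "\<And>e. e \<in> F - A \<Longrightarrow> ed e * gh e \<in> J"
  shows "gap F v \<approx> gap A v"
proof -
  let ?s = "\<lambda>A. (\<Sum>e\<in>A. ed e * gh e) :: ('v, 'e, 'k) lpa_poly"
  have "?s F = ?s (F - A) + ?s A"
    by (rule sum.subset_diff[OF assms(2,1)])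
  then have "gap F v - gap A v = - ?s (F - A)"
    by (simp add: gap_def)
  moreover have "- ?s (F - A) \<in> J"
    by (intro minus_mem sum_mem assms(3))
  ultimately show ?thesis by (simp add: eqv_def)
qed

text \<open>
  Induction on the length of the ghost parts.  If the product of \<open>a\<close> with an edge \<open>e\<close> from \<open>v\<close> to the
  complement of \<open>H\<close> is not in \<open>J\<close>, it has shorter ghost parts.  Otherwise \<open>a\<close> is orthogonal to these edges, so \<open>a\<close>
  equals \<open>a (v - \<Sum> e e\<^sup>*)\<close> for finite sums over them, and the ghost parts of \<open>a\<close> disappear: \<open>a\<close> becomes
  \<open>p (v - \<Sum> e e\<^sup>*)\<close>, where \<open>p\<close> is a combination of paths.  After splitting off a leading term of \<open>p\<close> the
  remaining closed paths are killed from the left by the same gap, and the gap itself is in \<open>L\<close>.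
  It yields the end of a further edge if \<open>v\<close> emits infinitely many edges to the complement of \<open>H\<close>, and
  \<open>v\<close> or \<open>v\<^sup>H\<close> otherwise.
\<close>

lemma reduction_step:
  assumes K: "condition_K G"
    and L: "leavitt_ideal G L" "J \<subseteq> L"
    and H: "\<And>v. v \<in> H \<Longrightarrow> vx v \<in> J"
    and S: "\<And>v. v \<in> S \<Longrightarrow> breaking_elem G H v \<in> J"
    and "a \<in> span_mod J (monomials_from n v)" "v \<in> verts G - H" "a \<in> L" "a \<notin> J"
  shows "(\<exists>w\<in>verts G - H. vx w \<in> L) \<or>
    (\<exists>w\<in>breaking_vertices_of G H - S. breaking_elem G H w \<in> L)"
  using assms(6-)
proof (induction n arbitrary: a v)
  case 0
  interpret L: leavitt_ideal G L by (rule L(1))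
  obtain s \<alpha> c r where "awalk s \<alpha> v" and D: "c \<noteq> 0" "ghost \<alpha> v * a \<approx> scal c (vx v) + r"
    "r \<in> closed_span v"
    by (rule leading_term[OF monomials_from_0[OF 0(1)] 0(4)])
  have "scal c (vx v) + r \<in> L"
    using eqv_mem_super[OF D(2) L.type_ideal_axioms L(2)] L.mult_left_mem[OF 0(3)] by simp
  then have "vx v \<in> L"
    using L.vertex_from_closed_paths[OF K _ D(1) span_mod_mono_ideal[OF D(3) L(2)]] 0(2) by blast
  then show ?case using 0(2) by blast
next
  case (Suc n)
  interpret L: leavitt_ideal G L by (rule L(1))
  obtain F p b where F: "finite F" "F \<subseteq> out_arcs G v"
    "p \<in> path_span v"
    "\<forall>e. b e \<in> span_mod J (monomials_from n (head G e))"
    "a \<approx> p + (\<Sum>e\<in>F. b e * gh e)"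
    by (rule ghost_decomposition[OF Suc.prems(1)])
  \<comment> \<open>The edges from \<open>v\<close> that survive in the quotient.\<close>
  define live where "live = {e \<in> out_arcs G v. head G e \<notin> H}"
  have dead: "ed e \<in> J" if "e \<in> out_arcs G v - live" for e
  proof -
    have "vx (head G e) \<in> J" using that H by (auto simp: live_def)
    then have "ed e * vx (head G e) \<in> J" by (rule mult_left_mem)
    then show ?thesis
      using eqv_mem_iff[OF right_vertex_mult[of "Edge e"]] by simp
  qed
  show ?case
  proof (cases "\<exists>e\<in>live. a * ed e \<notin> J")
    case True
    then obtain e where e: "e \<in> live" "a * ed e \<notin> J" by blast
    show ?thesis
    proof (rule Suc.IH)
      show "a * ed e \<in> span_mod J (monomials_from n (head G e))"
        using e(1) by (intro mult_ed_span[OF F(1,2) _ F(3) F(4)[rule_format] F(5)]) (simp add: live_def)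
      show "head G e \<in> verts G - H" using e(1) by (auto simp: live_def)
      show "a * ed e \<in> L" by (intro L.mult_right_mem Suc.prems)
    qed (rule e(2))
  next
    case False
    then have a_ed: "a * ed e \<in> J" if "e \<in> out_arcs G v" for e
      using that mult_left_mem[OF dead[of e], of a] by blast
    have a_gap: "a \<approx> a * gap F' v" and a_p: "a \<approx> p * gap F' v"
      if F': "finite F'" "F \<subseteq> F'" "F' \<subseteq> out_arcs G v" for F'
    proof -
      have a_vx: "a * vx v \<approx> a"
      proof -
        have "a * vx v \<approx> (p + (\<Sum>e\<in>F. b e * gh e)) * vx v"
          by (intro eqv_mult_right F)
        also have "\<dots> = p * vx v + (\<Sum>e\<in>F. b e * (gh e * vx v))"
          by (simp add: distrib_right sum_distrib_right mult.assoc)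
        also have "\<dots> \<approx> p + (\<Sum>e\<in>F. b e * gh e)"
        proof (intro eqv_add eqv_sum eqv_mult_left)
          show "gh e * vx v \<approx> gh e" if "e \<in> F" for e
            using gen_mult_vx[of "Ghost e" v] F(2) that by auto
          obtain A c where A: "p \<approx> (\<Sum>q\<in>A. scal (c q) (path q v))"
            using path_span_expand[OF F(3)] by metis
          have "p * vx v \<approx> (\<Sum>q\<in>A. scal (c q) (path q v)) * vx v"
            by (intro eqv_mult_right A)
          also have "\<dots> = (\<Sum>q\<in>A. scal (c q) (path q v * vx v))"
            by (simp add: sum_distrib_right scal_mult_left)
          also have "\<dots> \<approx> (\<Sum>q\<in>A. scal (c q) (path q v))"
            unfolding scal_def by (intro eqv_sum eqv_mult_left path_mult_vx_self)
          also have "\<dots> \<approx> p" by (rule eqv_sym[OF A])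
          finally show "p * vx v \<approx> p" .
        qed
        also have "\<dots> \<approx> a" by (rule eqv_sym[OF F(5)])
        finally show ?thesis .
      qed
      have "a * gap F' v \<approx> a * vx v"
      proof -
        have "a * gap F' v = a * vx v - (\<Sum>e\<in>F'. a * ed e * gh e)"
          by (simp add: gap_def right_diff_distrib sum_distrib_left mult.assoc)
        also have "\<dots> \<approx> a * vx v - 0"
        proof (intro eqv_diff eqv_refl)
          have "(\<Sum>e\<in>F'. a * ed e * gh e) \<in> J"
            using F'(3) by (intro sum_mem mult_right_mem[OF a_ed]) auto
          then show "(\<Sum>e\<in>F'. a * ed e * gh e) \<approx> 0" by (simp add: eqv_zero_iff)
        qed
        finally show ?thesis by simp
      qed
      from eqv_sym[OF eqv_trans[OF this a_vx]] show a_gap: "a \<approx> a * gap F' v" .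
      note a_gap
      also have "\<dots> \<approx> (p + (\<Sum>e\<in>F. b e * gh e)) * gap F' v"
        by (intro eqv_mult_right F)
      also have "\<dots> = p * gap F' v + (\<Sum>e\<in>F. b e * (gh e * gap F' v))"
        by (simp add: distrib_right sum_distrib_right mult.assoc)
      also have "\<dots> \<approx> p * gap F' v + (\<Sum>e\<in>F. b e * 0)"
      proof (intro eqv_add eqv_refl eqv_sum eqv_mult_left)
        show "gh e * gap F' v \<approx> 0" if "e \<in> F" for e
        proof -
          have "e \<in> F'" "e \<in> out_arcs G v" using that F'(2,3) by blast+
          then show ?thesis using gh_mult_gap[OF F'(1,3), of e] by simp
        qed
      qed
      finally show "a \<approx> p * gap F' v" by simp
    qed
    have p: "p \<notin> J"
      using eqv_mem_iff[OF a_p[OF F(1) subset_refl F(2)]] Suc.prems(4) mult_right_mem[of p]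
      by blast
    obtain s \<alpha> c r where "awalk s \<alpha> v" and D: "c \<noteq> 0" "ghost \<alpha> v * p \<approx> scal c (vx v) + r"
      "r \<in> closed_span v"
      by (rule leading_term[OF F(3) p])
    obtain F0 where F0: "finite F0" "F0 \<subseteq> out_arcs G v"
      "\<And>F'. finite F' \<Longrightarrow> F0 \<subseteq> F' \<Longrightarrow> F' \<subseteq> out_arcs G v \<Longrightarrow> gap F' v * r \<in> J"
      using gap_mult_closed_paths[OF D(3)] by blast
    \<comment> \<open>The left gap kills the closed paths and keeps the multiple of \<open>v\<close> in the middle.\<close>
    have gap_L: "gap F' v \<in> L" if F': "finite F'" "F \<union> F0 \<subseteq> F'" "F' \<subseteq> out_arcs G v" for F'
    proof -
      have "gap F' v * (ghost \<alpha> v * a) \<approx> gap F' v * (ghost \<alpha> v * (p * gap F' v))"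
        using F' by (intro eqv_mult_left a_p) auto
      also have "\<dots> = gap F' v * (ghost \<alpha> v * p) * gap F' v"
        by (simp add: mult.assoc)
      also have "\<dots> \<approx> gap F' v * (scal c (vx v) + r) * gap F' v"
        by (intro eqv_mult_left eqv_mult_right D)
      also have "\<dots> = scal c (gap F' v * vx v * gap F' v) + gap F' v * r * gap F' v"
        by (simp add: distrib_left distrib_right scal_mult_left scal_mult_right)
      also have "\<dots> \<approx> scal c (gap F' v) + 0"
      proof (intro eqv_add)
        have "gap F' v * r * gap F' v \<in> J"
          using F' by (intro mult_right_mem[OF F0(3)]) auto
        then show "gap F' v * r * gap F' v \<approx> 0" by (simp add: eqv_zero_iff)
        have "gap F' v * vx v * gap F' v \<approx> gap F' v * gap F' v"
          by (intro eqv_mult_right gap_mult_vx F')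
        also have "\<dots> \<approx> gap F' v" using F' by (intro gap_idem)
        finally show "scal c (gap F' v * vx v * gap F' v) \<approx> scal c (gap F' v)"
          unfolding scal_def by (rule eqv_mult_left)
      qed
      finally have "gap F' v * (ghost \<alpha> v * a) \<approx> scal c (gap F' v)" by simp
      moreover have "gap F' v * (ghost \<alpha> v * a) \<in> L"
        by (intro L.mult_left_mem Suc.prems)
      ultimately have "scal c (gap F' v) \<in> L"
        by (simp only: eqv_mem_super[OF _ L.type_ideal_axioms L(2)])
      then show ?thesis
        using L.scal_mem_iff[OF D(1)] by simp
    qed
    have F1: "finite (F \<union> F0)" "F \<union> F0 \<subseteq> out_arcs G v" using F F0 by auto
    have gap_live: "gap F' v \<approx> gap live v"
      if "finite F'" "live \<subseteq> F'" "F' \<subseteq> out_arcs G v" for F'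
      using that by (intro gap_eqv_subset mult_right_mem dead) auto
    have live_sub: "live \<subseteq> out_arcs G v" by (auto simp: live_def)
    have breaking: "breaking_elem G H v = gap live v"
      by (simp add: breaking_elem_def gap_def live_def)
    consider (inf) "infinite live" | (empty) "live = {}"
      | (fin) "finite live" "live \<noteq> {}" by blast
    then show ?thesis
    proof cases
      case inf
      \<comment> \<open>A live edge outside the finite set compresses the gap to the vertex at its end.\<close>
      then have "\<not> live \<subseteq> F \<union> F0"
        using F1(1) finite_subset by blast
      then obtain e where e: "e \<in> live" "e \<notin> F \<union> F0" by blast
      have e': "e \<in> out_arcs G v" using e(1) live_sub by blast
      have "gh e * gap (F \<union> F0) v * ed e \<approx> gh e * ed e"
        using gh_mult_gap[OF F1 e'] e(2) by (intro eqv_mult_right) auto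
      also have "\<dots> \<approx> vx (head G e)" using e' by (intro gh_mult_ed_same) auto
      finally have "gh e * gap (F \<union> F0) v * ed e \<in> L \<longleftrightarrow> vx (head G e) \<in> L"
        by (rule eqv_mem_super[OF _ L.type_ideal_axioms L(2)])
      moreover have "gh e * gap (F \<union> F0) v * ed e \<in> L"
        by (rule L.mult_right_mem[OF L.mult_left_mem[OF gap_L[OF F1(1) subset_refl F1(2)]]])
      ultimately have "vx (head G e) \<in> L" by simp
      then show ?thesis using e(1) by (auto simp: live_def)
    next
      case empty
      then have "gap (F \<union> F0) v \<approx> vx v"
        using gap_live[OF F1(1) _ F1(2)] by (simp add: gap_def)
      then have "gap (F \<union> F0) v \<in> L \<longleftrightarrow> vx v \<in> L"
        by (rule eqv_mem_super[OF _ L.type_ideal_axioms L(2)])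
      then have "vx v \<in> L"
        using gap_L[OF F1(1) subset_refl F1(2)] by simp
      then show ?thesis using Suc.prems(2) by blast
    next
      case fin
      let ?F = "F \<union> F0 \<union> live"
      have F2: "finite ?F" "?F \<subseteq> out_arcs G v" using F1 fin live_sub by auto
      have elem: "gap ?F v \<approx> breaking_elem G H v"
        unfolding breaking using F2 by (intro gap_live) auto
      \<comment> \<open>Otherwise the element that was started with would be a multiple of an element of \<open>J\<close>.\<close>
      have not_J: "breaking_elem G H v \<notin> J"
      proof
        assume "breaking_elem G H v \<in> J"
        then have "gap ?F v \<in> J" using eqv_mem_iff[OF elem] by simp
        then have "a * gap ?F v \<in> J" by (rule mult_left_mem)
        moreover have "a \<approx> a * gap ?F v"
          by (rule a_gap[OF F2(1) _ F2(2)]) auto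
        ultimately have "a \<in> J" by (simp add: eqv_mem_iff)
        then show False using Suc.prems(4) by simp
      qed
      have "infinite (out_arcs G v)"
      proof
        assume f: "finite (out_arcs G v)"
        then have "regular_vertex G v"
          using fin live_sub Suc.prems(2) by (auto simp: regular_vertex_def)
        then have "gap (out_arcs G v) v \<in> J"
          using regular_sum by (simp add: gap_def eqv_def)
        then have "breaking_elem G H v \<in> J"
          unfolding breaking using eqv_mem_iff[OF gap_live[OF f live_sub subset_refl]] by simp
        with not_J show False by simp
      qed
      moreover have "{e \<in> out_arcs G v. head G e \<in> verts G - H} = live"
        by (auto simp: live_def)
      ultimately have "v \<in> breaking_vertices_of G H"
        using fin Suc.prems(2) unfolding breaking_vertices_of_def mem_Collect_eq by simp
      moreover have "v \<notin> S" using not_J S by blast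
      moreover have "breaking_elem G H v \<in> L"
      proof -
        have "gap ?F v \<in> L" by (rule gap_L[OF F2(1) _ F2(2)]) auto
        then show ?thesis using eqv_mem_super[OF elem L.type_ideal_axioms L(2)] by simp
      qed
      ultimately show ?thesis by blast
    qed
  qed
qed

lemma monomial_mult_vx_span:
  assumes "f \<in> span_mod J monomials"
  shows "\<exists>n. f * vx v \<in> span_mod J (monomials_from n v)"
  using assms
proof (induction rule: span_mod.induct)
  case (base f)
  then show ?case by (auto intro: span_mod.base mult_right_mem)
next
  case (step f m c)
  obtain n where n: "f * vx v \<in> span_mod J (monomials_from n v)" using step.IH by blast
  obtain u p w u' q where m: "m = path p w * ghost q w" "awalk u p w" "awalk u' q w"
    using step.hyps unfolding monomials_def by blast
  have "m * vx v = path p w * (ghost q w * vx v)" by (simp add: m(1) mult.assoc)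
  also have "\<dots> \<approx> path p w * (if v = u' then ghost q w else 0)"
    by (intro eqv_mult_left ghost_mult_vx m(3))
  finally have eq: "m * vx v \<approx> path p w * (if v = u' then ghost q w else 0)" .
  have "path p w * (if v = u' then ghost q w else 0) \<in> span_mod J (monomials_from (length q) v)"
    using m by (auto intro: span_mod_zero
        span_mod_basis monomials_fromI)
  from span_mod_eqv[OF this eq]
  have "m * vx v \<in> span_mod J (monomials_from (n + length q) v)"
    by (rule span_mod_mono[OF _ monomials_from_mono]) simp
  moreover have "f * vx v \<in> span_mod J (monomials_from (n + length q) v)"
    by (rule span_mod_mono[OF n monomials_from_mono]) simp
  ultimately have "(f + scal c m) * vx v \<in> span_mod J (monomials_from (n + length q) v)"
    by (simp add: distrib_right scal_mult_left span_mod_add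
        span_mod_scal)
  then show ?case by blast
qed

text \<open>
  Some vertex \<open>v\<close> on the right keeps \<open>a\<close> outside \<open>J\<close>, and the ghost parts of \<open>a v\<close> start in \<open>v\<close>.
\<close>

theorem reduction:
  assumes K: "condition_K G"
    and L: "leavitt_ideal G L" "J \<subseteq> L" "\<not> L \<subseteq> J"
    and H: "\<And>v. v \<in> H \<Longrightarrow> vx v \<in> J"
    and S: "\<And>v. v \<in> S \<Longrightarrow> breaking_elem G H v \<in> J"
  shows "(\<exists>w\<in>verts G - H. vx w \<in> L) \<or>
    (\<exists>w\<in>breaking_vertices_of G H - S. breaking_elem G H w \<in> L)"
proof -
  interpret L: leavitt_ideal G L by (rule L(1))
  obtain a where a: "a \<in> L" "a \<notin> J" using L(3) by blast
  have cf: "a \<in> const_free" using a(1) L.const_free by blast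
  obtain v where v: "v \<in> verts G" "a * vx v \<notin> J"
    using const_free_mult_vx[OF cf a(2)] by blast
  obtain n where n: "a * vx v \<in> span_mod J (monomials_from n v)"
    using monomial_mult_vx_span[OF const_free_in_span[OF cf]] by blast
  have "v \<notin> H" using v(2) H mult_left_mem[of "vx v" a] by blast
  with v n show ?thesis
    using reduction_step[OF K L(1,2) H S n _ L.mult_right_mem[OF a(1)] v(2)] by blast
qed

end

section \<open>Generated ideals and prime ideals\<close>

definition leavitt_generated ::
    "('v, 'e) pre_digraph \<Rightarrow> 'v set \<Rightarrow> 'v set \<Rightarrow> ('v, 'e, 'k::field) lpa_poly set" where
  "leavitt_generated G H S =
     \<Inter>{J. leavitt_ideal G J \<and> vx ` H \<subseteq> J \<and> breaking_elem G H ` S \<subseteq> J}"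

text \<open>
  Primeness of an ideal of the Leavitt path algebra, in terms of its preimage.
\<close>

definition leavitt_prime :: "('v, 'e) pre_digraph \<Rightarrow> ('v, 'e, 'k::field) lpa_poly set \<Rightarrow> bool" where
  "leavitt_prime G Q \<longleftrightarrow> leavitt_ideal G Q \<and> Q \<noteq> const_free \<and>
     (\<forall>J1 J2. leavitt_ideal G J1 \<and> leavitt_ideal G J2 \<and> (\<forall>f\<in>J1. \<forall>g\<in>J2. f * g \<in> Q) \<longrightarrow>
        J1 \<subseteq> Q \<or> J2 \<subseteq> Q)"

lemma breaking_elem_const_free:
  "breaking_elem G H v \<in> (const_free :: ('v, 'e, 'k::field) lpa_poly set)"
proof -
  interpret C: type_ideal "const_free :: ('v, 'e, 'k) lpa_poly set"
    by (rule type_ideal_const_free)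
  show ?thesis
    unfolding breaking_elem_def by (intro C.diff_mem C.sum_mem C.mult_left_mem gen_const_free)
qed

lemma leavitt_generated_least:
  assumes "leavitt_ideal G J" "vx ` H \<subseteq> J" "breaking_elem G H ` S \<subseteq> J"
  shows "leavitt_generated G H S \<subseteq> J"
  unfolding leavitt_generated_def using assms by blast

lemma leavitt_generated_mem:
  "v \<in> H \<Longrightarrow> vx v \<in> leavitt_generated G H S"
  "v \<in> S \<Longrightarrow> breaking_elem G H v \<in> leavitt_generated G H S"
  unfolding leavitt_generated_def by blast+

section \<open>Free algebras inside the polynomial ring\<close>

lemma free_algebra_sel:
  "mult (free_algebra X) = (*)" "add (free_algebra X) = (+)" "\<zero>\<^bsub>free_algebra X\<^esub> = 0"
  "mult (free_algebra_nonunital X) = (*)" "add (free_algebra_nonunital X) = (+)"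
  "carrier (free_algebra_nonunital X) = carrier (free_algebra X) \<inter> const_free"
  by (auto simp: free_algebra_def free_algebra_nonunital_def const_free_def)

lemma single_0_in_free_algebra: "Poly_Mapping.single 0 c \<in> carrier (free_algebra X)"
  by (auto simp: free_algebra_def zero_free_monoid_def split: if_splits)

lemma gen_in_free_algebra: "x \<in> X \<Longrightarrow> gen x \<in> carrier (free_algebra X)"
  by (simp add: free_algebra_def)

lemma free_algebra_uminus:
  fixes f :: "('x, 'k::field) nc_poly"
  assumes "f \<in> carrier (free_algebra X)"
  shows "- f \<in> carrier (free_algebra X)"
  using monoid.m_closed[OF ring.is_monoid[OF ring_free_algebra] single_0_in_free_algebra[of "- 1"] assms]
  by (simp add: free_algebra_sel single_uminus)

lemma free_algebra_closed:
  fixes f g :: "('x, 'k::field) nc_poly"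
  assumes "f \<in> carrier (free_algebra X)" "g \<in> carrier (free_algebra X)"
  shows "f + g \<in> carrier (free_algebra X)" "f * g \<in> carrier (free_algebra X)"
    "f - g \<in> carrier (free_algebra X)"
proof -
  interpret ring "free_algebra X :: ('x, 'k) nc_poly ring" by (rule ring_free_algebra)
  show "f + g \<in> carrier (free_algebra X)" and "f * g \<in> carrier (free_algebra X)"
    using a_closed[OF assms] m_closed[OF assms] by (simp_all add: free_algebra_sel)
  show "f - g \<in> carrier (free_algebra X)"
    using a_closed[OF assms(1) free_algebra_uminus[OF assms(2)]] by (simp add: free_algebra_sel)
qed

lemma free_algebra_sum_closed:
  fixes f :: "'i \<Rightarrow> ('x, 'k::field) nc_poly"
  assumes "\<And>i. i \<in> A \<Longrightarrow> f i \<in> carrier (free_algebra X)"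
  shows "sum f A \<in> carrier (free_algebra X)"
  using assms
proof (induction A rule: infinite_finite_induct)
  case (insert x A)
  then show ?case by (simp add: free_algebra_closed)
qed (simp_all add: free_algebra_def)

text \<open>
  The words with a letter outside \<open>X\<close> span an ideal that is a complement of the free algebra over \<open>X\<close>.
\<close>

definition foreign :: "'x set \<Rightarrow> ('x, 'k::field) nc_poly set" where
  "foreign X = {f. \<forall>w\<in>Poly_Mapping.keys f. \<not> set (letters w) \<subseteq> X}"

lemma type_ideal_foreign: "type_ideal (foreign X :: ('x, 'k::field) nc_poly set)"
proof
  show "x + y \<in> foreign X" if "x \<in> foreign X" "y \<in> foreign X" for x y :: "('x, 'k) nc_poly"
    using that Poly_Mapping.keys_add[of x y] by (auto simp: foreign_def)
  have *: "f * g \<in> foreign X" if fg: "f \<in> foreign X \<or> g \<in> foreign X" for f g :: "('x, 'k) nc_poly"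
    unfolding foreign_def
  proof (intro CollectI ballI)
    fix w assume "w \<in> Poly_Mapping.keys (f * g)"
    then obtain u v where "w = u + v" "u \<in> Poly_Mapping.keys f" "v \<in> Poly_Mapping.keys g"
      using Poly_Mapping.keys_mult[of f g] by blast
    then show "\<not> set (letters w) \<subseteq> X"
      using fg by (auto simp: foreign_def plus_free_monoid_def)
  qed
  show "a * x \<in> foreign X" "x * a \<in> foreign X" if "x \<in> foreign X" for x a :: "('x, 'k) nc_poly"
    using that * by blast+
qed (simp add: foreign_def)

lemma foreign_const_free: "foreign X \<subseteq> const_free"
proof
  fix f assume "f \<in> foreign X"
  then have "Word [] \<notin> Poly_Mapping.keys f" by (auto simp: foreign_def)
  then show "f \<in> const_free" by (simp add: const_free_def zero_free_monoid_def in_keys_iff)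
qed

lemma free_algebra_Int_foreign:
  "f \<in> carrier (free_algebra X) \<Longrightarrow> f \<in> foreign X \<Longrightarrow> f = 0"
  using keys_eq_empty[of f] by (auto simp: foreign_def free_algebra_def)

lemma free_algebra_foreign_decomp:
  fixes f :: "('x, 'k::field) nc_poly"
  obtains g z where "f = g + z" "g \<in> carrier (free_algebra X)" "z \<in> foreign X"
proof -
  let ?K = "{w \<in> Poly_Mapping.keys f. set (letters w) \<subseteq> X}"
  let ?s = "\<lambda>w. Poly_Mapping.single w (Poly_Mapping.lookup f w)"
  interpret Z: type_ideal "foreign X :: ('x, 'k) nc_poly set" by (rule type_ideal_foreign)
  have "f = sum ?s (Poly_Mapping.keys f)"
    by (rule poly_mapping_eq_sum_single)
  also have "\<dots> = sum ?s (Poly_Mapping.keys f - ?K) + sum ?s ?K"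
    by (rule sum.subset_diff) auto
  finally have "f = sum ?s ?K + sum ?s (Poly_Mapping.keys f - ?K)"
    by (simp add: add.commute)
  moreover have "sum ?s ?K \<in> carrier (free_algebra X)"
    by (intro free_algebra_sum_closed) (auto simp: free_algebra_def split: if_splits)
  moreover have "sum ?s (Poly_Mapping.keys f - ?K) \<in> foreign X"
    by (intro Z.sum_mem) (auto simp: foreign_def split: if_splits)
  ultimately show ?thesis by (rule that)
qed


section \<open>The ideal of relations\<close>

lemma ideal_of_type_ideal:
  fixes J :: "('x, 'k::field) nc_poly set"
  assumes "type_ideal J"
  shows "ideal (J \<inter> carrier (free_algebra X)) (free_algebra X)"
proof (rule idealI)
  let ?A = "free_algebra X :: ('x, 'k) nc_poly ring"
  interpret J: type_ideal J by fact
  interpret A: ring ?A by (rule ring_free_algebra)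
  show "ring ?A" by (rule ring_free_algebra)
  have neg: "inv\<^bsub>add_monoid ?A\<^esub> f = - f" if "f \<in> carrier ?A" for f
    using A.minus_equality[of "- f" f] that free_algebra_uminus[OF that]
    by (simp add: free_algebra_sel a_inv_def)
  show "subgroup (J \<inter> carrier ?A) (add_monoid ?A)"
  proof (rule group.subgroupI[OF A.a_group])
    show "J \<inter> carrier ?A \<noteq> {}" using J.zero_mem A.zero_closed by (auto simp: free_algebra_sel)
    show "inv\<^bsub>add_monoid ?A\<^esub> a \<in> J \<inter> carrier ?A" if "a \<in> J \<inter> carrier ?A" for a
      using that neg[of a] J.minus_mem[of a] free_algebra_uminus[of a] by auto
  qed (auto simp: free_algebra_sel J.add_mem free_algebra_closed)
qed (auto simp: free_algebra_sel free_algebra_closed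
       type_ideal.mult_left_mem[OF assms] type_ideal.mult_right_mem[OF assms])

text \<open>
  For an ideal \<open>I\<close> of the free algebra, this is an ideal of the full polynomial ring that restricts to \<open>I\<close>.
\<close>

definition extension ::
    "('v, 'e) pre_digraph \<Rightarrow> ('v, 'e, 'k::field) lpa_poly set \<Rightarrow> ('v, 'e, 'k) lpa_poly set"
  where "extension G I = {f + z | f z. f \<in> I \<and> z \<in> foreign (lpa_gens G)}"

lemma extension_iff:
  assumes "I \<subseteq> carrier (free_algebra (lpa_gens G))" "f \<in> carrier (free_algebra (lpa_gens G))"
  shows "f \<in> extension G I \<longleftrightarrow> f \<in> I"
proof
  assume "f \<in> I"
  then have "f + 0 \<in> extension G I"
    unfolding extension_def using type_ideal.zero_mem[OF type_ideal_foreign] by blast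
  then show "f \<in> extension G I" by simp
next
  assume "f \<in> extension G I"
  then obtain g z where fg: "f = g + z" "g \<in> I" "z \<in> foreign (lpa_gens G)"
    unfolding extension_def by blast
  then have "z = f - g" by simp
  then have "z \<in> carrier (free_algebra (lpa_gens G))"
    using free_algebra_closed(3)[OF assms(2), of g] fg(2) assms(1) by blast
  then have "z = 0" using free_algebra_Int_foreign fg(3) by blast
  then show "f \<in> I" using fg by simp
qed

context
  fixes G :: "('v, 'e) pre_digraph" and k :: "'k::field itself"
  assumes wf: "wf_digraph G"
begin

interpretation wf_digraph G by (rule wf)

abbreviation free_lpa :: "('v, 'e, 'k) lpa_poly set" where
  "free_lpa \<equiv> carrier (free_algebra (lpa_gens G))"

abbreviation polys :: "('v, 'e, 'k) lpa_poly set" where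
  "polys \<equiv> free_lpa \<inter> const_free"

lemma relations_subset:
  "(lpa_relations G :: ('v, 'e, 'k) lpa_poly set)
     \<subseteq> polys"
proof -
  let ?D = "free_lpa \<inter> const_free :: ('v, 'e, 'k) lpa_poly set"
  interpret C: type_ideal "const_free :: ('v, 'e, 'k) lpa_poly set"
    by (rule type_ideal_const_free)
  have mult: "f * g \<in> ?D" and diff: "f - g \<in> ?D" if "f \<in> ?D" "g \<in> ?D" for f g
    using that free_algebra_closed[of f _ g] C.mult_left_mem C.diff_mem by blast+
  have zero: "0 \<in> ?D" using C.zero_mem by (simp add: free_algebra_def)
  have sum: "sum f A \<in> ?D" if "\<And>i. i \<in> A \<Longrightarrow> f i \<in> ?D" for f :: "'e \<Rightarrow> _" and A
    using that free_algebra_sum_closed[of A f] C.sum_mem[of A f] by blast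
  have gen: "gen x \<in> ?D" if "x \<in> lpa_gens G" for x
    using that by (simp add: gen_in_free_algebra)
  have gens: "v \<in> verts G \<Longrightarrow> vx v \<in> ?D" "e \<in> arcs G \<Longrightarrow> ed e \<in> ?D" "e \<in> arcs G \<Longrightarrow> gh e \<in> ?D"
    for v e
    by (rule gen; simp add: lpa_gens_def)+
  have ite: "(if P then f else 0) \<in> ?D" if "f \<in> ?D" for P f
    using that zero by simp
  show ?thesis
    unfolding lpa_relations_def regular_vertex_def
    by (intro Un_least subsetI; elim CollectE exE conjE; hypsubst)
       (intro diff mult ite sum gens; simp)+
qed

abbreviation relation_ideal :: "('v, 'e, 'k) lpa_poly set" where
  "relation_ideal \<equiv> lpa_relation_ideal G"

lemma relation_ideal_subset:
  "(relation_ideal :: ('v, 'e, 'k) lpa_poly set)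
     \<subseteq> polys"
proof -
  have "(lpa_relations G :: ('v, 'e, 'k) lpa_poly set) \<subseteq> const_free \<inter> free_lpa"
    using relations_subset by blast
  from ring.genideal_minimal[OF ring_free_algebra ideal_of_type_ideal[OF type_ideal_const_free] this]
  show ?thesis unfolding lpa_relation_ideal_def by blast
qed

lemma ideal_relation_ideal:
  "ideal (relation_ideal :: ('v, 'e, 'k) lpa_poly set) (free_algebra (lpa_gens G))"
  unfolding lpa_relation_ideal_def
  by (rule ring.genideal_ideal[OF ring_free_algebra]) (use relations_subset in blast)

lemma relations_in_relation_ideal:
  "(lpa_relations G :: ('v, 'e, 'k) lpa_poly set) \<subseteq> relation_ideal"
  unfolding lpa_relation_ideal_def
  by (rule ring.genideal_self[OF ring_free_algebra]) (use relations_subset in blast)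

lemma relation_ideal_minimal:
  fixes J :: "('v, 'e, 'k) lpa_poly set"
  assumes "type_ideal J" "lpa_relations G \<subseteq> J"
  shows "relation_ideal \<subseteq> J"
proof -
  have "lpa_relations G \<subseteq> J \<inter> free_lpa"
    using relations_subset assms(2) by blast
  from ring.genideal_minimal[OF ring_free_algebra ideal_of_type_ideal[OF assms(1)] this]
  show ?thesis unfolding lpa_relation_ideal_def by blast
qed

lemma extension_leavitt:
  fixes I :: "('v, 'e, 'k) lpa_poly set"
  assumes sub: "I \<subseteq> free_lpa \<inter> const_free"
    and rel: "relation_ideal \<subseteq> I"
    and add: "\<And>f g. f \<in> I \<Longrightarrow> g \<in> I \<Longrightarrow> f + g \<in> I"
    and mult: "\<And>f a. f \<in> I \<Longrightarrow> a \<in> free_lpa \<Longrightarrow> a * f \<in> I \<and> f * a \<in> I"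
  shows "leavitt_ideal G (extension G I)"
proof -
  interpret Z: type_ideal "foreign (lpa_gens G) :: ('v, 'e, 'k) lpa_poly set"
    by (rule type_ideal_foreign)
  have "\<zero>\<^bsub>free_algebra (lpa_gens G)\<^esub> \<in> (relation_ideal :: ('v, 'e, 'k) lpa_poly set)"
    using ideal.axioms(1)[OF ideal_relation_ideal] additive_subgroup.zero_closed by blast
  then have zero: "0 \<in> I" using rel by (auto simp: free_algebra_sel)
  have mem: "f + z \<in> extension G I" if "f \<in> I" "z \<in> foreign (lpa_gens G)" for f z
    using that unfolding extension_def by blast
  show ?thesis
  proof
    show "0 \<in> extension G I" using mem[OF zero Z.zero_mem] by simp
  next
    fix x y assume "x \<in> extension G I" "y \<in> extension G I"
    then obtain f z g z' where "x = f + z" "y = g + z'" "f \<in> I" "g \<in> I"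
      "z \<in> foreign (lpa_gens G)" "z' \<in> foreign (lpa_gens G)"
      unfolding extension_def by blast
    then show "x + y \<in> extension G I"
      using mem[of "f + g" "z + z'"] add Z.add_mem by (simp add: algebra_simps)
  next
    fix x a :: "('v, 'e, 'k) lpa_poly" assume "x \<in> extension G I"
    then obtain f z where x: "x = f + z" "f \<in> I" "z \<in> foreign (lpa_gens G)"
      unfolding extension_def by blast
    obtain b y where a: "a = b + y" "b \<in> free_lpa" "y \<in> foreign (lpa_gens G)"
      by (rule free_algebra_foreign_decomp)
    have "b * f \<in> I" "f * b \<in> I" using mult x a by auto
    moreover have "b * z + (y * f + y * z) \<in> foreign (lpa_gens G)"
      "f * y + (z * b + z * y) \<in> foreign (lpa_gens G)"
      using x a Z.add_mem Z.mult_left_mem Z.mult_right_mem by simp_all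
    ultimately show "a * x \<in> extension G I" "x * a \<in> extension G I"
      using mem[of "b * f" "b * z + (y * f + y * z)"] mem[of "f * b" "f * y + (z * b + z * y)"]
      by (simp_all add: x(1) a(1) algebra_simps)
  next
    show "lpa_relations G \<subseteq> extension G I"
    proof
      fix f :: "('v, 'e, 'k) lpa_poly" assume "f \<in> lpa_relations G"
      then have "f \<in> I" using relations_in_relation_ideal rel by blast
      then show "f \<in> extension G I" using mem[OF _ Z.zero_mem] by fastforce
    qed
  next
    fix x :: "('v, 'e) lpa_gen" assume "x \<notin> lpa_gens G"
    then have "gen x \<in> (foreign (lpa_gens G) :: ('v, 'e, 'k) lpa_poly set)"
      by (simp add: foreign_def)
    then show "gen x \<in> extension G I" using mem[OF zero] by fastforce
  next
    show "extension G I \<subseteq> const_free"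
      using sub foreign_const_free type_ideal.add_mem[OF type_ideal_const_free]
      unfolding extension_def by blast
  qed
qed

section \<open>Ideals of the Leavitt path algebra\<close>

lemma relation_ideal_closed:
  "0 \<in> relation_ideal"
  "\<lbrakk>f \<in> relation_ideal; g \<in> relation_ideal\<rbrakk> \<Longrightarrow> f + g \<in> relation_ideal"
  "\<lbrakk>f \<in> relation_ideal; a \<in> free_lpa\<rbrakk> \<Longrightarrow> a * f \<in> relation_ideal"
  "\<lbrakk>f \<in> relation_ideal; a \<in> free_lpa\<rbrakk> \<Longrightarrow> f * a \<in> relation_ideal"
  "f \<in> relation_ideal \<Longrightarrow> - f \<in> relation_ideal"
  "\<lbrakk>f \<in> relation_ideal; g \<in> relation_ideal\<rbrakk> \<Longrightarrow> f - g \<in> relation_ideal"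
proof -
  note R = ideal_relation_ideal
  note sub = ideal.axioms(1)[OF R]
  show z: "0 \<in> relation_ideal"
    using additive_subgroup.zero_closed[OF sub] by (simp add: free_algebra_sel)
  show add: "\<lbrakk>f \<in> relation_ideal; g \<in> relation_ideal\<rbrakk> \<Longrightarrow> f + g \<in> relation_ideal" for f g
    using additive_subgroup.a_closed[OF sub] by (simp add: free_algebra_sel)
  show l: "\<lbrakk>f \<in> relation_ideal; a \<in> free_lpa\<rbrakk> \<Longrightarrow> a * f \<in> relation_ideal" for f a
    using ideal.I_l_closed[OF R] by (simp add: free_algebra_sel)
  show "\<lbrakk>f \<in> relation_ideal; a \<in> free_lpa\<rbrakk> \<Longrightarrow> f * a \<in> relation_ideal" for f a
    using ideal.I_r_closed[OF R] by (simp add: free_algebra_sel)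
  show neg: "f \<in> relation_ideal \<Longrightarrow> - f \<in> relation_ideal" for f
    using l[OF _ single_0_in_free_algebra, of f "- 1"] by (simp add: single_uminus)
  show "\<lbrakk>f \<in> relation_ideal; g \<in> relation_ideal\<rbrakk> \<Longrightarrow> f - g \<in> relation_ideal" for f g
    using add[OF _ neg, of f g] by simp
qed

lemma lpa_class_eq_coset:
  "lpa_class G f = a_r_coset (free_algebra (lpa_gens G)) relation_ideal f"
  by (simp add: lpa_class_def a_r_coset_defs free_algebra_sel)

lemma lpa_class_image: "lpa_class G f = (\<lambda>h. h + f) ` relation_ideal"
  by (auto simp: lpa_class_eq_coset a_r_coset_defs free_algebra_sel)

lemma lpa_class_eq_iff:
  fixes f g :: "('v, 'e, 'k) lpa_poly"
  shows "lpa_class G f = lpa_class G g \<longleftrightarrow> f - g \<in> relation_ideal"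
proof
  assume "lpa_class G f = lpa_class G g"
  moreover have "0 + f \<in> lpa_class G f"
    unfolding lpa_class_image using relation_ideal_closed(1) by blast
  ultimately obtain h where "f = h + g" "h \<in> relation_ideal"
    unfolding lpa_class_image by auto
  then show "f - g \<in> relation_ideal" by simp
next
  assume fg: "f - g \<in> relation_ideal"
  have "h + f \<in> lpa_class G g" if "h \<in> relation_ideal" for h
    unfolding lpa_class_image using relation_ideal_closed(2)[OF that fg]
    by (intro image_eqI[of _ _ "h + (f - g)"]) simp_all
  moreover have "h + g \<in> lpa_class G f" if "h \<in> relation_ideal" for h
    unfolding lpa_class_image using relation_ideal_closed(6)[OF that fg]
    by (intro image_eqI[of _ _ "h - (f - g)"]) simp_all
  ultimately show "lpa_class G f = lpa_class G g"
    by (auto simp: lpa_class_image)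
qed

lemma lpa_zero: "\<zero>\<^bsub>lpa k G\<^esub> = lpa_class G 0"
  by (simp add: lpa_def FactRing_def lpa_class_image)

lemma lpa_carrier: "carrier (lpa k G) = lpa_class G ` polys"
  unfolding lpa_def FactRing_def A_RCOSETS_def' lpa_class_def by (auto simp: free_algebra_sel)

lemma lpa_mult:
  assumes "f \<in> polys" "g \<in> polys"
  shows "lpa_class G f \<otimes>\<^bsub>lpa k G\<^esub> lpa_class G g = lpa_class G (f * g)"
proof -
  have "lpa_class G f \<otimes>\<^bsub>lpa k G\<^esub> lpa_class G g =
        rcoset_mult (free_algebra (lpa_gens G)) relation_ideal (lpa_class G f) (lpa_class G g)"
    by (simp add: lpa_def FactRing_def rcoset_mult_def a_r_coset_defs free_algebra_sel)
  also have "\<dots> = lpa_class G (f * g)"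
    unfolding lpa_class_eq_coset
    using ideal.rcoset_mult_add[OF ideal_relation_ideal, of f g] assms by (simp add: free_algebra_sel)
  finally show ?thesis .
qed

lemma lpa_add:
  assumes "f \<in> polys" "g \<in> polys"
  shows "lpa_class G f \<oplus>\<^bsub>lpa k G\<^esub> lpa_class G g = lpa_class G (f + g)"
proof -
  have "lpa_class G f \<oplus>\<^bsub>lpa k G\<^esub> lpa_class G g =
        set_add (free_algebra (lpa_gens G)) (lpa_class G f) (lpa_class G g)"
    by (simp add: lpa_def FactRing_def set_add_defs free_algebra_sel)
  also have "\<dots> = lpa_class G (f + g)"
  proof -
    interpret R: ideal relation_ideal "free_algebra (lpa_gens G)" by (rule ideal_relation_ideal)
    show ?thesis
      unfolding lpa_class_eq_coset
      using R.a_rcos_sum[of f g] assms by (simp add: free_algebra_sel)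
  qed
  finally show ?thesis .
qed

lemma polys_closed:
  "f \<in> polys \<Longrightarrow> g \<in> polys \<Longrightarrow> f + g \<in> polys"
  "f \<in> free_lpa \<Longrightarrow> g \<in> polys \<Longrightarrow> f * g \<in> polys"
  "f \<in> polys \<Longrightarrow> g \<in> free_lpa \<Longrightarrow> f * g \<in> polys"
  "f \<in> polys \<Longrightarrow> - f \<in> polys"
  "0 \<in> polys"
proof -
  interpret C: type_ideal "const_free :: ('v, 'e, 'k) lpa_poly set" by (rule type_ideal_const_free)
  show "f \<in> polys \<Longrightarrow> g \<in> polys \<Longrightarrow> f + g \<in> polys"
    "f \<in> free_lpa \<Longrightarrow> g \<in> polys \<Longrightarrow> f * g \<in> polys"
    "f \<in> polys \<Longrightarrow> g \<in> free_lpa \<Longrightarrow> f * g \<in> polys"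
    "f \<in> polys \<Longrightarrow> - f \<in> polys"
    by (simp_all add: free_algebra_closed free_algebra_uminus C.add_mem C.mult_left_mem C.mult_right_mem C.minus_mem)
  show "0 \<in> polys" using C.zero_mem by (simp add: free_algebra_def)
qed

lemma abelian_group_lpa: "abelian_group (lpa k G)"
proof (rule abelian_groupI)
  show "\<exists>y\<in>carrier (lpa k G). y \<oplus>\<^bsub>lpa k G\<^esub> x = \<zero>\<^bsub>lpa k G\<^esub>" if x: "x \<in> carrier (lpa k G)" for x
  proof -
    obtain f where "x = lpa_class G f" "f \<in> polys" using x lpa_carrier by auto
    then show ?thesis
      using lpa_add[of "- f" f] polys_closed(4)[of f]
      by (intro bexI[of _ "lpa_class G (- f)"]) (simp_all add: lpa_carrier lpa_zero)
  qed
  show "x \<oplus>\<^bsub>lpa k G\<^esub> y \<in> carrier (lpa k G)" "x \<oplus>\<^bsub>lpa k G\<^esub> y = y \<oplus>\<^bsub>lpa k G\<^esub> x"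
    if "x \<in> carrier (lpa k G)" "y \<in> carrier (lpa k G)" for x y
    using that unfolding lpa_carrier
    by (elim imageE; simp add: lpa_add polys_closed add.commute del: Int_iff)+
  show "x \<oplus>\<^bsub>lpa k G\<^esub> y \<oplus>\<^bsub>lpa k G\<^esub> z = x \<oplus>\<^bsub>lpa k G\<^esub> (y \<oplus>\<^bsub>lpa k G\<^esub> z)"
    if "x \<in> carrier (lpa k G)" "y \<in> carrier (lpa k G)" "z \<in> carrier (lpa k G)" for x y z
    using that unfolding lpa_carrier
    by (elim imageE) (simp add: lpa_add polys_closed add.assoc del: Int_iff)
  show "\<zero>\<^bsub>lpa k G\<^esub> \<in> carrier (lpa k G)"
    using polys_closed(5) by (simp add: lpa_carrier lpa_zero del: Int_iff)
  show "\<zero>\<^bsub>lpa k G\<^esub> \<oplus>\<^bsub>lpa k G\<^esub> x = x" if "x \<in> carrier (lpa k G)" for x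
    using that unfolding lpa_carrier lpa_zero
    by (elim imageE) (simp add: lpa_add polys_closed del: Int_iff)
qed

lemma lpa_inv:
  assumes "f \<in> polys"
  shows "inv\<^bsub>add_monoid (lpa k G)\<^esub> lpa_class G f = lpa_class G (- f)"
proof -
  have "\<ominus>\<^bsub>lpa k G\<^esub> lpa_class G f = lpa_class G (- f)"
    using assms polys_closed(4)[OF assms]
    by (intro abelian_group.minus_equality[OF abelian_group_lpa])
       (simp_all add: lpa_add lpa_carrier lpa_zero)
  then show ?thesis by (simp only: a_inv_def)
qed

text \<open>
  These two maps are inverse to each other: ideals of the Leavitt path algebra correspond to the
  ideals of the full polynomial ring of the kind considered above.
\<close>

definition preimage_ideal :: "('v, 'e, 'k) lpa_poly set set \<Rightarrow> ('v, 'e, 'k) lpa_poly set" where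
  "preimage_ideal I = extension G {f \<in> polys. lpa_class G f \<in> I}"

definition image_ideal :: "('v, 'e, 'k) lpa_poly set \<Rightarrow> ('v, 'e, 'k) lpa_poly set set" where
  "image_ideal J = lpa_class G ` (J \<inter> polys)"

lemma preimage_ideal_iff: "f \<in> polys \<Longrightarrow> f \<in> preimage_ideal I \<longleftrightarrow> lpa_class G f \<in> I"
  unfolding preimage_ideal_def by (subst extension_iff) auto

lemma two_sided_ideal_lpaD:
  assumes "two_sided_ideal (lpa k G) I"
  shows "I \<subseteq> lpa_class G ` polys" "lpa_class G 0 \<in> I"
    "\<lbrakk>f \<in> polys; g \<in> polys; lpa_class G f \<in> I; lpa_class G g \<in> I\<rbrakk> \<Longrightarrow> lpa_class G (f + g) \<in> I"
    "\<lbrakk>f \<in> polys; g \<in> polys; lpa_class G f \<in> I\<rbrakk> \<Longrightarrow> lpa_class G (g * f) \<in> I"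
    "\<lbrakk>f \<in> polys; g \<in> polys; lpa_class G f \<in> I\<rbrakk> \<Longrightarrow> lpa_class G (f * g) \<in> I"
proof -
  have sub: "additive_subgroup I (lpa k G)"
    and mult: "\<And>x a. x \<in> I \<Longrightarrow> a \<in> carrier (lpa k G) \<Longrightarrow> a \<otimes>\<^bsub>lpa k G\<^esub> x \<in> I \<and> x \<otimes>\<^bsub>lpa k G\<^esub> a \<in> I"
    using assms by (auto simp: two_sided_ideal_def)
  show "I \<subseteq> lpa_class G ` polys"
    using additive_subgroup.a_subset[OF sub] by (simp add: lpa_carrier)
  show "lpa_class G 0 \<in> I"
    using additive_subgroup.zero_closed[OF sub] by (simp add: lpa_zero)
  show "lpa_class G (f + g) \<in> I"
    if "f \<in> polys" "g \<in> polys" "lpa_class G f \<in> I" "lpa_class G g \<in> I"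
    using additive_subgroup.a_closed[OF sub that(3,4)] lpa_add[OF that(1,2)] by simp
  show "lpa_class G (g * f) \<in> I" "lpa_class G (f * g) \<in> I"
    if fg: "f \<in> polys" "g \<in> polys" "lpa_class G f \<in> I"
    using mult[OF fg(3), of "lpa_class G g"] lpa_mult[OF fg(1,2)] lpa_mult[OF fg(2,1)] fg(2)
    by (auto simp: lpa_carrier)
qed

lemma leavitt_extension_relation_ideal: "leavitt_ideal G (extension G relation_ideal)"
  by (rule extension_leavitt) (use relation_ideal_subset relation_ideal_closed in auto)

text \<open>
  A sum of vertices that is a right unit modulo the extended ideal of relations is one modulo the
  ideal of relations itself, since the difference lies in the free algebra.
\<close>

lemma polys_local_unit:
  assumes "f \<in> polys"
  obtains u where "u \<in> polys" "f * u - f \<in> relation_ideal"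
proof -
  interpret leavitt_ideal G "extension G relation_ideal"
    by (rule leavitt_extension_relation_ideal)
  have "f \<in> const_free" using assms by simp
  then obtain V where V: "finite V" "V \<subseteq> verts G"
    "type_ideal.eqv (extension G relation_ideal) (f * (\<Sum>v\<in>V. vx v)) f"
    by (rule local_unit)
  have gen: "vx v \<in> polys" if "v \<in> V" for v
    using that V(2) gen_in_gens_iff(1) by (auto intro: gen_in_free_algebra)
  then have u: "(\<Sum>v\<in>V. vx v) \<in> polys"
    using free_algebra_sum_closed[of V vx] type_ideal.sum_mem[OF type_ideal_const_free, of V vx] by blast
  moreover have "f * (\<Sum>v\<in>V. vx v) - f \<in> polys"
    using polys_closed(1)[OF polys_closed(3)[OF assms] polys_closed(4)[OF assms]] u by simp
  then have "f * (\<Sum>v\<in>V. vx v) - f \<in> relation_ideal"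
    using V(3) extension_iff[of relation_ideal G] relation_ideal_subset by (auto simp: eqv_def)
  ultimately show ?thesis by (rule that)
qed

text \<open>
  Ideals are not assumed to be subspaces, but scalars can be moved into a local unit \<open>u\<close>:
  \<open>c f = c (f u) = f (c u)\<close>.
\<close>

lemma preimage_ideal_scal:
  assumes I: "two_sided_ideal (lpa k G) I" and f: "f \<in> polys" "lpa_class G f \<in> I"
  shows "lpa_class G (scal c f) \<in> I"
proof -
  obtain u where u: "u \<in> polys" "f * u - f \<in> relation_ideal"
    using polys_local_unit[OF f(1)] by blast
  have "scal c u \<in> polys"
    unfolding scal_def by (intro polys_closed u single_0_in_free_algebra)
  then have "lpa_class G (f * scal c u) \<in> I"
    using two_sided_ideal_lpaD(5)[OF I f(1) _ f(2)] by blast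
  moreover have "scal c (f * u - f) \<in> relation_ideal"
    unfolding scal_def by (intro relation_ideal_closed u single_0_in_free_algebra)
  then have "lpa_class G (f * scal c u) = lpa_class G (scal c f)"
    unfolding lpa_class_eq_iff by (simp add: scal_def[of c "f * u - f"] right_diff_distrib
        scal_mult_right) (simp add: scal_def)
  ultimately show ?thesis by simp
qed

lemma preimage_ideal_leavitt:
  assumes I: "two_sided_ideal (lpa k G) I"
  shows "leavitt_ideal G (preimage_ideal I)"
  unfolding preimage_ideal_def
proof (rule extension_leavitt)
  show "{f \<in> polys. lpa_class G f \<in> I} \<subseteq> polys" by blast
  show "relation_ideal \<subseteq> {f \<in> polys. lpa_class G f \<in> I}"
  proof
    fix f :: "('v, 'e, 'k) lpa_poly" assume f: "f \<in> relation_ideal"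
    then have "lpa_class G f = lpa_class G 0" by (simp add: lpa_class_eq_iff)
    then show "f \<in> {f \<in> polys. lpa_class G f \<in> I}"
      using two_sided_ideal_lpaD(2)[OF I] relation_ideal_subset f by auto
  qed
  show "f + g \<in> {f \<in> polys. lpa_class G f \<in> I}"
    if "f \<in> {f \<in> polys. lpa_class G f \<in> I}" "g \<in> {f \<in> polys. lpa_class G f \<in> I}" for f g
    using that two_sided_ideal_lpaD(3)[OF I, of f g] polys_closed(1)[of f g] by blast
  fix f a :: "('v, 'e, 'k) lpa_poly"
  assume "f \<in> {f \<in> polys. lpa_class G f \<in> I}" and a: "a \<in> free_lpa"
  then have f: "f \<in> polys" "lpa_class G f \<in> I" by auto
  define c where "c = Poly_Mapping.lookup a 0"
  \<comment> \<open>A polynomial is a scalar plus a polynomial without constant term.\<close>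
  define a' where "a' = a - Poly_Mapping.single 0 c"
  have "a' \<in> const_free" by (simp add: a'_def c_def const_free_def lookup_minus)
  moreover have "a' \<in> free_lpa"
    unfolding a'_def by (intro free_algebra_closed a single_0_in_free_algebra)
  ultimately have a': "a' \<in> polys" by simp
  have sc: "scal c f \<in> polys"
    unfolding scal_def by (intro polys_closed f single_0_in_free_algebra)
  have "a * f = scal c f + a' * f"
    by (simp add: a'_def scal_def algebra_simps)
  moreover have "f * a = scal c f + f * a'"
    using scal_mult_right[of f c 1] by (simp add: a'_def scal_def algebra_simps)
  moreover have "lpa_class G (scal c f + a' * f) \<in> I" "lpa_class G (scal c f + f * a') \<in> I"
    using two_sided_ideal_lpaD(4)[OF I f(1) a' f(2)] two_sided_ideal_lpaD(5)[OF I f(1) a' f(2)]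
      a' f(1) preimage_ideal_scal[OF I f, of c] polys_closed(3)[OF f(1), of a'] polys_closed(3)[OF a', of f]
    by (auto intro!: two_sided_ideal_lpaD(3)[OF I sc] simp del: Int_iff)
  moreover have "a * f \<in> polys" "f * a \<in> polys"
    using polys_closed(2)[OF a f(1)] polys_closed(3)[OF f(1) a] by blast+
  ultimately show "a * f \<in> {f \<in> polys. lpa_class G f \<in> I} \<and> f * a \<in> {f \<in> polys. lpa_class G f \<in> I}"
    by simp
qed

lemma leavitt_ideal_relation:
  fixes J :: "('v, 'e, 'k) lpa_poly set"
  assumes "leavitt_ideal G J"
  shows "relation_ideal \<subseteq> J"
  using relation_ideal_minimal[OF leavitt_ideal_type_ideal[OF assms] leavitt_ideal.relations[OF assms]] .

text \<open>
  A word with a foreign letter has a factor in the ideal.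
\<close>

lemma leavitt_ideal_foreign:
  fixes J :: "('v, 'e, 'k) lpa_poly set"
  assumes "leavitt_ideal G J"
  shows "foreign (lpa_gens G) \<subseteq> J"
proof
  interpret leavitt_ideal G J by fact
  fix f :: "('v, 'e, 'k) lpa_poly" assume f: "f \<in> foreign (lpa_gens G)"
  have word: "word w \<in> J" if "\<not> set w \<subseteq> lpa_gens G" for w
    using that
  proof (induction w)
    case (Cons x w)
    then show ?case
      using outside[of x] by (cases "x \<in> lpa_gens G") (auto simp: word_Cons mult_left_mem mult_right_mem)
  qed simp
  show "f \<in> J"
    by (subst nc_poly_expand) (use f in \<open>auto simp: foreign_def intro!: sum_mem scal_mem word\<close>)
qed

lemma image_ideal_iff:
  fixes J :: "('v, 'e, 'k) lpa_poly set"
  assumes "leavitt_ideal G J" "f \<in> polys"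
  shows "lpa_class G f \<in> image_ideal J \<longleftrightarrow> f \<in> J"
proof
  interpret leavitt_ideal G J by fact
  assume "lpa_class G f \<in> image_ideal J"
  then obtain g where g: "g \<in> J" "lpa_class G f = lpa_class G g" by (auto simp: image_ideal_def)
  then have "f - g \<in> J"
    using leavitt_ideal_relation[OF assms(1)] by (auto simp: lpa_class_eq_iff)
  from add_mem[OF this g(1)] show "f \<in> J" by simp
qed (use assms in \<open>auto simp: image_ideal_def\<close>)

lemma preimage_ideal_image_ideal:
  fixes J :: "('v, 'e, 'k) lpa_poly set"
  assumes "leavitt_ideal G J"
  shows "preimage_ideal (image_ideal J) = J"
proof
  interpret leavitt_ideal G J by fact
  show "preimage_ideal (image_ideal J) \<subseteq> J"
    unfolding preimage_ideal_def extension_def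
    using image_ideal_iff[OF assms] leavitt_ideal_foreign[OF assms] by (auto intro!: add_mem)
  show "J \<subseteq> preimage_ideal (image_ideal J)"
  proof
    fix f assume f: "f \<in> J"
    obtain g z where fg: "f = g + z" "g \<in> free_lpa" "z \<in> foreign (lpa_gens G)"
      by (rule free_algebra_foreign_decomp)
    then have "g = f - z" by simp
    then have "g \<in> J" using diff_mem[OF f] fg(3) leavitt_ideal_foreign[OF assms] by blast
    then have "g \<in> polys" "lpa_class G g \<in> image_ideal J"
      using fg(2) const_free by (auto simp: image_ideal_def)
    then show "f \<in> preimage_ideal (image_ideal J)"
      unfolding preimage_ideal_def extension_def fg(1) using fg(3) by blast
  qed
qed

lemma image_ideal_preimage_ideal:
  assumes "two_sided_ideal (lpa k G) I"
  shows "image_ideal (preimage_ideal I) = I"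
  using two_sided_ideal_lpaD(1)[OF assms] preimage_ideal_iff[of _ I] unfolding image_ideal_def by blast

lemma image_ideal_two_sided:
  fixes J :: "('v, 'e, 'k) lpa_poly set"
  assumes J: "leavitt_ideal G J"
  shows "two_sided_ideal (lpa k G) (image_ideal J)"
proof -
  interpret leavitt_ideal G J by (rule J)
  have "subgroup (image_ideal J) (add_monoid (lpa k G))"
  proof
    show "image_ideal J \<subseteq> carrier (add_monoid (lpa k G))"
      by (auto simp: image_ideal_def lpa_carrier)
    show "x \<otimes>\<^bsub>add_monoid (lpa k G)\<^esub> y \<in> image_ideal J" if xy: "x \<in> image_ideal J" "y \<in> image_ideal J" for x y
    proof -
      obtain f g where fg: "x = lpa_class G f" "y = lpa_class G g" "f \<in> J" "g \<in> J" "f \<in> polys" "g \<in> polys"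
        using xy unfolding image_ideal_def by blast
      then show ?thesis
        using lpa_add[OF fg(5,6)] add_mem[OF fg(3,4)] polys_closed(1)[OF fg(5,6)]
        by (simp add: image_ideal_def)
    qed
    show "\<one>\<^bsub>add_monoid (lpa k G)\<^esub> \<in> image_ideal J"
      using zero_mem polys_closed(5) by (simp add: image_ideal_def lpa_zero)
    show "inv\<^bsub>add_monoid (lpa k G)\<^esub> x \<in> image_ideal J" if x: "x \<in> image_ideal J" for x
    proof -
      obtain f where f: "x = lpa_class G f" "f \<in> J" "f \<in> polys"
        using x unfolding image_ideal_def by blast
      then show ?thesis
        using lpa_inv[OF f(3)] minus_mem[OF f(2)] polys_closed(4)[OF f(3)]
        unfolding image_ideal_def by (simp only:) blast
    qed
  qed
  moreover have "a \<otimes>\<^bsub>lpa k G\<^esub> x \<in> image_ideal J \<and> x \<otimes>\<^bsub>lpa k G\<^esub> a \<in> image_ideal J"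
    if x: "x \<in> image_ideal J" and a: "a \<in> carrier (lpa k G)" for x a
  proof -
    obtain f where f: "x = lpa_class G f" "f \<in> J" "f \<in> polys"
      using x unfolding image_ideal_def by blast
    obtain g where g: "a = lpa_class G g" "g \<in> polys"
      using a unfolding lpa_carrier by blast
    show ?thesis
      using lpa_mult[OF f(3) g(2)] lpa_mult[OF g(2) f(3)] mult_left_mem[OF f(2), of g]
        mult_right_mem[OF f(2), of g] polys_closed(3)[OF f(3), of g] polys_closed(3)[OF g(2), of f] f g
      by (simp add: image_ideal_def)
  qed
  ultimately show ?thesis
    unfolding two_sided_ideal_def by (blast intro: additive_subgroup.intro)
qed

section \<open>Generated ideals, primeness and simplicity in the Leavitt path algebra\<close>

lemma leavitt_const_free: "leavitt_ideal G (const_free :: ('v, 'e, 'k) lpa_poly set)"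
proof -
  interpret C: type_ideal "const_free :: ('v, 'e, 'k) lpa_poly set"
    by (rule type_ideal_const_free)
  show ?thesis
    by unfold_locales (use relations_subset in auto)
qed

lemma leavitt_generated_ideal: "leavitt_ideal G (leavitt_generated G H S :: ('v, 'e, 'k) lpa_poly set)"
proof -
  have CF: "leavitt_generated G H S \<subseteq> (const_free :: ('v, 'e, 'k) lpa_poly set)"
    by (intro leavitt_generated_least leavitt_const_free) (auto simp: breaking_elem_const_free)
  show ?thesis
  proof
    show "leavitt_generated G H S \<subseteq> (const_free :: ('v, 'e, 'k) lpa_poly set)" by (rule CF)
  next
    show "lpa_relations G \<subseteq> (leavitt_generated G H S :: ('v, 'e, 'k) lpa_poly set)"
      unfolding leavitt_generated_def using leavitt_ideal.relations by blast
  next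
    show "gen x \<in> (leavitt_generated G H S :: ('v, 'e, 'k) lpa_poly set)" if "x \<notin> lpa_gens G" for x
      unfolding leavitt_generated_def using leavitt_ideal.outside that by blast
  next
    show "0 \<in> (leavitt_generated G H S :: ('v, 'e, 'k) lpa_poly set)"
      unfolding leavitt_generated_def
      by (auto dest!: leavitt_ideal_type_ideal type_ideal.zero_mem)
  next
    fix f g :: "('v, 'e, 'k) lpa_poly"
    assume f: "f \<in> leavitt_generated G H S" and g: "g \<in> leavitt_generated G H S"
    then show "f + g \<in> leavitt_generated G H S"
      unfolding leavitt_generated_def
      by (auto dest: leavitt_ideal_type_ideal intro: type_ideal.add_mem)
  next
    fix f a :: "('v, 'e, 'k) lpa_poly"
    assume f: "f \<in> leavitt_generated G H S"
    then show "a * f \<in> leavitt_generated G H S" "f * a \<in> leavitt_generated G H S"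
      unfolding leavitt_generated_def
      by (auto dest: leavitt_ideal_type_ideal intro: type_ideal.mult_left_mem type_ideal.mult_right_mem)
  qed
qed

lemma vx_polys: "v \<in> verts G \<Longrightarrow> vx v \<in> polys"
  by (simp add: gen_in_free_algebra lpa_gens_def)

lemma breaking_elem_polys:
  assumes "v \<in> verts G"
  shows "breaking_elem G H v \<in> polys"
proof -
  have "breaking_elem G H v \<in> free_lpa"
    unfolding breaking_elem_def using assms
    by (intro free_algebra_closed free_algebra_sum_closed gen_in_free_algebra) (auto simp: lpa_gens_def)
  then show ?thesis by (simp add: breaking_elem_const_free)
qed

lemma image_ideal_mono: "J \<subseteq> J' \<Longrightarrow> image_ideal J \<subseteq> image_ideal J'"
  unfolding image_ideal_def by blast

lemma image_ideal_subset_iff: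
  assumes "leavitt_ideal G J" "leavitt_ideal G J'"
  shows "image_ideal J \<subseteq> image_ideal J' \<longleftrightarrow> J \<subseteq> J'"
proof
  assume "image_ideal J \<subseteq> image_ideal J'"
  then have "preimage_ideal (image_ideal J) \<subseteq> preimage_ideal (image_ideal J')"
    unfolding preimage_ideal_def extension_def by blast
  then show "J \<subseteq> J'" by (simp add: preimage_ideal_image_ideal assms)
qed (rule image_ideal_mono)

lemma image_ideal_const_free: "image_ideal const_free = carrier (lpa k G)"
  unfolding lpa_carrier image_ideal_def by (simp add: Int_commute)

lemma lpa_ideal_eq_image_ideal:
  assumes "H \<subseteq> verts G" "S \<subseteq> verts G"
  shows "lpa_ideal k G H S = image_ideal (leavitt_generated G H S)"
proof
  let ?T = "(\<lambda>v. lpa_class G (vx v)) ` H \<union> (\<lambda>v. lpa_class G (breaking_elem G H v)) ` S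
    :: ('v, 'e, 'k) lpa_poly set set"
  have "?T \<subseteq> image_ideal (leavitt_generated G H S)"
    unfolding image_ideal_def
    using assms vx_polys breaking_elem_polys leavitt_generated_mem by (auto intro!: imageI)
  then show "lpa_ideal k G H S \<subseteq> image_ideal (leavitt_generated G H S)"
    unfolding lpa_ideal_def ideal_generated_by_def
    using image_ideal_two_sided[OF leavitt_generated_ideal] by blast
  show "image_ideal (leavitt_generated G H S) \<subseteq> lpa_ideal k G H S"
    unfolding lpa_ideal_def ideal_generated_by_def
  proof (intro Inter_greatest)
    fix I assume "I \<in> {I. two_sided_ideal (lpa k G) I \<and> ?T \<subseteq> I}"
    then have I: "two_sided_ideal (lpa k G) I" "?T \<subseteq> I" by auto
    have "leavitt_generated G H S \<subseteq> preimage_ideal I"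
    proof (rule leavitt_generated_least[OF preimage_ideal_leavitt[OF I(1)]])
      show "vx ` H \<subseteq> preimage_ideal I"
      proof (rule image_subsetI)
        fix v assume "v \<in> H"
        then show "vx v \<in> preimage_ideal I"
          using preimage_ideal_iff[OF vx_polys, of v] I(2) assms(1) by blast
      qed
      show "breaking_elem G H ` S \<subseteq> preimage_ideal I"
      proof (rule image_subsetI)
        fix v assume "v \<in> S"
        then show "breaking_elem G H v \<in> preimage_ideal I"
          using preimage_ideal_iff[OF breaking_elem_polys, of v] I(2) assms(2) by blast
      qed
    qed
    from image_ideal_mono[OF this] show "image_ideal (leavitt_generated G H S) \<subseteq> I"
      by (simp add: image_ideal_preimage_ideal[OF I(1)])
  qed
qed

text \<open>
  From left to right the polynomials are split into a part in the free algebra, which is visible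
  in the Leavitt path algebra, and a foreign part, which lies in every ideal.
\<close>

lemma ideal_prod_image_ideal:
  assumes J: "leavitt_ideal G J1" "leavitt_ideal G J2" "leavitt_ideal G Q"
  shows "ideal_prod (lpa k G) (image_ideal J1) (image_ideal J2) \<subseteq> image_ideal Q \<longleftrightarrow> (\<forall>f\<in>J1. \<forall>g\<in>J2. f * g \<in> Q)"
proof
  interpret J1: leavitt_ideal G J1 by (rule J)
  interpret J2: leavitt_ideal G J2 by (rule J)
  interpret Q: leavitt_ideal G Q by (rule J)
  assume prod: "ideal_prod (lpa k G) (image_ideal J1) (image_ideal J2) \<subseteq> image_ideal Q"
  show "\<forall>f\<in>J1. \<forall>g\<in>J2. f * g \<in> Q"
  proof (intro ballI)
    fix f g assume fg: "f \<in> J1" "g \<in> J2"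
    obtain f0 z where f: "f = f0 + z" "f0 \<in> free_lpa" "z \<in> foreign (lpa_gens G)"
      by (rule free_algebra_foreign_decomp)
    obtain g0 y where g: "g = g0 + y" "g0 \<in> free_lpa" "y \<in> foreign (lpa_gens G)"
      by (rule free_algebra_foreign_decomp)
    have "f0 = f - z" "g0 = g - y" using f g by simp_all
    then have "f0 \<in> J1" "g0 \<in> J2"
      using J1.diff_mem[OF fg(1)] J2.diff_mem[OF fg(2)] f(3) g(3)
        leavitt_ideal_foreign[OF J(1)] leavitt_ideal_foreign[OF J(2)] by blast+
    then have 0: "f0 \<in> J1" "g0 \<in> J2" "f0 \<in> polys" "g0 \<in> polys"
      using f(2) g(2) J1.const_free J2.const_free by auto
    then have "lpa_class G f0 \<otimes>\<^bsub>lpa k G\<^esub> lpa_class G g0 \<in> image_ideal Q"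
      using prod image_ideal_iff[OF J(1) 0(3)] image_ideal_iff[OF J(2) 0(4)] by (blast intro: ideal_prod.prod)
    then have "f0 * g0 \<in> Q"
      using lpa_mult[OF 0(3,4)] image_ideal_iff[OF J(3) polys_closed(3)[OF 0(3)]] 0(4) by simp
    moreover have "z \<in> Q" "y \<in> Q" using f(3) g(3) leavitt_ideal_foreign[OF J(3)] by blast+
    then have "f0 * y + z * g \<in> Q" by (intro Q.add_mem Q.mult_left_mem[of y] Q.mult_right_mem[of z])
    ultimately have "f0 * g0 + (f0 * y + z * g) \<in> Q" by (rule Q.add_mem)
    moreover have "f * g = f0 * g0 + (f0 * y + z * g)"
      by (simp add: f(1) g(1) algebra_simps)
    ultimately show "f * g \<in> Q" by simp
  qed
next
  interpret Q: leavitt_ideal G Q by (rule J)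
  assume prod: "\<forall>f\<in>J1. \<forall>g\<in>J2. f * g \<in> Q"
  have sub: "additive_subgroup (image_ideal Q) (lpa k G)"
    using image_ideal_two_sided[OF J(3)] by (simp add: two_sided_ideal_def)
  show "ideal_prod (lpa k G) (image_ideal J1) (image_ideal J2) \<subseteq> image_ideal Q"
  proof
    fix x assume "x \<in> ideal_prod (lpa k G) (image_ideal J1) (image_ideal J2)"
    then show "x \<in> image_ideal Q"
    proof induction
      case (prod i j)
      then obtain f g where fg: "i = lpa_class G f" "f \<in> J1" "f \<in> polys"
        "j = lpa_class G g" "g \<in> J2" "g \<in> polys"
        unfolding image_ideal_def by blast
      have "f * g \<in> polys" using polys_closed(3)[OF fg(3)] fg(6) by simp
      then show ?case
        using lpa_mult[OF fg(3,6)] \<open>\<forall>f\<in>J1. \<forall>g\<in>J2. f * g \<in> Q\<close> fg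
        by (simp add: image_ideal_iff[OF J(3)])
    next
      case (sum s1 s2)
      then show ?case using additive_subgroup.a_closed[OF sub] by blast
    qed
  qed
qed

lemma prime_ideal_image_ideal_iff:
  assumes Q: "leavitt_ideal G Q"
  shows "prime_ideal (lpa k G) (image_ideal Q) \<longleftrightarrow> leavitt_prime G Q"
proof -
  have eq: "image_ideal Q = carrier (lpa k G) \<longleftrightarrow> Q = const_free"
    using image_ideal_subset_iff[OF Q leavitt_const_free] image_ideal_subset_iff[OF leavitt_const_free Q]
    by (auto simp: image_ideal_const_free)
  \<comment> \<open>Every two-sided ideal is the image of its preimage.\<close>
  have all: "(\<forall>I. two_sided_ideal (lpa k G) I \<longrightarrow> P I) \<longleftrightarrow> (\<forall>J. leavitt_ideal G J \<longrightarrow> P (image_ideal J))" for P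
    using image_ideal_two_sided[of _] preimage_ideal_leavitt image_ideal_preimage_ideal by metis
  have "(\<forall>I1 I2. two_sided_ideal (lpa k G) I1 \<and> two_sided_ideal (lpa k G) I2 \<and>
          ideal_prod (lpa k G) I1 I2 \<subseteq> image_ideal Q \<longrightarrow> I1 \<subseteq> image_ideal Q \<or> I2 \<subseteq> image_ideal Q) \<longleftrightarrow>
        (\<forall>I1. two_sided_ideal (lpa k G) I1 \<longrightarrow> (\<forall>I2. two_sided_ideal (lpa k G) I2 \<longrightarrow>
          ideal_prod (lpa k G) I1 I2 \<subseteq> image_ideal Q \<longrightarrow> I1 \<subseteq> image_ideal Q \<or> I2 \<subseteq> image_ideal Q))"
    by blast
  also have "\<dots> \<longleftrightarrow> (\<forall>J1. leavitt_ideal G J1 \<longrightarrow> (\<forall>J2. leavitt_ideal G J2 \<longrightarrow>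
          ideal_prod (lpa k G) (image_ideal J1) (image_ideal J2) \<subseteq> image_ideal Q \<longrightarrow> image_ideal J1 \<subseteq> image_ideal Q \<or> image_ideal J2 \<subseteq> image_ideal Q))"
    unfolding all ..
  also have "\<dots> \<longleftrightarrow> (\<forall>J1. leavitt_ideal G J1 \<longrightarrow> (\<forall>J2. leavitt_ideal G J2 \<longrightarrow>
          (\<forall>f\<in>J1. \<forall>g\<in>J2. f * g \<in> Q) \<longrightarrow> J1 \<subseteq> Q \<or> J2 \<subseteq> Q))"
    by (simp add: ideal_prod_image_ideal[OF _ _ Q] image_ideal_subset_iff[OF _ Q] cong: imp_cong)
  also have "\<dots> \<longleftrightarrow> (\<forall>J1 J2. leavitt_ideal G J1 \<and> leavitt_ideal G J2 \<and> (\<forall>f\<in>J1. \<forall>g\<in>J2. f * g \<in> Q) \<longrightarrow>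
        J1 \<subseteq> Q \<or> J2 \<subseteq> Q)"
    by blast
  finally show ?thesis
    using image_ideal_two_sided[OF Q] Q eq unfolding prime_ideal_def leavitt_prime_def by auto
qed

lemma prime_ideals_eq: "{P. prime_ideal (lpa k G) P} = image_ideal ` {Q. leavitt_prime G Q}"
proof (intro equalityI subsetI)
  fix P assume "P \<in> {P. prime_ideal (lpa k G) P}"
  then have P: "prime_ideal (lpa k G) P" "two_sided_ideal (lpa k G) P"
    by (auto simp: prime_ideal_def)
  then have "leavitt_prime G (preimage_ideal P)"
    using prime_ideal_image_ideal_iff[OF preimage_ideal_leavitt[OF P(2)]] image_ideal_preimage_ideal[OF P(2)] by simp
  then show "P \<in> image_ideal ` {Q. leavitt_prime G Q}"
    using image_ideal_preimage_ideal[OF P(2)] by force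
next
  fix P assume "P \<in> image_ideal ` {Q. leavitt_prime G Q}"
  then show "P \<in> {P. prime_ideal (lpa k G) P}"
    using prime_ideal_image_ideal_iff by (auto simp: leavitt_prime_def)
qed

lemma simple_lpaI:
  assumes v: "v \<in> verts G" "vx v \<notin> (leavitt_generated G {} {} :: ('v, 'e, 'k) lpa_poly set)"
    and J: "\<And>J :: ('v, 'e, 'k) lpa_poly set. leavitt_ideal G J \<Longrightarrow> J = leavitt_generated G {} {} \<or> J = const_free"
  shows "simple_ring (lpa k G)"
  unfolding simple_ring_def
proof (intro conjI allI impI)
  let ?J = "leavitt_generated G {} {} :: ('v, 'e, 'k) lpa_poly set"
  interpret leavitt_ideal G ?J by (rule leavitt_generated_ideal)
  have vp: "vx v \<in> polys" by (rule vx_polys[OF v(1)])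
  have "lpa_class G (vx v) \<otimes>\<^bsub>lpa k G\<^esub> lpa_class G (vx v) \<noteq> \<zero>\<^bsub>lpa k G\<^esub>"
  proof
    assume "lpa_class G (vx v) \<otimes>\<^bsub>lpa k G\<^esub> lpa_class G (vx v) = \<zero>\<^bsub>lpa k G\<^esub>"
    then have "vx v * vx v \<in> ?J"
      using leavitt_ideal_relation[OF leavitt_generated_ideal]
      by (auto simp: lpa_mult[OF vp vp] lpa_zero lpa_class_eq_iff)
    then show False
      using vx_mult_vx[of v v] eqv_mem_iff v(2) by auto
  qed
  then show "\<exists>x\<in>carrier (lpa k G). \<exists>y\<in>carrier (lpa k G). x \<otimes>\<^bsub>lpa k G\<^esub> y \<noteq> \<zero>\<^bsub>lpa k G\<^esub>"
    using vp lpa_carrier by blast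
  have zero: "image_ideal ?J = {\<zero>\<^bsub>lpa k G\<^esub>}"
  proof -
    have "lpa_class G f = lpa_class G 0" if f: "f \<in> ?J" "f \<in> polys" for f
    proof -
      have "?J \<subseteq> extension G (lpa_relation_ideal G)"
        by (rule leavitt_generated_least[OF leavitt_extension_relation_ideal]) auto
      then have "f \<in> lpa_relation_ideal G"
        using f extension_iff[of "lpa_relation_ideal G" G f] relation_ideal_subset by blast
      then show ?thesis by (simp add: lpa_class_eq_iff)
    qed
    moreover have "lpa_class G 0 \<in> image_ideal ?J"
      using zero_mem polys_closed(5) by (simp add: image_ideal_def)
    ultimately show ?thesis by (auto simp: image_ideal_def lpa_zero)
  qed
  fix I assume I: "two_sided_ideal (lpa k G) I"
  have "image_ideal (preimage_ideal I) = {\<zero>\<^bsub>lpa k G\<^esub>} \<or> image_ideal (preimage_ideal I) = carrier (lpa k G)"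
    using J[OF preimage_ideal_leavitt[OF I]] zero image_ideal_const_free by auto
  then show "I = {\<zero>\<^bsub>lpa k G\<^esub>} \<or> I = carrier (lpa k G)"
    by (simp add: image_ideal_preimage_ideal[OF I])
qed

end

section \<open>A representation by a branching system\<close>

text \<open>
  The linear functional with value \<open>h w\<close> on the word \<open>w\<close>.
\<close>

definition word_sum :: "('x free_monoid \<Rightarrow> 'k) \<Rightarrow> ('x, 'k::field) nc_poly \<Rightarrow> 'k" where
  "word_sum h f = (\<Sum>w\<in>Poly_Mapping.keys f. Poly_Mapping.lookup f w * h w)"

lemma word_sum_superset:
  assumes "finite A" "Poly_Mapping.keys f \<subseteq> A"
  shows "word_sum h f = (\<Sum>w\<in>A. Poly_Mapping.lookup f w * h w)"
  unfolding word_sum_def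
  by (rule sum.mono_neutral_left) (use assms in \<open>auto simp: in_keys_iff\<close>)

lemma word_sum_add: "word_sum h (f + g) = word_sum h f + word_sum h g"
proof -
  let ?A = "Poly_Mapping.keys f \<union> Poly_Mapping.keys g"
  have "Poly_Mapping.keys (f + g) \<subseteq> ?A" by (rule Poly_Mapping.keys_add)
  then show ?thesis
    using word_sum_superset[of ?A f h] word_sum_superset[of ?A g h] word_sum_superset[of ?A "f + g" h]
    by (simp add: lookup_add distrib_right sum.distrib)
qed

lemma word_sum_scal_word: "word_sum h (scal c (word w)) = c * h (Word w)"
  by (cases "c = 0") (simp_all add: scal_word word_sum_def)

lemma word_sum_0 [simp]: "word_sum h 0 = 0"
  by (simp add: word_sum_def)

lemma word_sum_sum: "word_sum h (sum f A) = (\<Sum>i\<in>A. word_sum h (f i))"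
  by (induction A rule: infinite_finite_induct) (simp_all add: word_sum_add)

lemma word_sum_diff: "word_sum h (f - g) = word_sum h f - word_sum h g"
  using word_sum_add[of h "f - g" g] by simp

lemma word_mult_word: "word u * word w = word (u @ w)"
  by (simp add: word_def mult_single plus_free_monoid_def)

lemma word_sum_scal: "word_sum h (scal c f) = c * word_sum h f"
proof -
  have "scal c f = (\<Sum>w\<in>Poly_Mapping.keys f. scal (c * Poly_Mapping.lookup f w) (word (letters w)))"
    by (subst nc_poly_expand[of f])
       (simp add: scal_def sum_distrib_left mult_single flip: mult.assoc)
  then show ?thesis
    by (simp add: word_sum_sum word_sum_scal_word sum_distrib_left mult.assoc)
       (simp add: word_sum_def sum_distrib_left)
qed

lemma word_sum_word_mult: "word_sum h (word u * f) = word_sum (\<lambda>w. h (Word (u @ letters w))) f"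
proof -
  have "word u * f = (\<Sum>w\<in>Poly_Mapping.keys f. scal (Poly_Mapping.lookup f w) (word (u @ letters w)))"
    by (subst nc_poly_expand[of f]) (simp add: sum_distrib_left scal_mult_right word_mult_word)
  then show ?thesis
    by (simp add: word_sum_sum word_sum_scal_word) (simp add: word_sum_def)
qed

lemma word_sum_mult_word: "word_sum h (f * word u) = word_sum (\<lambda>w. h (Word (letters w @ u))) f"
proof -
  have "f * word u = (\<Sum>w\<in>Poly_Mapping.keys f. scal (Poly_Mapping.lookup f w) (word (letters w @ u)))"
    by (subst nc_poly_expand[of f]) (simp add: sum_distrib_right scal_mult_left word_mult_word)
  then show ?thesis
    by (simp add: word_sum_sum word_sum_scal_word) (simp add: word_sum_def)
qed

text \<open>
  A set with one copy of \<open>\<nat>\<close> for each vertex outside \<open>H\<close> and, for each edge \<open>e\<close> between such vertices,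
  an injection of the copy of \<open>r(e)\<close> into the copy of \<open>s(e)\<close>, such that the images for different
  edges are disjoint, is a space on whose functions the Leavitt path algebra acts.  The relation
  \<open>v = \<Sum> e e\<^sup>*\<close> holds in the action if the images cover the copy of \<open>v\<close>.  If \<open>v\<close> emits an edge of this kind,
  the images can be made to cover the copy of \<open>v\<close>, and also to omit a point of it, as there are at most
  countably many edges.  A point is omitted for the breaking vertices outside \<open>S\<close>, so that of the
  elements \<open>v\<^sup>H\<close> precisely those with \<open>v \<in> S\<close> act as zero.
\<close>

locale branching_system = wf_digraph G
  for G :: "('v, 'e) pre_digraph" +
  fixes H S :: "'v set"
  assumes countable_arcs: "countable (arcs G)"
    and hereditary: "\<And>e. e \<in> arcs G \<Longrightarrow> tail G e \<in> H \<Longrightarrow> head G e \<in> H"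
    and saturated: "\<And>v. regular_vertex G v \<Longrightarrow> v \<notin> H \<Longrightarrow> \<exists>e\<in>out_arcs G v. head G e \<notin> H"
    and S_subset: "S \<subseteq> breaking_vertices_of G H"
begin

definition live :: "'v \<Rightarrow> 'e set" where
  "live v = {e \<in> out_arcs G v. head G e \<notin> H}"

text \<open>
  The vertices at which the enumeration below leaves the point 0 uncovered.
\<close>

definition unbranched :: "'v set" where
  "unbranched = breaking_vertices_of G H - S"

text \<open>
  The copies of \<open>\<nat>\<close> belonging to the edges that start in one vertex are enumerated jointly.  Shifting the
  enumeration by one leaves 0 uncovered.
\<close>

definition branch :: "'e \<Rightarrow> nat \<Rightarrow> nat" where
  "branch e n = (if tail G e \<in> unbranched then Suc else id)
     (to_nat_on (live (tail G e) \<times> UNIV) (e, n))"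

lemma live_bij:
  assumes "live v \<noteq> {}"
  shows "bij_betw (to_nat_on (live v \<times> (UNIV :: nat set))) (live v \<times> UNIV) UNIV"
proof (rule to_nat_on_infinite)
  have "countable (live v)"
    by (rule countable_subset[OF _ countable_arcs]) (auto simp: live_def)
  then show "countable (live v \<times> (UNIV :: nat set))" by simp
  show "infinite (live v \<times> (UNIV :: nat set))"
    using assms by (simp add: finite_cartesian_product_iff)
qed

lemma branch_inj:
  assumes "e \<in> live v" "f \<in> live v" "branch e n = branch f m"
  shows "e = f \<and> n = m"
proof -
  have "tail G e = v" "tail G f = v" using assms(1,2) by (auto simp: live_def)
  then have "to_nat_on (live v \<times> UNIV) (e, n) = to_nat_on (live v \<times> UNIV) (f, m)"
    using assms(3) by (simp add: branch_def split: if_splits)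
  moreover have "inj_on (to_nat_on (live v \<times> (UNIV :: nat set))) (live v \<times> UNIV)"
    using live_bij[of v] assms(1) by (auto simp: bij_betw_def)
  ultimately have "(e, n) = (f, m)"
    using assms(1,2) by (auto dest: inj_onD)
  then show ?thesis by simp
qed

lemma branch_surj:
  assumes "live v \<noteq> {}" "v \<notin> unbranched"
  shows "\<exists>e\<in>live v. m \<in> range (branch e)"
proof -
  have "m \<in> to_nat_on (live v \<times> (UNIV :: nat set)) ` (live v \<times> UNIV)"
    using live_bij[OF assms(1)] by (simp add: bij_betw_def)
  then obtain e and n :: nat where "e \<in> live v" "m = to_nat_on (live v \<times> UNIV) (e, n)" by auto
  moreover from this have "tail G e = v" by (simp add: live_def)
  ultimately have "m = branch e n" using assms(2) by (simp add: branch_def)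
  with \<open>e \<in> live v\<close> show ?thesis by blast
qed

lemma branch_not_0: "tail G e \<in> unbranched \<Longrightarrow> 0 \<notin> range (branch e)"
  by (auto simp: branch_def)

text \<open>
  The generators act by partial maps on points, and a function is transported back along them.  An edge leads
  from the copy of its source to the copy of its range and is defined on its image only.
\<close>

fun move :: "('v, 'e) lpa_gen \<Rightarrow> 'v \<times> nat \<Rightarrow> ('v \<times> nat) option" where
  "move (Vertex v) (u, n) = (if u = v \<and> v \<in> verts G - H then Some (u, n) else None)"
| "move (Edge e) (u, n) = (if e \<in> live u \<and> n \<in> range (branch e)
     then Some (head G e, inv_into UNIV (branch e) n) else None)"
| "move (Ghost e) (u, n) = (if e \<in> live (tail G e) \<and> u = head G e
     then Some (tail G e, branch e n) else None)"

fun moves :: "('v, 'e) lpa_gen list \<Rightarrow> 'v \<times> nat \<Rightarrow> ('v \<times> nat) option" where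
  "moves [] p = Some p"
| "moves (x # xs) p = Option.bind (move x p) (moves xs)"

lemma moves_append: "moves (xs @ ys) p = Option.bind (moves xs p) (moves ys)"
  by (induction xs arbitrary: p) (auto split: bind_split)

definition value_at :: "('v \<times> nat \<Rightarrow> 'k) \<Rightarrow> ('v \<times> nat) option \<Rightarrow> 'k::field" where
  "value_at \<phi> p = (case p of None \<Rightarrow> 0 | Some q \<Rightarrow> \<phi> q)"

text \<open>
  A word acts by following its letters from the left; where they lead nowhere, the value is 0.
\<close>

definition action :: "('v, 'e, 'k::field) lpa_poly \<Rightarrow> ('v \<times> nat \<Rightarrow> 'k) \<Rightarrow> 'v \<times> nat \<Rightarrow> 'k" where
  "action f \<phi> p = word_sum (\<lambda>w. value_at \<phi> (moves (letters w) p)) f"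

lemma action_word_mult:
  "action (word u * f) \<phi> p = (case moves u p of None \<Rightarrow> 0 | Some q \<Rightarrow> action f \<phi> q)"
  unfolding action_def word_sum_word_mult
  by (cases "moves u p") (simp_all add: moves_append value_at_def word_sum_def)

lemma action_mult_word: "action (f * word u) \<phi> p = action f (\<lambda>q. value_at \<phi> (moves u q)) p"
proof -
  have "value_at \<phi> (Option.bind x (moves u)) = value_at (\<lambda>q. value_at \<phi> (moves u q)) x" for x
    by (cases x) (simp_all add: value_at_def)
  then show ?thesis
    unfolding action_def word_sum_mult_word by (simp add: moves_append)
qed

lemmas action_linear =
  word_sum_add[of "\<lambda>w. value_at \<phi> (moves (letters w) p)" for \<phi> p, folded action_def]
  word_sum_diff[of "\<lambda>w. value_at \<phi> (moves (letters w) p)" for \<phi> p, folded action_def]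
  word_sum_sum[of "\<lambda>w. value_at \<phi> (moves (letters w) p)" for \<phi> p, folded action_def]
  word_sum_scal[of "\<lambda>w. value_at \<phi> (moves (letters w) p)" for \<phi> p, folded action_def]
  word_sum_0[of "\<lambda>w. value_at \<phi> (moves (letters w) p)" for \<phi> p, folded action_def]

lemma action_word: "action (word u) \<phi> p = value_at \<phi> (moves u p)"
  using word_sum_scal_word[of "\<lambda>w. value_at \<phi> (moves (letters w) p)" 1 u]
  by (simp add: action_def)

lemma moves_single: "moves [x] = move x"
proof
  show "moves [x] p = move x p" for p by (cases "move x p") simp_all
qed

lemma action_gen: "action (gen x) \<phi> p = value_at \<phi> (move x p)"
  using action_word[of "[x]" \<phi> p] by (simp add: word_Cons word_Nil moves_single del: moves.simps)

lemma action_gen_gen: "action (gen x * gen y) \<phi> p = value_at \<phi> (Option.bind (move x p) (move y))"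
  using action_word[of "[x, y]" \<phi> p] moves.simps(2)[of x "[y]" p]
  by (simp add: word_Cons word_Nil moves_single del: moves.simps)

definition annihilator :: "('v, 'e, 'k::field) lpa_poly set" where
  "annihilator = {f \<in> const_free. \<forall>\<phi> p. action f \<phi> p = 0}"

text \<open>
  The action of a product is the composition of the actions, and it suffices to see this when one
  factor is a word.
\<close>

lemma type_ideal_annihilator: "type_ideal (annihilator :: ('v, 'e, 'k::field) lpa_poly set)"
proof -
  have "type_ideal {f :: ('v, 'e, 'k) lpa_poly. \<forall>\<phi> p. action f \<phi> p = 0}"
  proof
    fix f a :: "('v, 'e, 'k) lpa_poly"
    assume "f \<in> {f. \<forall>\<phi> p. action f \<phi> p = 0}"
    then have f: "action f \<phi> p = 0" for \<phi> p by blast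
    have "a * f = (\<Sum>w\<in>Poly_Mapping.keys a. scal (Poly_Mapping.lookup a w) (word (letters w) * f))"
      by (subst nc_poly_expand[of a]) (simp add: sum_distrib_right scal_mult_left)
    moreover have "action (word u * f) \<phi> p = 0" for u \<phi> p
      unfolding action_word_mult by (cases "moves u p") (simp_all add: f)
    ultimately show "a * f \<in> {f. \<forall>\<phi> p. action f \<phi> p = 0}"
      by (simp add: action_linear)
    have "f * a = (\<Sum>w\<in>Poly_Mapping.keys a. scal (Poly_Mapping.lookup a w) (f * word (letters w)))"
      by (subst nc_poly_expand[of a]) (simp add: sum_distrib_left scal_mult_right)
    then show "f * a \<in> {f. \<forall>\<phi> p. action f \<phi> p = 0}"
      by (simp add: action_linear action_mult_word f)
  qed (simp_all add: action_linear)
  from type_ideal_Int[OF type_ideal_const_free this] show ?thesis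
    by (simp add: annihilator_def Int_def)
qed

lemma live_tail: "e \<in> live u \<Longrightarrow> e \<in> arcs G \<and> tail G e = u \<and> head G e \<notin> H \<and> u \<in> verts G - H"
  using hereditary by (auto simp: live_def)

text \<open>
  At a point over \<open>v\<close> at most one edge is defined, and it acts together with its ghost as the identity.  So a gap
  is the projection to the points over \<open>v\<close> that are not covered by its edges.
\<close>

lemma action_gap:
  assumes "finite F" "F \<subseteq> out_arcs G v"
  shows "action (gap F v) \<phi> (u, n) =
    (if u = v \<and> v \<in> verts G - H \<and> (\<forall>e\<in>F \<inter> live v. n \<notin> range (branch e)) then \<phi> (u, n) else 0)"
proof -
  let ?P = "\<lambda>e. e \<in> live u \<and> n \<in> range (branch e)"
  have edge: "action (ed e * gh e) \<phi> (u, n) = (if ?P e then \<phi> (u, n) else 0)" for e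
    unfolding action_gen_gen using live_tail[of e u]
    by (auto simp: value_at_def f_inv_into_f)
  have gap: "action (gap F v) \<phi> (u, n) =
      (if u = v \<and> v \<in> verts G - H then \<phi> (u, n) else 0) - (\<Sum>e\<in>F. if ?P e then \<phi> (u, n) else 0)"
    unfolding gap_def action_linear action_gen edge by (simp add: value_at_def)
  show ?thesis
  proof (cases "\<exists>e\<in>F. ?P e")
    case True
    then obtain e where e: "e \<in> F" "?P e" by blast
    have unique: "f = e" if "f \<in> F" "?P f" for f
      using that e branch_inj[of f u e] by auto
    have "(\<Sum>e\<in>F. if ?P e then \<phi> (u, n) else 0) = (\<Sum>f\<in>F. if f = e then \<phi> (u, n) else 0)"
    proof (intro sum.cong refl)
      fix f assume "f \<in> F"
      then have "?P f \<longleftrightarrow> f = e" using unique[of f] e(2) by blast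
      then show "(if ?P f then \<phi> (u, n) else 0) = (if f = e then \<phi> (u, n) else 0)" by simp
    qed
    then have "(\<Sum>e\<in>F. if ?P e then \<phi> (u, n) else 0) = \<phi> (u, n)"
      using e(1) assms(1) by simp
    moreover have "u = v" "v \<in> verts G - H"
      using e(2) live_tail[of e u] subsetD[OF assms(2) e(1)] by auto
    ultimately show ?thesis
      unfolding gap using e by auto
  next
    case False
    then have "(\<Sum>e\<in>F. if ?P e then \<phi> (u, n) else 0) = 0" by (intro sum.neutral) auto
    then show ?thesis
      unfolding gap using False by auto
  qed
qed

text \<open>
  The relation at a regular vertex uses that the images of its edges cover everything: by saturation one of
  them ends outside \<open>H\<close>, and the vertices at which a point is left uncovered are infinite emitters.
\<close>

lemma leavitt_annihilator: "leavitt_ideal G (annihilator :: ('v, 'e, 'k::field) lpa_poly set)"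
proof -
  interpret A: type_ideal "annihilator :: ('v, 'e, 'k) lpa_poly set"
    by (rule type_ideal_annihilator)
  have regular: "action (vx v - (\<Sum>e\<in>out_arcs G v. ed e * gh e)) \<phi> p = 0"
    if v: "regular_vertex G v" for v and \<phi> :: "'v \<times> nat \<Rightarrow> 'k" and p
  proof -
    obtain u n where p: "p = (u, n)" by (cases p)
    have fin: "finite (out_arcs G v)" using v by (simp add: regular_vertex_def)
    have "v \<notin> unbranched" using fin by (simp add: unbranched_def breaking_vertices_of_def)
    moreover have "live v \<noteq> {}" if "v \<notin> H" using saturated[OF v that] by (auto simp: live_def)
    ultimately have "v \<notin> H \<Longrightarrow> \<exists>e\<in>live v. n \<in> range (branch e)" using branch_surj by blast
    moreover have "out_arcs G v \<inter> live v = live v" by (auto simp: live_def)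
    ultimately have "action (gap (out_arcs G v) v) \<phi> (u, n) = 0"
      by (auto simp: action_gap[OF fin subset_refl])
    then show ?thesis by (simp add: gap_def p)
  qed
  have act: "action r \<phi> p = 0" if r: "r \<in> lpa_relations G"
    for r and \<phi> :: "'v \<times> nat \<Rightarrow> 'k" and p
  proof -
    obtain u n where p: "p = (u, n)" by (cases p)
    have inv: "inv_into UNIV (branch e) (branch e m) = m" if "e \<in> live (tail G e)" for e m
      using branch_inj[OF that that] by (intro inv_f_f injI) blast
    have same: "e = f \<and> m = m'" if "e \<in> live w" "f \<in> live w" "branch e m = branch f m'" for e f w m m'
      using branch_inj[OF that] by simp
    have live: "e \<in> live (tail G e) \<longleftrightarrow> head G e \<notin> H" if "e \<in> arcs G" for e
      using that by (auto simp: live_def)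
    consider
        (vertices) v w where "r = vx v * vx w - (if v = w then vx v else 0)"
      | (edge) e where "r = vx (tail G e) * ed e - ed e \<or> r = ed e * vx (head G e) - ed e" "e \<in> arcs G"
      | (ghost) e where "r = vx (head G e) * gh e - gh e \<or> r = gh e * vx (tail G e) - gh e" "e \<in> arcs G"
      | (product) e f where "r = gh e * ed f - (if e = f then vx (head G e) else 0)"
          "e \<in> arcs G" "f \<in> arcs G"
      | (sum) v where "r = vx v - (\<Sum>e\<in>out_arcs G v. ed e * gh e)" "regular_vertex G v"
      using r unfolding lpa_relations_def by blast
    then show ?thesis
    proof cases
      case vertices
      then show ?thesis
        by (simp add: p action_linear action_gen_gen action_gen value_at_def)
    next
      case edge
      show ?thesis
      proof (cases "e \<in> live u \<and> n \<in> range (branch e)")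
        case True
        then have "tail G e = u" "u \<in> verts G" "u \<notin> H" "head G e \<notin> H" "head G e \<in> verts G"
          using live_tail[of e u] by simp_all
        with edge(1) True show ?thesis
          by (elim disjE) (simp_all add: p action_linear action_gen_gen action_gen value_at_def)
      next
        case False
        then have "move (Edge e) (u, n) = None" by simp
        with edge(1) show ?thesis
          by (elim disjE)
             (auto simp: p action_linear action_gen_gen action_gen value_at_def simp del: move.simps(2))
      qed
    next
      case ghost
      show ?thesis
      proof (cases "e \<in> live (tail G e) \<and> u = head G e")
        case True
        then have "tail G e \<in> verts G" "tail G e \<notin> H" "head G e \<notin> H" "head G e \<in> verts G"
          using live_tail[of e "tail G e"] by simp_all
        with ghost(1) True show ?thesis
          by (elim disjE) (simp_all add: p action_linear action_gen_gen action_gen value_at_def)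
      next
        case False
        then have "move (Ghost e) (u, n) = None" by simp
        with ghost(1) show ?thesis
          by (elim disjE)
             (auto simp: p action_linear action_gen_gen action_gen value_at_def simp del: move.simps(3))
      qed
    next
      case product
      show ?thesis
      proof (cases "e \<in> live (tail G e) \<and> u = head G e")
        case True
        have "action (gh e * ed f) \<phi> p = (if e = f then \<phi> p else 0)"
        proof (cases "e = f")
          case True
          with \<open>e \<in> live (tail G e) \<and> u = head G e\<close> show ?thesis
            by (simp add: p action_gen_gen value_at_def inv)
        next
          case False
          have "\<not> (f \<in> live (tail G e) \<and> branch e n \<in> range (branch f))"
            using same[of e "tail G e" f n] True False by blast
          with True False show ?thesis
            by (auto simp: p action_gen_gen value_at_def)
        qed
        moreover have "action (vx (head G e)) \<phi> p = \<phi> p"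
          using True live_tail[of e "tail G e"] by (simp add: p action_gen value_at_def)
        ultimately show ?thesis
          by (cases "e = f") (simp_all add: product(1) action_linear)
      next
        case False
        then have "action (gh e * ed f) \<phi> p = 0" "action (vx (head G e)) \<phi> p = 0"
          using live[OF product(2)] by (auto simp: p action_gen_gen action_gen value_at_def)
        then show ?thesis
          by (cases "e = f") (simp_all add: product(1) action_linear)
      qed
    next
      case sum
      then show ?thesis using regular by simp
    qed
  qed
  have cf: "lpa_relations G \<subseteq> (const_free :: ('v, 'e, 'k) lpa_poly set)"
    using relations_subset[OF wf_digraph] by blast
  show ?thesis
  proof
    show "lpa_relations G \<subseteq> (annihilator :: ('v, 'e, 'k) lpa_poly set)"
      using act cf by (auto simp: annihilator_def)
    show "annihilator \<subseteq> (const_free :: ('v, 'e, 'k) lpa_poly set)" by (auto simp: annihilator_def)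
    fix x assume x: "x \<notin> lpa_gens G"
    have "move x (u, n) = None" for u n
      using x live_tail by (cases x) (auto simp: lpa_gens_def)
    then show "gen x \<in> (annihilator :: ('v, 'e, 'k) lpa_poly set)"
      by (auto simp: annihilator_def action_gen value_at_def)
  qed
qed

lemma live_eq: "v \<in> verts G \<Longrightarrow> {e \<in> out_arcs G v. head G e \<in> verts G - H} = live v"
  by (auto simp: live_def)

lemma action_breaking_elem:
  fixes \<phi> :: "'v \<times> nat \<Rightarrow> 'k::field"
  assumes "v \<in> breaking_vertices_of G H"
  shows "action (breaking_elem G H v) \<phi> (u, n) =
    (if u = v \<and> (\<forall>e\<in>live v. n \<notin> range (branch e)) then \<phi> (u, n) else 0)"
proof -
  have v: "v \<in> verts G - H" "finite (live v)"
    using assms live_eq[of v] by (auto simp: breaking_vertices_of_def)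
  have eq: "breaking_elem G H v = (gap (live v) v :: ('v, 'e, 'k) lpa_poly)"
    by (simp add: breaking_elem_def gap_def live_def)
  have "live v \<subseteq> out_arcs G v" by (auto simp: live_def)
  from action_gap[OF v(2) this, of \<phi> u n] show ?thesis
    unfolding eq using v(1) by simp
qed

lemma generated_subset_annihilator:
  "leavitt_generated G H S \<subseteq> (annihilator :: ('v, 'e, 'k::field) lpa_poly set)"
proof (rule leavitt_generated_least[OF leavitt_annihilator])
  show "vx ` H \<subseteq> (annihilator :: ('v, 'e, 'k) lpa_poly set)"
    by (auto simp: annihilator_def action_gen value_at_def)
  show "breaking_elem G H ` S \<subseteq> (annihilator :: ('v, 'e, 'k) lpa_poly set)"
  proof (rule image_subsetI)
    fix v assume v: "v \<in> S"
    then have vB: "v \<in> breaking_vertices_of G H" using S_subset by blast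
    then have "live v \<noteq> {}"
      using live_eq[of v] by (auto simp: breaking_vertices_of_def)
    then have ex: "\<exists>e\<in>live v. n \<in> range (branch e)" for n
      using branch_surj[of v n] v by (simp add: unbranched_def)
    have "action (breaking_elem G H v) \<phi> p = 0" for \<phi> :: "'v \<times> nat \<Rightarrow> 'k" and p
    proof (cases p)
      case (Pair u n)
      then show ?thesis using action_breaking_elem[OF vB, of \<phi> u n] ex[of n] by auto
    qed
    then show "breaking_elem G H v \<in> (annihilator :: ('v, 'e, 'k) lpa_poly set)"
      by (simp add: annihilator_def breaking_elem_const_free)
  qed
qed

text \<open>
  A vertex outside \<open>H\<close> acts as the identity on the points over it.
\<close>

theorem vx_not_generated:
  assumes "v \<in> verts G - H"
  shows "vx v \<notin> (leavitt_generated G H S :: ('v, 'e, 'k::field) lpa_poly set)"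
proof
  assume "vx v \<in> (leavitt_generated G H S :: ('v, 'e, 'k::field) lpa_poly set)"
  then have "vx v \<in> (annihilator :: ('v, 'e, 'k) lpa_poly set)"
    using generated_subset_annihilator by blast
  then have "action (vx v) (\<lambda>_. 1 :: 'k) (v, 0) = 0" by (simp add: annihilator_def)
  then show False using assms by (simp add: action_gen value_at_def)
qed

text \<open>
  The element \<open>v\<^sup>H\<close> acts as the identity on the uncovered point over \<open>v\<close>.
\<close>

theorem breaking_elem_not_generated:
  assumes "v \<in> breaking_vertices_of G H - S"
  shows "breaking_elem G H v \<notin> (leavitt_generated G H S :: ('v, 'e, 'k::field) lpa_poly set)"
proof
  assume "breaking_elem G H v \<in> (leavitt_generated G H S :: ('v, 'e, 'k::field) lpa_poly set)"
  then have "breaking_elem G H v \<in> (annihilator :: ('v, 'e, 'k) lpa_poly set)"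
    using generated_subset_annihilator by blast
  then have "action (breaking_elem G H v) (\<lambda>_. 1 :: 'k) (v, 0) = 0" by (simp add: annihilator_def)
  moreover have "0 \<notin> range (branch e)" if "e \<in> live v" for e
    using branch_not_0[of e] that assms by (simp add: unbranched_def live_def)
  ultimately show False using assms action_breaking_elem[of v "\<lambda>_. 1 :: 'k" v 0] by simp
qed

end

section \<open>Reachability and maximal tails\<close>

context wf_digraph
begin

lemma path_ge_refl: "v \<in> verts G \<Longrightarrow> path_ge G v v"
  unfolding path_ge_def by (metis awalk_Nil_iff)

lemma path_ge_trans: "path_ge G u v \<Longrightarrow> path_ge G v w \<Longrightarrow> path_ge G u w"
  unfolding path_ge_def by (metis awalk_appendI)

lemma path_ge_arc: "e \<in> arcs G \<Longrightarrow> path_ge G (tail G e) (head G e)"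
  unfolding path_ge_def by (metis arc_implies_awalk)

lemma path_ge_verts: "path_ge G u v \<Longrightarrow> u \<in> verts G \<and> v \<in> verts G"
  unfolding path_ge_def using awalk_hd_in_verts awalk_last_in_verts by blast

lemma path_ge_first_arc:
  assumes "path_ge G u v" "u \<noteq> v"
  obtains e where "e \<in> out_arcs G u" "path_ge G (head G e) v"
proof -
  obtain p where p: "awalk u p v" using assms(1) by (auto simp: path_ge_def)
  then obtain e q where "p = e # q" using assms(2) by (cases p) (auto simp: awalk_Nil_iff)
  with p show ?thesis using that[of e] by (auto simp: path_ge_def awalk_Cons_iff)
qed

lemma path_ge_hereditary:
  assumes "path_ge G u v" "u \<in> H" "\<And>e. e \<in> arcs G \<Longrightarrow> tail G e \<in> H \<Longrightarrow> head G e \<in> H"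
  shows "v \<in> H"
proof -
  obtain p where "awalk u p v" using assms(1) by (auto simp: path_ge_def)
  then show ?thesis
    using assms(2)
  proof (induction p arbitrary: u)
    case (Cons e p)
    then show ?case using assms(3)[of e] by (auto simp: awalk_Cons_iff)
  qed (simp add: awalk_Nil_iff)
qed

lemma Omega_maximal_tail:
  assumes "maximal_tail G M"
  shows "Omega G M = verts G - M"
  using assms unfolding maximal_tail_def Omega_def by blast

lemma breaking_vertices_of_Omega:
  assumes "v \<in> verts G" "infinite (out_arcs G v)"
  shows "v \<in> breaking_vertices G \<longleftrightarrow> v \<in> breaking_vertices_of G (Omega G {v})"
proof -
  have "{e \<in> out_arcs G v. head G e \<notin> Omega G {v}} =
        {e \<in> out_arcs G v. head G e \<in> verts G - Omega G {v}}" by auto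
  moreover have "v \<notin> Omega G {v}" by (simp add: Omega_def)
  ultimately show ?thesis
    using assms unfolding breaking_vertices_def breaking_vertices_of_def by auto
qed

text \<open>
  Starting from \<open>v\<close>, follow an edge to a vertex outside \<open>H\<close> as long as the current vertex is
  regular, and stay where it is not.  The vertices from which this sequence can be reached form a
  maximal tail: two of them reach a common later vertex, and a regular vertex on the sequence is
  followed by another one.
\<close>

lemma exists_maximal_tail:
  assumes her: "\<And>e. e \<in> arcs G \<Longrightarrow> tail G e \<in> H \<Longrightarrow> head G e \<in> H"
    and sat: "\<And>u. regular_vertex G u \<Longrightarrow> u \<notin> H \<Longrightarrow> \<exists>e\<in>out_arcs G u. head G e \<notin> H"
    and v: "v \<in> verts G" "v \<notin> H"
  obtains M where "maximal_tail G M" "v \<in> M" "M \<inter> H = {}"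
proof -
  define next_vertex where
    "next_vertex u = (if regular_vertex G u then head G (SOME e. e \<in> out_arcs G u \<and> head G e \<notin> H) else u)" for u
  define x where "x n = (next_vertex ^^ n) v" for n
  have next_arc: "\<exists>e\<in>out_arcs G u. next_vertex u = head G e \<and> head G e \<notin> H"
    if "regular_vertex G u" "u \<notin> H" for u
  proof -
    have "\<exists>e. e \<in> out_arcs G u \<and> head G e \<notin> H" using sat[OF that] by blast
    from someI_ex[OF this] show ?thesis using that(1) by (auto simp: next_vertex_def)
  qed
  have next_live: "next_vertex u \<in> verts G - H \<and> path_ge G u (next_vertex u)" if u: "u \<in> verts G - H" for u
  proof (cases "regular_vertex G u")
    case True
    then obtain e where "e \<in> out_arcs G u" "next_vertex u = head G e" "head G e \<notin> H"
      using next_arc[of u] u by blast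
    then show ?thesis using path_ge_arc[of e] by auto
  next
    case False
    then show ?thesis using u path_ge_refl by (simp add: next_vertex_def)
  qed
  have x_Suc: "x (Suc n) = next_vertex (x n)" for n by (simp add: x_def)
  have x: "x n \<in> verts G - H" for n
    by (induction n) (use v next_live x_Suc in \<open>auto simp: x_def\<close>)
  have x_path: "path_ge G (x n) (x (n + m))" for n m
  proof (induction m)
    case 0
    then show ?case using x path_ge_refl by simp
  next
    case (Suc m)
    then show ?case using next_live[OF x[of "n + m"]] path_ge_trans x_Suc[of "n + m"] by simp
  qed
  define M where "M = {w \<in> verts G. \<exists>n. path_ge G w (x n)}"
  have "maximal_tail G M"
    unfolding maximal_tail_def
  proof (intro conjI ballI impI)
    show "M \<noteq> {}" using v(1) path_ge_refl[OF v(1)] unfolding M_def x_def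
      by (auto intro!: exI[of _ v] exI[of _ 0])
    show "M \<subseteq> verts G" by (auto simp: M_def)
    show "w \<in> M" if "w \<in> verts G" "u \<in> M" "path_ge G w u" for w u
      using that path_ge_trans unfolding M_def by blast
    show "\<exists>e\<in>out_arcs G w. head G e \<in> M" if w: "w \<in> M" "regular_vertex G w" for w
    proof -
      obtain n where n: "path_ge G w (x n)" using w(1) by (auto simp: M_def)
      show ?thesis
      proof (cases "w = x n")
        case True
        then obtain e where e: "e \<in> out_arcs G w" "x (Suc n) = head G e"
          using next_arc[OF w(2)] x[of n] x_Suc[of n] by auto
        then have "head G e \<in> M"
          unfolding M_def using path_ge_refl[of "head G e"] by (auto intro!: exI[of _ "Suc n"])
        then show ?thesis using e(1) by blast
      next
        case False
        then obtain e where "e \<in> out_arcs G w" "path_ge G (head G e) (x n)"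
          using path_ge_first_arc[OF n] by blast
        then show ?thesis unfolding M_def using path_ge_verts by blast
      qed
    qed
    show "\<exists>y\<in>M. path_ge G w y \<and> path_ge G u y" if wu: "w \<in> M" "u \<in> M" for w u
    proof -
      obtain n m where n: "path_ge G w (x n)" "path_ge G u (x m)" using wu by (auto simp: M_def)
      have "path_ge G w (x (n + m))" "path_ge G u (x (n + m))"
        using path_ge_trans[OF n(1) x_path[of n m]] path_ge_trans[OF n(2) x_path[of m n]]
        by (simp_all add: add.commute)
      moreover have "x (n + m) \<in> M"
        unfolding M_def using x[of "n + m"] path_ge_refl[of "x (n + m)"] by blast
      ultimately show ?thesis by blast
    qed
  qed
  moreover have "v \<in> M" unfolding M_def x_def
    using v(1) path_ge_refl[OF v(1)] by (auto intro!: exI[of _ 0])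
  moreover have "w \<notin> H" if "w \<in> M" for w
    using that path_ge_hereditary[of w _ H] her x unfolding M_def by blast
  ultimately show ?thesis using that by blast
qed

end

section \<open>Vertices and breaking vertices in an ideal\<close>

context leavitt_ideal
begin

definition vertices_in :: "'v set" where
  "vertices_in = {v \<in> verts G. vx v \<in> J}"

lemma ed_mem: "vx (head G e) \<in> J \<Longrightarrow> ed e \<in> J"
  using eqv_mem_iff[OF right_vertex_mult[of "Edge e"]] mult_left_mem by simp

lemma gh_mem: "vx (head G e) \<in> J \<Longrightarrow> gh e \<in> J"
  using eqv_mem_iff[OF left_vertex_mult[of "Ghost e"]] mult_right_mem by simp

lemma vertices_hereditary:
  assumes "e \<in> arcs G" "tail G e \<in> vertices_in"
  shows "head G e \<in> vertices_in"
proof -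
  have "vx (tail G e) * ed e \<in> J"
    using assms(2) by (auto simp: vertices_in_def intro: mult_right_mem)
  then have "ed e \<in> J"
    using eqv_mem_iff[OF left_vertex_mult[of "Edge e"]] by simp
  then have "gh e * ed e \<in> J" by (rule mult_left_mem)
  then show ?thesis
    using eqv_mem_iff[OF gh_mult_ed_same[OF assms(1)]] assms(1) by (simp add: vertices_in_def)
qed

lemma vertices_saturated:
  assumes "regular_vertex G v" "v \<notin> vertices_in"
  shows "\<exists>e\<in>out_arcs G v. head G e \<notin> vertices_in"
proof (rule ccontr)
  assume "\<not> (\<exists>e\<in>out_arcs G v. head G e \<notin> vertices_in)"
  then have "(\<Sum>e\<in>out_arcs G v. ed e * gh e) \<in> J"
    by (intro sum_mem mult_right_mem[OF ed_mem]) (auto simp: vertices_in_def)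
  then have "vx v \<in> J" using eqv_mem_iff[OF regular_sum[OF assms(1)]] by simp
  then show False using assms by (simp add: vertices_in_def regular_vertex_def)
qed

lemma path_ge_mem:
  assumes "path_ge G v w" "vx v \<in> J"
  shows "vx w \<in> J"
  using path_ge_hereditary[OF assms(1), of vertices_in] vertices_hereditary assms path_ge_verts
  by (auto simp: vertices_in_def)

text \<open>
  Every polynomial without constant term has a sum of vertices as a right unit modulo the ideal.
\<close>

lemma all_vertices:
  assumes "verts G \<subseteq> vertices_in"
  shows "J = const_free"
proof
  show "const_free \<subseteq> J"
  proof
    fix f :: "('v, 'e, 'k) lpa_poly" assume f: "f \<in> const_free"
    show "f \<in> J"
    proof (rule ccontr)
      assume "f \<notin> J"
      then obtain v where v: "v \<in> verts G" "f * vx v \<notin> J"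
        by (rule const_free_mult_vx[OF f])
      then show False using assms mult_left_mem[of "vx v" f] by (auto simp: vertices_in_def)
    qed
  qed
qed (rule const_free)

lemma leavitt_superset:
  assumes "type_ideal L" "J \<subseteq> L" "L \<subseteq> const_free"
  shows "leavitt_ideal G L"
proof -
  interpret L: type_ideal L by fact
  show ?thesis
    by unfold_locales (use assms(2,3) relations outside in blast)+
qed

definition breaking_in :: "'v set" where
  "breaking_in = {v \<in> breaking_vertices_of G vertices_in. breaking_elem G vertices_in v \<in> J}"

text \<open>
  Otherwise the reduction theorem would produce a vertex or a breaking element of \<open>J\<close> that is not
  among those used to define the generated ideal.
\<close>

theorem ideal_is_generated:
  assumes K: "condition_K G"
  shows "J = leavitt_generated G vertices_in breaking_in"
proof
  let ?I = "leavitt_generated G vertices_in breaking_in :: ('v, 'e, 'k) lpa_poly set"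
  show sub: "?I \<subseteq> J"
    by (rule leavitt_generated_least[OF leavitt_ideal_axioms])
       (auto simp: vertices_in_def breaking_in_def)
  interpret I: leavitt_ideal G ?I by (rule leavitt_generated_ideal[OF wf_digraph])
  show "J \<subseteq> ?I"
  proof (rule ccontr)
    assume "\<not> J \<subseteq> ?I"
    then have "(\<exists>w\<in>verts G - vertices_in. vx w \<in> J) \<or>
      (\<exists>w\<in>breaking_vertices_of G vertices_in - breaking_in. breaking_elem G vertices_in w \<in> J)"
      by (rule I.reduction[OF K leavitt_ideal_axioms sub _ leavitt_generated_mem])
    then show False by (auto simp: vertices_in_def breaking_in_def)
  qed
qed

lemma breaking_elem_gap: "breaking_elem G H v = gap {e \<in> out_arcs G v. head G e \<notin> H} v"
  by (simp add: breaking_elem_def gap_def)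

lemma breaking_elem_vx: "breaking_elem G H v * vx v \<approx> breaking_elem G H v"
  unfolding breaking_elem_gap by (rule gap_mult_vx) auto

lemma vx_breaking_elem: "vx v * breaking_elem G H v \<approx> breaking_elem G H v"
  unfolding breaking_elem_gap by (rule vx_mult_gap) auto

lemma breaking_finite:
  assumes "v \<in> breaking_vertices_of G H"
  shows "finite {e \<in> out_arcs G v. head G e \<notin> H}"
proof -
  have "{e \<in> out_arcs G v. head G e \<notin> H} = {e \<in> out_arcs G v. head G e \<in> verts G - H}"
    by auto
  then show ?thesis using assms by (simp add: breaking_vertices_of_def)
qed

lemma breaking_elem_idem:
  assumes "v \<in> breaking_vertices_of G H"
  shows "breaking_elem G H v * breaking_elem G H v \<approx> breaking_elem G H v"
  unfolding breaking_elem_gap by (rule gap_idem[OF breaking_finite[OF assms]]) auto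

lemma breaking_elem_mult_vx:
  assumes "w \<noteq> v"
  shows "breaking_elem G H v * vx w \<in> J"
proof -
  have "breaking_elem G H v * vx w \<approx> breaking_elem G H v * vx v * vx w"
    by (intro eqv_mult_right eqv_sym[OF breaking_elem_vx])
  also have "\<dots> = breaking_elem G H v * (vx v * vx w)" by (simp add: mult.assoc)
  also have "\<dots> \<approx> breaking_elem G H v * 0"
    using vx_mult_vx[of v w] assms by (intro eqv_mult_left) simp
  finally show ?thesis by (simp add: eqv_zero_iff)
qed

lemma vx_mult_breaking_elem:
  assumes "w \<noteq> v"
  shows "vx w * breaking_elem G H v \<in> J"
proof -
  have "vx w * breaking_elem G H v \<approx> vx w * (vx v * breaking_elem G H v)"
    by (intro eqv_mult_left eqv_sym[OF vx_breaking_elem])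
  also have "\<dots> = vx w * vx v * breaking_elem G H v" by (simp add: mult.assoc)
  also have "\<dots> \<approx> 0 * breaking_elem G H v"
    using vx_mult_vx[of w v] assms by (intro eqv_mult_right) simp
  finally show ?thesis by (simp add: eqv_zero_iff)
qed

text \<open>
  Edges that end in \<open>H\<close> are in the ideal, the other edges starting in \<open>v\<close> occur in the
  gap, and the edges starting elsewhere are killed by \<open>v\<close>.
\<close>

lemma breaking_elem_mult_ed:
  assumes H: "vx ` H \<subseteq> J" and v: "v \<in> breaking_vertices_of G H"
  shows "breaking_elem G H v * ed e \<in> J"
proof (cases "tail G e = v \<and> e \<in> arcs G")
  case True
  then have e: "e \<in> out_arcs G v" by simp
  show ?thesis
  proof (cases "head G e \<in> H")
    case True
    then have "vx (head G e) \<in> J" using H by blast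
    then show ?thesis by (rule mult_left_mem[OF ed_mem])
  next
    case False
    have "{e \<in> out_arcs G v. head G e \<notin> H} \<subseteq> out_arcs G v" by blast
    from gap_mult_ed[OF breaking_finite[OF v] this e] show ?thesis
      using False e by (simp add: breaking_elem_gap eqv_zero_iff)
  qed
next
  case False
  show ?thesis
  proof (cases "e \<in> arcs G")
    case True
    have "breaking_elem G H v * vx (tail G e) * ed e \<in> J"
      using True False by (intro mult_right_mem[OF breaking_elem_mult_vx]) simp
    then have "breaking_elem G H v * (vx (tail G e) * ed e) \<in> J" by (simp add: mult.assoc)
    moreover have "breaking_elem G H v * (vx (tail G e) * ed e) \<approx> breaking_elem G H v * ed e"
      using left_vertex_mult[of "Edge e"] by (intro eqv_mult_left) simp
    ultimately show ?thesis using eqv_mem_iff by blast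
  next
    case False
    then show ?thesis by (intro mult_left_mem[OF outside]) (simp add: gen_in_gens_iff)
  qed
qed

lemma gh_mult_breaking_elem:
  assumes H: "vx ` H \<subseteq> J" and v: "v \<in> breaking_vertices_of G H"
  shows "gh e * breaking_elem G H v \<in> J"
proof (cases "tail G e = v \<and> e \<in> arcs G")
  case True
  then have e: "e \<in> out_arcs G v" by simp
  show ?thesis
  proof (cases "head G e \<in> H")
    case True
    then have "vx (head G e) \<in> J" using H by blast
    then show ?thesis by (rule mult_right_mem[OF gh_mem])
  next
    case False
    have "{e \<in> out_arcs G v. head G e \<notin> H} \<subseteq> out_arcs G v" by blast
    from gh_mult_gap[OF breaking_finite[OF v] this e] show ?thesis
      using False e by (simp add: breaking_elem_gap eqv_zero_iff)
  qed
next
  case False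
  show ?thesis
  proof (cases "e \<in> arcs G")
    case True
    have "gh e * (vx (tail G e) * breaking_elem G H v) \<in> J"
      using True False by (intro mult_left_mem[OF vx_mult_breaking_elem]) simp
    then have "gh e * vx (tail G e) * breaking_elem G H v \<in> J" by (simp add: mult.assoc)
    moreover have "gh e * vx (tail G e) * breaking_elem G H v \<approx> gh e * breaking_elem G H v"
      using right_vertex_mult[of "Ghost e"] by (intro eqv_mult_right) simp
    ultimately show ?thesis using eqv_mem_iff by blast
  next
    case False
    then show ?thesis by (intro mult_right_mem[OF outside]) (simp add: gen_in_gens_iff)
  qed
qed

section \<open>Prime ideals come from maximal tails and breaking vertices\<close>

text \<open>
  If \<open>x f y\<close> is in \<open>J\<close> for all \<open>f\<close>, then \<open>y\<close> lies in the ideal \<open>J2\<close> of all elements that are sent to \<open>J\<close> by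
  \<open>x f\<close> for every \<open>f\<close>, and \<open>x\<close> in the ideal \<open>J1\<close> of those that play the role of \<open>x\<close> for all elements of \<open>J2\<close>; and
  \<open>J1 J2\<close> is contained in \<open>J\<close>.
\<close>

lemma prime_elementwise:
  assumes "leavitt_prime G J" and x: "x \<in> const_free" "x \<notin> J" and y: "y \<in> const_free" "y \<notin> J"
  shows "\<exists>f. x * f * y \<notin> J"
proof (rule ccontr)
  assume "\<nexists>f. x * f * y \<notin> J"
  then have xy: "x * f * y \<in> J" for f by blast
  interpret C: type_ideal "const_free :: ('v, 'e, 'k) lpa_poly set" by (rule type_ideal_const_free)
  define J2 where "J2 = {b \<in> const_free. \<forall>f. x * f * b \<in> J}"
  define J1 where "J1 = {a \<in> const_free. \<forall>b\<in>J2. \<forall>f. a * f * b \<in> J}"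
  have "type_ideal J2"
  proof
    show "0 \<in> J2" using C.zero_mem zero_mem by (simp add: J2_def)
    show "a + b \<in> J2" if "a \<in> J2" "b \<in> J2" for a b
      using that C.add_mem add_mem by (simp add: J2_def distrib_left)
    show "c * b \<in> J2" "b * c \<in> J2" if b: "b \<in> J2" for b c
    proof -
      have "x * f * (c * b) \<in> J" for f
        using b by (simp add: J2_def flip: mult.assoc) (simp add: mult.assoc[of x f c])
      moreover have "x * f * (b * c) \<in> J" for f
        using b mult_right_mem[of "x * f * b" c] by (simp add: J2_def mult.assoc)
      ultimately show "c * b \<in> J2" "b * c \<in> J2"
        using b C.mult_left_mem C.mult_right_mem by (auto simp: J2_def)
    qed
  qed
  then have J2: "leavitt_ideal G J2"
    using const_free by (intro leavitt_superset) (auto simp: J2_def intro: mult_left_mem)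
  have "type_ideal J1"
  proof
    show "0 \<in> J1" using C.zero_mem zero_mem by (simp add: J1_def)
    show "a + b \<in> J1" if "a \<in> J1" "b \<in> J1" for a b
      using that C.add_mem add_mem by (simp add: J1_def distrib_right)
    show "c * a \<in> J1" "a * c \<in> J1" if a: "a \<in> J1" for a c
    proof -
      have "c * a * f * b \<in> J" if "b \<in> J2" for f b
        using a that mult_left_mem[of "a * f * b" c] by (simp add: J1_def mult.assoc)
      moreover have "a * c * f * b \<in> J" if "b \<in> J2" for f b
        using a that by (simp add: J1_def mult.assoc[of a c f])
      ultimately show "c * a \<in> J1" "a * c \<in> J1"
        using a C.mult_left_mem C.mult_right_mem by (auto simp: J1_def)
    qed
  qed
  then have J1: "leavitt_ideal G J1"
    using const_free by (intro leavitt_superset) (auto simp: J1_def intro: mult_right_mem)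
  have "a * b \<in> J" if "a \<in> J1" "b \<in> J2" for a b
  proof -
    have "a * 1 * b \<in> J" using that unfolding J1_def by blast
    then show ?thesis by simp
  qed
  then have "J1 \<subseteq> J \<or> J2 \<subseteq> J"
    using assms(1) J1 J2 unfolding leavitt_prime_def by blast
  moreover have "y \<in> J2" using y(1) xy by (simp add: J2_def)
  moreover have "x \<in> J1" using x(1) by (simp add: J1_def J2_def)
  ultimately show False using x(2) y(2) by blast
qed

text \<open>
  The hypothesis \<open>x v = x\<close> allows to replace \<open>f\<close> by \<open>v f\<close>, which has no constant term and is
  therefore in the span of the monomials.
\<close>

lemma prime_monomial:
  assumes "leavitt_prime G J" and x: "x \<in> const_free" "x \<notin> J" "x * vx v \<approx> x"
    and y: "y \<in> const_free" "y \<notin> J"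
  obtains u p z u' q where "awalk u p z" "awalk u' q z" "x * (path p z * ghost q z) * y \<notin> J"
proof -
  obtain f where f: "x * f * y \<notin> J" using prime_elementwise[OF assms(1) x(1,2) y] by blast
  have "x * f * y \<approx> x * vx v * f * y"
    by (intro eqv_mult_right eqv_sym[OF x(3)])
  then have xy: "x * (vx v * f) * y \<notin> J" using f eqv_mem_iff by (simp add: mult.assoc)
  have "vx v * f \<in> const_free"
    by (rule type_ideal.mult_right_mem[OF type_ideal_const_free gen_const_free])
  then obtain m where m: "m \<in> monomials" "x * m * y \<notin> J"
    by (rule span_mod_sandwich[OF const_free_in_span xy])
  then show ?thesis using that unfolding monomials_def by blast
qed

text \<open>
  For (MT3), a monomial \<open>\<alpha>\<beta>\<^sup>*\<close> with \<open>v \<alpha>\<beta>\<^sup>* w\<close> outside the prime ideal starts in \<open>v\<close>, its ghost part starts in \<open>w\<close>,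
  and the common end of \<open>\<alpha>\<close> and \<open>\<beta>\<close> is not in the ideal.
\<close>

lemma prime_maximal_tail:
  assumes "leavitt_prime G J"
  shows "maximal_tail G (verts G - vertices_in)"
  unfolding maximal_tail_def
proof (intro conjI ballI impI)
  show "verts G - vertices_in \<noteq> {}"
    using all_vertices assms unfolding leavitt_prime_def by blast
  show "verts G - vertices_in \<subseteq> verts G" by blast
  show "v \<in> verts G - vertices_in"
    if "v \<in> verts G" "w \<in> verts G - vertices_in" "path_ge G v w" for v w
    using that path_ge_mem by (auto simp: vertices_in_def)
  show "\<exists>e\<in>out_arcs G v. head G e \<in> verts G - vertices_in"
    if "v \<in> verts G - vertices_in" "regular_vertex G v" for v
    using vertices_saturated[OF that(2)] that(1) by auto
  show "\<exists>y\<in>verts G - vertices_in. path_ge G v y \<and> path_ge G w y"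
    if vw: "v \<in> verts G - vertices_in" "w \<in> verts G - vertices_in" for v w
  proof -
    have v: "vx v \<notin> J" "vx v * vx v \<approx> vx v" "vx w \<notin> J"
      using vw vx_mult_vx[of v v] by (auto simp: vertices_in_def)
    obtain u p z u' q where m: "awalk u p z" "awalk u' q z" "vx v * (path p z * ghost q z) * vx w \<notin> J"
      by (rule prime_monomial[OF assms gen_const_free v(1,2) gen_const_free v(3)])
    have eq: "vx v * (path p z * ghost q z) * vx w = (vx v * path p z) * (ghost q z * vx w)"
      by (simp add: mult.assoc)
    have "vx v * path p z \<notin> J" "ghost q z * vx w \<notin> J"
      using m(3) mult_left_mem mult_right_mem unfolding eq by blast+
    then have "v = u" "w = u'"
      using vx_mult_path[OF m(1), of v] ghost_mult_vx[OF m(2), of w]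
      by (auto simp: eqv_zero_iff split: if_splits)
    moreover have "vx z \<notin> J"
    proof
      assume "vx z \<in> J"
      then have "path p z \<in> J"
        using mult_left_mem[of "vx z" "path p z"] eqv_mem_iff[OF path_mult_vx_self[of p z]] by simp
      then show False using \<open>vx v * path p z \<notin> J\<close> mult_left_mem by blast
    qed
    ultimately show ?thesis
      using m(1,2) awalk_last_in_verts[OF m(1)] unfolding path_ge_def vertices_in_def by blast
  qed
qed

text \<open>
  As \<open>v\<^sup>H e\<close> is in the ideal for all edges \<open>e\<close>, the path part of the monomial is trivial.
\<close>

lemma prime_breaking_monomial:
  assumes "leavitt_prime G J"
    and v: "v \<in> breaking_vertices_of G vertices_in" "v \<notin> breaking_in"
    and y: "y \<in> const_free" "y \<notin> J"
  obtains u q where "awalk u q v" "ghost q v * y \<notin> J"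
proof -
  let ?b = "breaking_elem G vertices_in v :: ('v, 'e, 'k) lpa_poly"
  have H: "vx ` vertices_in \<subseteq> J" by (auto simp: vertices_in_def)
  have b: "?b \<notin> J" using v by (simp add: breaking_in_def)
  obtain u p z u' q where m: "awalk u p z" "awalk u' q z" "?b * (path p z * ghost q z) * y \<notin> J"
    by (rule prime_monomial[OF assms(1) breaking_elem_const_free b breaking_elem_vx y])
  have eq: "?b * (path p z * ghost q z) * y = (?b * path p z) * (ghost q z * y)"
    by (simp add: mult.assoc)
  have bp: "?b * path p z \<notin> J" and qy: "ghost q z * y \<notin> J"
    using m(3) mult_left_mem mult_right_mem unfolding eq by blast+
  have "p = []"
  proof (cases p)
    case (Cons e p')
    have "?b * ed e * path p' z \<in> J"
      by (rule mult_right_mem[OF breaking_elem_mult_ed[OF H v(1)]])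
    with bp show ?thesis by (simp add: Cons mult.assoc)
  qed simp
  with bp have "z = v" using breaking_elem_mult_vx[of z v vertices_in] by auto
  with m(2) qy that show ?thesis by blast
qed

lemma prime_breaking_reaches:
  assumes "leavitt_prime G J"
    and v: "v \<in> breaking_vertices_of G vertices_in" "v \<notin> breaking_in"
    and w: "w \<in> verts G - vertices_in"
  shows "path_ge G w v"
proof -
  have "vx w \<notin> J" using w by (simp add: vertices_in_def)
  then obtain u q where q: "awalk u q v" "ghost q v * vx w \<notin> J"
    by (rule prime_breaking_monomial[OF assms(1-3) gen_const_free])
  then have "w = u"
    using ghost_mult_vx[OF q(1), of w] by (auto simp: eqv_zero_iff split: if_splits)
  then show ?thesis using q(1) unfolding path_ge_def by blast
qed

text \<open>
  For another such vertex \<open>w\<close> also the ghost part would have to be trivial, and \<open>v\<^sup>H w\<^sup>H\<close> vanishes.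
\<close>

lemma prime_breaking_unique:
  assumes "leavitt_prime G J"
    and v: "v \<in> breaking_vertices_of G vertices_in" "v \<notin> breaking_in"
    and w: "w \<in> breaking_vertices_of G vertices_in" "w \<notin> breaking_in"
  shows "w = v"
proof (rule ccontr)
  assume wv: "w \<noteq> v"
  let ?b = "breaking_elem G vertices_in w :: ('v, 'e, 'k) lpa_poly"
  have H: "vx ` vertices_in \<subseteq> J" by (auto simp: vertices_in_def)
  have b: "?b \<notin> J" using w by (simp add: breaking_in_def)
  obtain u q where q: "awalk u q v" "ghost q v * ?b \<notin> J"
    by (rule prime_breaking_monomial[OF assms(1-3) breaking_elem_const_free b])
  show False
  proof (cases q)
    case Nil
    then show ?thesis using q(2) vx_mult_breaking_elem[of v w vertices_in] wv by simp
  next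
    case (Cons e q')
    have "ghost q' v * (gh e * ?b) \<in> J"
      by (rule mult_left_mem[OF gh_mult_breaking_elem[OF H w(1)]])
    then show ?thesis using q(2) by (simp add: Cons mult.assoc)
  qed
qed

text \<open>
  If no \<open>v\<^sup>H\<close> is missing, the ideal is the one of the maximal tail of all vertices outside it.  A missing
  \<open>v\<^sup>H\<close> is unique, and since every vertex outside the ideal reaches \<open>v\<close>, the vertices in the ideal are
  \<open>\<Omega>(v)\<close>.
\<close>

theorem prime_is_generated:
  assumes K: "condition_K G" and prime: "leavitt_prime G J"
  shows "(\<exists>M. maximal_tail G M \<and> J = leavitt_generated G (Omega G M) (breaking_vertices_of G (Omega G M))) \<or>
    (\<exists>v\<in>breaking_vertices G. J = leavitt_generated G (Omega G {v}) (breaking_vertices_of G (Omega G {v}) - {v}))"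
proof (cases "breaking_in = breaking_vertices_of G vertices_in")
  case True
  let ?M = "verts G - vertices_in"
  have M: "maximal_tail G ?M" by (rule prime_maximal_tail[OF prime])
  have "Omega G ?M = vertices_in"
    unfolding Omega_maximal_tail[OF M] by (auto simp: vertices_in_def)
  then show ?thesis
    using M ideal_is_generated[OF K] True by metis
next
  case False
  then obtain v where v: "v \<in> breaking_vertices_of G vertices_in" "v \<notin> breaking_in"
    by (auto simp: breaking_in_def)
  have "breaking_in = breaking_vertices_of G vertices_in - {v}"
    using prime_breaking_unique[OF prime v] v(2) by (auto simp: breaking_in_def)
  moreover have Omega: "Omega G {v} = vertices_in"
  proof
    show "Omega G {v} \<subseteq> vertices_in"
      using prime_breaking_reaches[OF prime v] by (auto simp: Omega_def)
    show "vertices_in \<subseteq> Omega G {v}"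
    proof
      fix w assume w: "w \<in> vertices_in"
      have "v \<notin> vertices_in" using v(1) by (simp add: breaking_vertices_of_def)
      then have "\<not> path_ge G w v" "w \<noteq> v"
        using path_ge_hereditary[of w v vertices_in] vertices_hereditary w by auto
      then show "w \<in> Omega G {v}" using w by (auto simp: Omega_def vertices_in_def)
    qed
  qed
  moreover have "v \<in> breaking_vertices G"
    using breaking_vertices_of_Omega[of v] v(1) Omega by (simp add: breaking_vertices_of_def)
  ultimately show ?thesis
    using ideal_is_generated[OF K] by metis
qed

end

section \<open>Maximal tails and breaking vertices give prime ideals\<close>

context leavitt_ideal
begin

text \<open>
  Adding \<open>J\<close> to two ideals whose product is in \<open>J\<close> does not change this property.  A common element \<open>z\<close> with
  \<open>z z = z\<close> modulo \<open>J\<close> then has to be in \<open>J\<close>.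
\<close>

lemma leavitt_primeI:
  assumes proper: "J \<noteq> const_free"
    and common: "\<And>J1 J2. \<lbrakk>leavitt_ideal G J1; leavitt_ideal G J2; J \<subseteq> J1; J \<subseteq> J2; \<not> J1 \<subseteq> J; \<not> J2 \<subseteq> J\<rbrakk> \<Longrightarrow>
      \<exists>z\<in>J1 \<inter> J2. z \<notin> J \<and> z * z \<approx> z"
  shows "leavitt_prime G J"
  unfolding leavitt_prime_def
proof (intro conjI allI impI leavitt_ideal_axioms proper)
  interpret C: type_ideal "const_free :: ('v, 'e, 'k) lpa_poly set" by (rule type_ideal_const_free)
  have plus: "leavitt_ideal G (ideal_plus I J)"
      "J \<subseteq> ideal_plus I J" "I \<subseteq> ideal_plus I J"
    if I: "leavitt_ideal G I" for I
  proof -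
    interpret I: leavitt_ideal G I by (rule I)
    show sub: "J \<subseteq> ideal_plus I J"
    proof
      fix y assume "y \<in> J"
      then show "y \<in> ideal_plus I J"
        using I.zero_mem by (intro CollectI exI[of _ 0] exI[of _ y]) simp
    qed
    show "I \<subseteq> ideal_plus I J"
    proof
      fix x assume "x \<in> I"
      then show "x \<in> ideal_plus I J"
        using zero_mem by (intro CollectI exI[of _ x] exI[of _ 0]) simp
    qed
    have "ideal_plus I J \<subseteq> const_free"
      using I.const_free const_free C.add_mem by blast
    then show "leavitt_ideal G (ideal_plus I J)"
      by (rule leavitt_superset[OF type_ideal_sum[OF I.type_ideal_axioms type_ideal_axioms] sub])
  qed
  fix J1 J2
  assume J12: "leavitt_ideal G J1 \<and> leavitt_ideal G J2 \<and> (\<forall>f\<in>J1. \<forall>g\<in>J2. f * g \<in> J)"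
  show "J1 \<subseteq> J \<or> J2 \<subseteq> J"
  proof (rule ccontr)
    assume not: "\<not> (J1 \<subseteq> J \<or> J2 \<subseteq> J)"
    have J1: "leavitt_ideal G J1" and J2: "leavitt_ideal G J2" using J12 by auto
    let ?L1 = "ideal_plus J1 J" and ?L2 = "ideal_plus J2 J"
    have "\<not> ?L1 \<subseteq> J" "\<not> ?L2 \<subseteq> J"
      using not plus(3)[OF J1] plus(3)[OF J2] by blast+
    then obtain z where z: "z \<in> ?L1" "z \<in> ?L2" "z \<notin> J" "z * z \<approx> z"
      using common[OF plus(1)[OF J1] plus(1)[OF J2] plus(2)[OF J1] plus(2)[OF J2]] by blast
    obtain a i where a: "z = a + i" "a \<in> J1" "i \<in> J" using z(1) by blast
    obtain b j where b: "z = b + j" "b \<in> J2" "j \<in> J" using z(2) by blast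
    have "z * z = a * b + (a * j + i * z)"
      by (subst (1) a(1), subst (2) b(1)) (simp add: b(1) algebra_simps)
    moreover have "a * b \<in> J" using J12 a(2) b(2) by blast
    moreover have "a * j + i * z \<in> J"
      by (rule add_mem[OF mult_left_mem[OF b(3)] mult_right_mem[OF a(3)]])
    ultimately have "z * z \<in> J" using add_mem by simp
    then show False using z(3) eqv_mem_iff[OF z(4)] by simp
  qed
qed

end

context
  fixes G :: "('v, 'e) pre_digraph" and k :: "'k::field itself"
  assumes wf: "wf_digraph G" and arcs: "countable (arcs G)" and K: "condition_K G"
begin

interpretation wf_digraph G by (rule wf)

text \<open>
  Two larger ideals contain vertices of the tail by the reduction theorem, since no breaking element
  is left over.  By (MT3) they contain a common vertex of the tail.
\<close>

lemma maximal_tail_prime: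
  assumes M: "maximal_tail G M"
  shows "leavitt_prime G (leavitt_generated G (Omega G M) (breaking_vertices_of G (Omega G M))
    :: ('v, 'e, 'k) lpa_poly set)" (is "leavitt_prime G ?Q")
proof -
  let ?H = "Omega G M"
  have MT: "M \<noteq> {}" "M \<subseteq> verts G"
    "\<And>v w. v \<in> verts G \<Longrightarrow> w \<in> M \<Longrightarrow> path_ge G v w \<Longrightarrow> v \<in> M"
    "\<And>v. v \<in> M \<Longrightarrow> regular_vertex G v \<Longrightarrow> \<exists>e\<in>out_arcs G v. head G e \<in> M"
    "\<And>v w. v \<in> M \<Longrightarrow> w \<in> M \<Longrightarrow> \<exists>y\<in>M. path_ge G v y \<and> path_ge G w y"
    using M unfolding maximal_tail_def by auto
  have H: "?H = verts G - M" by (rule Omega_maximal_tail[OF M])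
  interpret B: branching_system G ?H "breaking_vertices_of G ?H"
  proof
    show "countable (arcs G)" by (rule arcs)
    show "head G e \<in> ?H" if "e \<in> arcs G" "tail G e \<in> ?H" for e
      using that MT(3)[of "tail G e" "head G e"] path_ge_arc[of e] by (auto simp: H)
    show "\<exists>e\<in>out_arcs G v. head G e \<notin> ?H" if "regular_vertex G v" "v \<notin> ?H" for v
      using MT(4)[of v] that by (auto simp: H regular_vertex_def)
  qed simp
  interpret Q: leavitt_ideal G ?Q by (rule leavitt_generated_ideal[OF wf])
  have notin: "vx v \<notin> ?Q" if "v \<in> M" for v
    using B.vx_not_generated[of v] that MT(2) by (auto simp: H)
  show ?thesis
  proof (rule Q.leavitt_primeI)
    obtain v where "v \<in> M" using MT(1) by blast
    then have "vx v \<notin> ?Q" by (rule notin)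
    then show "?Q \<noteq> const_free" using gen_const_free[of "Vertex v"] by metis
    fix J1 J2 :: "('v, 'e, 'k) lpa_poly set"
    assume J: "leavitt_ideal G J1" "leavitt_ideal G J2" "?Q \<subseteq> J1" "?Q \<subseteq> J2" "\<not> J1 \<subseteq> ?Q" "\<not> J2 \<subseteq> ?Q"
    have vertex: "\<exists>w\<in>M. vx w \<in> L" if L: "leavitt_ideal G L" "?Q \<subseteq> L" "\<not> L \<subseteq> ?Q" for L
    proof -
      have "(\<exists>w\<in>verts G - ?H. vx w \<in> L) \<or>
        (\<exists>w\<in>breaking_vertices_of G ?H - breaking_vertices_of G ?H. breaking_elem G ?H w \<in> L)"
        by (rule Q.reduction[OF K L leavitt_generated_mem])
      then show ?thesis by (auto simp: H)
    qed
    obtain v w where vw: "v \<in> M" "vx v \<in> J1" "w \<in> M" "vx w \<in> J2"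
      using vertex[OF J(1,3,5)] vertex[OF J(2,4,6)] by blast
    obtain y where y: "y \<in> M" "path_ge G v y" "path_ge G w y"
      using MT(5)[OF vw(1,3)] by blast
    have "vx y \<in> J1 \<inter> J2"
      using leavitt_ideal.path_ge_mem[OF J(1) y(2) vw(2)] leavitt_ideal.path_ge_mem[OF J(2) y(3) vw(4)]
      by blast
    moreover have "Q.eqv (vx y * vx y) (vx y)" using Q.vx_mult_vx[of y y] by simp
    ultimately show "\<exists>z\<in>J1 \<inter> J2. z \<notin> ?Q \<and> Q.eqv (z * z) z"
      using notin[OF y(1)] by blast
  qed
qed

text \<open>
  Two larger ideals contain \<open>v\<^sup>H\<close>: the reduction theorem provides \<open>v\<^sup>H\<close> itself or a vertex outside
  \<open>\<Omega>(v)\<close>, and such a vertex reaches \<open>v\<close>.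
\<close>

lemma breaking_vertex_prime:
  assumes v: "v \<in> breaking_vertices G"
  shows "leavitt_prime G (leavitt_generated G (Omega G {v}) (breaking_vertices_of G (Omega G {v}) - {v})
    :: ('v, 'e, 'k) lpa_poly set)" (is "leavitt_prime G ?Q")
proof -
  let ?H = "Omega G {v}"
  have inf: "v \<in> verts G" "infinite (out_arcs G v)"
    using v by (auto simp: breaking_vertices_def)
  have vB: "v \<in> breaking_vertices_of G ?H"
    using breaking_vertices_of_Omega[OF inf] v by simp
  have H: "w \<in> ?H \<longleftrightarrow> w \<in> verts G \<and> \<not> path_ge G w v" for w
  proof (cases "w = v")
    case True
    have "path_ge G v v" by (rule path_ge_refl[OF inf(1)])
    then show ?thesis using True by (simp add: Omega_def)
  next
    case False
    then show ?thesis by (simp add: Omega_def)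
  qed
  interpret B: branching_system G ?H "breaking_vertices_of G ?H - {v}"
  proof
    show "countable (arcs G)" by (rule arcs)
    show "head G e \<in> ?H" if "e \<in> arcs G" "tail G e \<in> ?H" for e
      using that path_ge_trans[OF path_ge_arc[OF that(1)], of v] by (auto simp: H)
    show "\<exists>e\<in>out_arcs G w. head G e \<notin> ?H" if w: "regular_vertex G w" "w \<notin> ?H" for w
    proof -
      have "path_ge G w v" "w \<noteq> v" using w inf(2) by (auto simp: H regular_vertex_def)
      then obtain e where "e \<in> out_arcs G w" "path_ge G (head G e) v"
        by (rule path_ge_first_arc)
      then show ?thesis by (auto simp: H)
    qed
  qed blast
  interpret Q: leavitt_ideal G ?Q by (rule leavitt_generated_ideal[OF wf])
  let ?b = "breaking_elem G ?H v :: ('v, 'e, 'k) lpa_poly"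
  have b: "?b \<notin> ?Q" by (rule B.breaking_elem_not_generated) (use vB in blast)
  show ?thesis
  proof (rule Q.leavitt_primeI)
    show "?Q \<noteq> const_free" using b breaking_elem_const_free[of G ?H v] by metis
    fix J1 J2 :: "('v, 'e, 'k) lpa_poly set"
    assume J: "leavitt_ideal G J1" "leavitt_ideal G J2" "?Q \<subseteq> J1" "?Q \<subseteq> J2" "\<not> J1 \<subseteq> ?Q" "\<not> J2 \<subseteq> ?Q"
    have mem: "?b \<in> L" if L: "leavitt_ideal G L" "?Q \<subseteq> L" "\<not> L \<subseteq> ?Q" for L
    proof -
      interpret L: leavitt_ideal G L by (rule L(1))
      have "(\<exists>w\<in>verts G - ?H. vx w \<in> L) \<or>
        (\<exists>w\<in>breaking_vertices_of G ?H - (breaking_vertices_of G ?H - {v}). breaking_elem G ?H w \<in> L)"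
        by (rule Q.reduction[OF K L leavitt_generated_mem])
      then show ?thesis
      proof
        assume "\<exists>w\<in>verts G - ?H. vx w \<in> L"
        then obtain w where "path_ge G w v" "vx w \<in> L" by (auto simp: H)
        then have "vx v \<in> L" by (rule L.path_ge_mem)
        then have "?b * vx v \<in> L" by (rule L.mult_left_mem)
        then show ?thesis using L.eqv_mem_iff[OF L.breaking_elem_vx] by blast
      qed auto
    qed
    have "Q.eqv (?b * ?b) ?b" by (rule Q.breaking_elem_idem[OF vB])
    then show "\<exists>z\<in>J1 \<inter> J2. z \<notin> ?Q \<and> Q.eqv (z * z) z"
      using b mem[OF J(1,3,5)] mem[OF J(2,4,6)] by (intro bexI[of _ ?b] conjI IntI)
  qed
qed

lemma leavitt_primes_eq:
  "{Q :: ('v, 'e, 'k) lpa_poly set. leavitt_prime G Q} =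
     {leavitt_generated G (Omega G M) (breaking_vertices_of G (Omega G M)) | M. maximal_tail G M} \<union>
     {leavitt_generated G (Omega G {v}) (breaking_vertices_of G (Omega G {v}) - {v}) | v. v \<in> breaking_vertices G}"
  (is "_ = ?A \<union> ?B")
proof (intro equalityI Un_least subsetI)
  fix Q :: "('v, 'e, 'k) lpa_poly set"
  assume "Q \<in> {Q. leavitt_prime G Q}"
  then have Q: "leavitt_prime G Q" "leavitt_ideal G Q" by (simp_all add: leavitt_prime_def)
  from leavitt_ideal.prime_is_generated[OF Q(2) K Q(1)] show "Q \<in> ?A \<union> ?B"
    unfolding Un_iff mem_Collect_eq by metis
next
  fix Q assume "Q \<in> ?A"
  then show "Q \<in> {Q. leavitt_prime G Q}"
    by (elim CollectE exE conjE) (simp add: maximal_tail_prime)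
next
  fix Q assume "Q \<in> ?B"
  then show "Q \<in> {Q. leavitt_prime G Q}"
    by (elim CollectE exE conjE) (simp add: breaking_vertex_prime)
qed

text \<open>
  If an ideal does not contain all vertices, some maximal tail is disjoint from it.  If the ideal contains a
  vertex, this tail is proper.  An ideal without vertices is generated by the empty set, since no vertex is breaking for
  the empty set.
\<close>

lemma simple_if_no_proper_tails:
  assumes "verts G \<noteq> {}" and no_tail: "\<nexists>M. maximal_tail G M \<and> M \<subset> verts G"
  shows "simple_ring (lpa k G)"
proof -
  interpret B: branching_system G "{}" "{}"
    by unfold_locales (auto simp: arcs regular_vertex_def)
  obtain v where v: "v \<in> verts G" using assms(1) by blast
  show ?thesis
  proof (rule simple_lpaI[OF wf v])
    show "vx v \<notin> (leavitt_generated G {} {} :: ('v, 'e, 'k) lpa_poly set)"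
      by (rule B.vx_not_generated) (use v in simp)
    fix J :: "('v, 'e, 'k) lpa_poly set"
    assume J: "leavitt_ideal G J"
    interpret J: leavitt_ideal G J by (rule J)
    show "J = leavitt_generated G {} {} \<or> J = const_free"
    proof (cases "verts G \<subseteq> J.vertices_in")
      case True
      then show ?thesis using J.all_vertices by blast
    next
      case False
      then obtain u where u: "u \<in> verts G" "u \<notin> J.vertices_in" by blast
      obtain M where M: "maximal_tail G M" "M \<inter> J.vertices_in = {}"
        by (rule exists_maximal_tail[OF J.vertices_hereditary J.vertices_saturated u])
      have "M = verts G"
        using no_tail M(1) unfolding maximal_tail_def by blast
      then have empty: "J.vertices_in = {}"
        using M(2) by (auto simp: J.vertices_in_def)
      have "{e \<in> out_arcs G w. head G e \<in> verts G - {}} = out_arcs G w" for w by auto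
      then have "breaking_vertices_of G {} = {}"
        unfolding breaking_vertices_of_def by (simp only:) blast
      then have "J.breaking_in = {}"
        by (simp add: J.breaking_in_def empty)
      then show ?thesis
        using J.ideal_is_generated[OF K] empty by simp
    qed
  qed
qed

end

lemma Omega_subset: "Omega G X \<subseteq> verts G"
  by (auto simp: Omega_def)

lemma breaking_vertices_of_subset: "breaking_vertices_of G H \<subseteq> verts G"
  by (auto simp: breaking_vertices_of_def)

theorem corollary4p13:
  fixes G :: "('v, 'e) pre_digraph"
  assumes "wf_digraph G"
    and "countable (verts G)" and "countable (arcs G)" and "verts G \<noteq> {}"
    and "condition_K G"
  shows "{P. prime_ideal (lpa TYPE('k::field) G) P} =
           {lpa_ideal TYPE('k) G (Omega G M) (breaking_vertices_of G (Omega G M)) | M.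
              maximal_tail G M} \<union>
           {lpa_ideal TYPE('k) G (Omega G {v}) (breaking_vertices_of G (Omega G {v}) - {v}) | v.
              v \<in> breaking_vertices G}
       \<and> ((\<nexists>M. maximal_tail G M \<and> M \<subset> verts G) \<and> breaking_vertices G = {} \<longrightarrow>
            simple_ring (lpa TYPE('k) G))"
proof (intro conjI impI)
  have ideal: "lpa_ideal TYPE('k) G (Omega G X) (breaking_vertices_of G (Omega G X) - Y) =
      image_ideal G (leavitt_generated G (Omega G X) (breaking_vertices_of G (Omega G X) - Y))" for X Y
    using breaking_vertices_of_subset[of G "Omega G X"]
    by (intro lpa_ideal_eq_image_ideal[OF assms(1)] Omega_subset) blast
  have ideal': "lpa_ideal TYPE('k) G (Omega G X) (breaking_vertices_of G (Omega G X)) =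
      image_ideal G (leavitt_generated G (Omega G X) (breaking_vertices_of G (Omega G X)))" for X
    using ideal[of X "{}"] by simp
  show "{P. prime_ideal (lpa TYPE('k) G) P} =
           {lpa_ideal TYPE('k) G (Omega G M) (breaking_vertices_of G (Omega G M)) | M.
              maximal_tail G M} \<union>
           {lpa_ideal TYPE('k) G (Omega G {v}) (breaking_vertices_of G (Omega G {v}) - {v}) | v.
              v \<in> breaking_vertices G}"
    unfolding prime_ideals_eq[OF assms(1)] leavitt_primes_eq[OF assms(1,3,5)] ideal ideal'
      image_Un setcompr_eq_image image_image ..
  assume "(\<nexists>M. maximal_tail G M \<and> M \<subset> verts G) \<and> breaking_vertices G = {}"
  then show "simple_ring (lpa TYPE('k) G)"
    using simple_if_no_proper_tails[OF assms(1,3,5,4)] by blast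
qed

end
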